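(* Let $1<p\le\infty$. The class $\mathcal{D}_p^{LipL}$ is the Banach Lip-linear ideal generated by the composition method from the Banach linear operator ideal $\mathcal{D}_p$. In other words, $$\mathcal{D}_p^{LipL}(X\times E;F)=\mathcal{D}_p\circ LipL_0(X\times E;F)$$ for all pointed metric spaces $X$ and Banach spaces $E,F$.
   Context: Banach spaces are real; $B_E$ is the closed unit ball of $E$, $E^*$ the dual, and $1/p+1/p^*=1$. For an exponent $\infty$ the expression $(\sum|a_i|^p)^{1/p}$ means $\max|a_i|$. A pointed metric space $X$ has a metric $d$ and a base point $0$; $X^{\#}$ is the space of real Lipschitz functions on $X$ vanishing at $0$, and $Lip_0(X;X_0)$ the set of base-point preserving Lipschitz maps, with Lipschitz constant $Lip(f)$. Lip-linear operators: $T:X\times E\to F$ is Lip-linear if $T(x,\cdot)$ is linear for each $x\in X$ and there is $C>0$ with $\|T(x,e)-T(y,e)\|\le C\,d(x,y)\|e\|$ for all $x,y\in X$, $e\in E$. $LipL_0(X\times E;F)$ is the Banach space of Lip-linear operators with $T(0,e)=0$ for all $e$, normed by $LipL(T)$, the infimum of such $C$. $\mathcal{D}_p^{LipL}(X\times E;F)$ (Cohen strongly $p$-summing operators) is the set of $T\in LipL_0(X\times E;F)$ for which there is $C>0$ such that for all finite families $x_i,y_i\in X$, $e_i\in E$, $z_i^*\in F^*$, $$\sum_{i=1}^n|\langle T(x_i,e_i)-T(y_i,e_i),z_i^*\rangle|\le C\Big(\sum_{i=1}^n(d(x_i,y_i)\|e_i\|)^p\Big)^{1/p}\sup_{z^{**}\in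 B_{F^{**}}}\Big(\sum_{i=1}^n|z^{**}(z_i^* )|^{p^*}\Big)^{1/p^*};$$ $d_p^{LipL}(T)$ is the infimum of such $C$. $\mathcal{D}_p(G;F)$ (strongly $p$-summing linear operators) is the set of bounded linear $u:G\to F$ for which there is $C>0$ with $\sum_{i=1}^n|\langle u(g_i),z_i^*\rangle|\le C(\sum_{i=1}^n\|g_i\|^p)^{1/p}\sup_{z^{**}\in B_{F^{**}}}(\sum_{i=1}^n|z^{**}(z_i^* )|^{p^*})^{1/p^*}$ for all finite families $g_i\in G$, $z_i^*\in F^*$; $d_p(u)$ is the infimum of such $C$. Composition method: for a Banach operator ideal $(\mathcal{I},\|\cdot\|_{\mathcal I})$, $\mathcal{I}\circ LipL_0(X\times E;F)$ is the set of $T\in LipL_0(X\times E;F)$ of the form $T=u\circ S$ with $G$ a Banach space, $S\in LipL_0(X\times E;G)$ and $u\in\mathcal{I}(G;F)$; its norm is $\|T\|_{\mathcal{I}\circ LipL_0}=\inf\{\|u\|_{\mathcal I}LipL(S):T=u\circ S\}$. The Lip-linear ideal generated by the composition method from $\mathcal I$ is $\mathcal{I}\circ LipL_0$ with this norm. A Banach Lip-linear ideal is a subclass $\mathcal{I}^{LipL}$ of $LipL_0$ with a function $\|\cdot\|_{\mathcal{I}^{LipL}}\ge 0$ such that, for all $X,E,F$, the component $\mathcal{I}^{LipL}(X\times E;F)$ is a vector subspace of $LipL_0(X\times E;F)$ containing all maps $(x,e)\mapsto f(x)e^*(e)z$ ($f\in X^{\#}$, $e^*\in E^*$, $z\in F$),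 is a Banach space under $\|\cdot\|_{\mathcal{I}^{LipL}}$ with $LipL(T)\le\|T\|_{\mathcal{I}^{LipL}}$; the map $\mathbb{R}\times\mathbb{R}\to\mathbb{R}$, $(\alpha,\beta)\mapsto\alpha\beta$, has norm $1$; and for $f\in Lip_0(X;X_0)$, $v\in\mathcal{L}(E;E_0)$, $T\in\mathcal{I}^{LipL}(X_0\times E_0;F_0)$, $u\in\mathcal{L}(F_0;F)$ one has $u\circ T\circ(f,v)\in\mathcal{I}^{LipL}(X\times E;F)$ with norm at most $\|u\|\,\|T\|_{\mathcal{I}^{LipL}}Lip(f)\|v\|$. *)

theory Defs
  imports
    "HOL-Analysis.Abstract_Metric_Spaces"
    "HOL-Algebra.Module"
    "HOL-Library.Extended_Real"
begin

text \<open>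
  The notions below quantify over all Banach spaces (the intermediate space of a factorization) and
  over all components of an operator ideal. Neither is possible inside a formula if spaces are types,
  so spaces are structures with a carrier inside an arbitrary type \<open>'u\<close>, which acts as a
  universe. A set of spaces given on different types can be transported into one common type, so
  a statement that holds for every \<open>'u\<close> covers all spaces. Maps are extensional functions
  (\<open>undefined\<close> outside of their domain), so that equality is equality on the domain.
\<close>


section \<open>Normed and Banach spaces with carriers\<close>

definition real_ring :: "real ring" where
  "real_ring = \<lparr>carrier = UNIV, monoid.mult = (*), one = 1, zero = 0, add = (+)\<rparr>"

lemma cring_real_ring: "cring real_ring"
proof (rule cringI)
  show "abelian_group real_ring"
    by (rule abelian_groupI) (auto simp: real_ring_def intro: exI[of _ "- x" for x])
  show "comm_monoid real_ring"
    by (rule comm_monoidI) (auto simp: real_ring_def)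
qed (auto simp: real_ring_def algebra_simps)

text \<open>The fields \<open>mult\<close> and \<open>one\<close> inherited from the library's modules
  play no role.\<close>

record 'v nspace = "(real, 'v) module" +
  nrm :: "'v \<Rightarrow> real"

locale normed_space = Module.module real_ring V for V :: "'v nspace" (structure) +
  assumes nrm_nonneg: "v \<in> carrier V \<Longrightarrow> 0 \<le> nrm V v"
    and nrm_eq_0: "v \<in> carrier V \<Longrightarrow> nrm V v = 0 \<longleftrightarrow> v = \<zero>"
    and nrm_smult: "v \<in> carrier V \<Longrightarrow> nrm V (c \<odot> v) = \<bar>c\<bar> * nrm V v"
    and nrm_triangle:
      "\<lbrakk>v \<in> carrier V; w \<in> carrier V\<rbrakk> \<Longrightarrow> nrm V (v \<oplus> w) \<le> nrm V v + nrm V w"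

text \<open>The type of metrics requires symmetry and nonnegativity also off the carrier, hence the
  case distinction.\<close>

definition norm_metric :: "'v nspace \<Rightarrow> 'v metric" where
  "norm_metric V = metric (carrier V,
     \<lambda>v w. if v \<in> carrier V \<and> w \<in> carrier V then nrm V (v \<ominus>\<^bsub>V\<^esub> w) else 0)"

definition banach_space :: "'v nspace \<Rightarrow> bool" where
  "banach_space V \<longleftrightarrow> normed_space V \<and> mcomplete_of (norm_metric V)"

definition nspace_of_type :: "'a::real_normed_vector nspace" where
  "nspace_of_type = \<lparr>carrier = UNIV, monoid.mult = undefined, one = undefined, zero = 0, add = (+),
     Module.module.smult = (*\<^sub>R), nrm = norm\<rparr>"

lemma banach_space_nspace_of_type: "banach_space (nspace_of_type :: 'a::banach nspace)"
proof -
  let ?V = "nspace_of_type :: 'a nspace"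
  have "\<exists>y. y + x = 0" for x :: 'a
    by (rule exI[of _ "- x"]) simp
  then have ag: "abelian_group ?V"
    by (intro abelian_groupI) (auto simp: nspace_of_type_def add_ac)
  then interpret Module.module real_ring ?V
    by (intro Module.moduleI cring_real_ring)
       (auto simp: nspace_of_type_def real_ring_def scaleR_add_left scaleR_add_right)
  have "normed_space ?V"
    by unfold_locales (auto simp: nspace_of_type_def norm_triangle_ineq)
  moreover have "\<ominus>\<^bsub>?V\<^esub> w = - w" for w :: 'a
    by (rule minus_equality) (auto simp: nspace_of_type_def)
  then have "v \<ominus>\<^bsub>?V\<^esub> w = v - w" for v w :: 'a
    by (simp add: a_minus_def) (simp add: nspace_of_type_def)
  then have "norm_metric ?V = euclidean_metric"
    by (simp add: norm_metric_def euclidean_metric_def)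
       (simp add: nspace_of_type_def dist_norm[abs_def])
  then have "mcomplete_of (norm_metric ?V)"
    by (simp add: mcomplete_of_def complete_UNIV)
  ultimately show ?thesis
    by (simp add: banach_space_def)
qed

abbreviation real_line :: "real nspace" where
  "real_line \<equiv> nspace_of_type"

definition fun_nspace :: "'a set \<Rightarrow> 'w nspace \<Rightarrow> ('a \<Rightarrow> 'w) set \<Rightarrow> (('a \<Rightarrow> 'w) \<Rightarrow> real) \<Rightarrow> ('a \<Rightarrow> 'w) nspace"
  where
  "fun_nspace A W M N = \<lparr>carrier = M, monoid.mult = undefined, one = undefined,
     zero = (\<lambda>a\<in>A. \<zero>\<^bsub>W\<^esub>),
     add = (\<lambda>f g. \<lambda>a\<in>A. f a \<oplus>\<^bsub>W\<^esub> g a),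
     Module.module.smult = (\<lambda>c f. \<lambda>a\<in>A. c \<odot>\<^bsub>W\<^esub> f a),
     nrm = N\<rparr>"


section \<open>Bounded linear operators and duals\<close>

definition linear_on :: "'v nspace \<Rightarrow> 'w nspace \<Rightarrow> ('v \<Rightarrow> 'w) \<Rightarrow> bool" where
  "linear_on V W u \<longleftrightarrow>
     u \<in> carrier V \<rightarrow> carrier W \<and>
     (\<forall>v\<in>carrier V. \<forall>v'\<in>carrier V. u (v \<oplus>\<^bsub>V\<^esub> v') = u v \<oplus>\<^bsub>W\<^esub> u v') \<and>
     (\<forall>c. \<forall>v\<in>carrier V. u (c \<odot>\<^bsub>V\<^esub> v) = c \<odot>\<^bsub>W\<^esub> u v)"

definition unit_ball :: "'v nspace \<Rightarrow> 'v set" where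
  "unit_ball V = {v \<in> carrier V. nrm V v \<le> 1}"

definition blin :: "'v nspace \<Rightarrow> 'w nspace \<Rightarrow> ('v \<Rightarrow> 'w) nspace" where
  "blin V W = fun_nspace (carrier V) W
     {u \<in> extensional (carrier V). linear_on V W u \<and>
        (\<exists>C. \<forall>v\<in>carrier V. nrm W (u v) \<le> C * nrm V v)}
     (\<lambda>u. SUP v\<in>unit_ball V. nrm W (u v))"

abbreviation dual :: "'v nspace \<Rightarrow> ('v \<Rightarrow> real) nspace" where
  "dual V \<equiv> blin V real_line"


section \<open>Pointed metric spaces and Lipschitz maps\<close>

record 'x pmspace =
  met :: "'x metric"
  base :: 'x

abbreviation pts :: "'x pmspace \<Rightarrow> 'x set" where
  "pts X \<equiv> mspace (met X)"

abbreviation pdist :: "'x pmspace \<Rightarrow> 'x \<Rightarrow> 'x \<Rightarrow> real" where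
  "pdist X \<equiv> mdist (met X)"

definition pointed_metric_space :: "'x pmspace \<Rightarrow> bool" where
  "pointed_metric_space X \<longleftrightarrow> base X \<in> pts X"

definition Lip0 :: "'x pmspace \<Rightarrow> 'y pmspace \<Rightarrow> ('x \<Rightarrow> 'y) set" where
  "Lip0 X Y = {f. Lipschitz_continuous_map (met X) (met Y) f \<and> f (base X) = base Y}"

definition Lip :: "'x pmspace \<Rightarrow> 'y pmspace \<Rightarrow> ('x \<Rightarrow> 'y) \<Rightarrow> real" where
  "Lip X Y f = Inf {C. 0 \<le> C \<and> (\<forall>x\<in>pts X. \<forall>y\<in>pts X. pdist Y (f x) (f y) \<le> C * pdist X x y)}"

text \<open>The space of real Lipschitz functions vanishing at the base point.\<close>

definition sharp :: "'x pmspace \<Rightarrow> ('x \<Rightarrow> real) set" where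
  "sharp X = Lip0 X \<lparr>met = euclidean_metric, base = 0\<rparr>"


section \<open>Lip-linear operators\<close>

definition LipL_bound ::
  "'x pmspace \<Rightarrow> 'e nspace \<Rightarrow> 'f nspace \<Rightarrow> ('x \<times> 'e \<Rightarrow> 'f) \<Rightarrow> real \<Rightarrow> bool" where
  "LipL_bound X E F T C \<longleftrightarrow>
     (\<forall>x\<in>pts X. \<forall>y\<in>pts X. \<forall>e\<in>carrier E.
        nrm F (T (x, e) \<ominus>\<^bsub>F\<^esub> T (y, e)) \<le> C * pdist X x y * nrm E e)"

definition LipL_norm ::
  "'x pmspace \<Rightarrow> 'e nspace \<Rightarrow> 'f nspace \<Rightarrow> ('x \<times> 'e \<Rightarrow> 'f) \<Rightarrow> real" where
  "LipL_norm X E F T = Inf {C. 0 < C \<and> LipL_bound X E F T C}"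

definition LipL0 :: "'x pmspace \<Rightarrow> 'e nspace \<Rightarrow> 'f nspace \<Rightarrow> ('x \<times> 'e \<Rightarrow> 'f) nspace" where
  "LipL0 X E F = fun_nspace (pts X \<times> carrier E) F
     {T \<in> extensional (pts X \<times> carrier E).
        (\<forall>x\<in>pts X. linear_on E F (\<lambda>e. T (x, e))) \<and>
        (\<exists>C>0. LipL_bound X E F T C) \<and>
        (\<forall>e\<in>carrier E. T (base X, e) = \<zero>\<^bsub>F\<^esub>)}
     (LipL_norm X E F)"


section \<open>Strongly summing operators\<close>

text \<open>The exponent $p^*$ with $1/p + 1/p^* = 1$, for $1 < p \le \infty$.\<close>

definition conj_exp :: "ereal \<Rightarrow> ereal" where
  "conj_exp p = (if p = \<infinity> then 1 else ereal (real_of_ereal p / (real_of_ereal p - 1)))"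

lemma conj_exp: "1 / p + 1 / conj_exp p = 1" if "1 < p" for p :: ereal
  using that
  by (cases p) (auto simp: conj_exp_def one_ereal_def divide_ereal_def field_simps)

definition lp_norm :: "ereal \<Rightarrow> nat \<Rightarrow> (nat \<Rightarrow> real) \<Rightarrow> real" where
  "lp_norm p n a =
     (if p = \<infinity> then Max (insert 0 ((\<lambda>i. \<bar>a i\<bar>) ` {..<n}))
      else (\<Sum>i<n. \<bar>a i\<bar> powr real_of_ereal p) powr (1 / real_of_ereal p))"

definition weak_norm :: "ereal \<Rightarrow> 'f nspace \<Rightarrow> nat \<Rightarrow> (nat \<Rightarrow> 'f \<Rightarrow> real) \<Rightarrow> real" where
  "weak_norm q F n z = (SUP \<phi>\<in>unit_ball (dual (dual F)). lp_norm q n (\<lambda>i. \<phi> (z i)))"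

definition strongly_summing_bound ::
  "ereal \<Rightarrow> 'g nspace \<Rightarrow> 'f nspace \<Rightarrow> ('g \<Rightarrow> 'f) \<Rightarrow> real \<Rightarrow> bool" where
  "strongly_summing_bound p G F u C \<longleftrightarrow>
     (\<forall>n g z. (\<forall>i<n. g i \<in> carrier G \<and> z i \<in> carrier (dual F)) \<longrightarrow>
        (\<Sum>i<n. \<bar>z i (u (g i))\<bar>)
          \<le> C * lp_norm p n (\<lambda>i. nrm G (g i)) * weak_norm (conj_exp p) F n z)"

definition strongly_summing :: "ereal \<Rightarrow> 'g nspace \<Rightarrow> 'f nspace \<Rightarrow> ('g \<Rightarrow> 'f) set" where
  "strongly_summing p G F = {u \<in> carrier (blin G F). \<exists>C>0. strongly_summing_bound p G F u C}"

definition strongly_summing_norm :: "ereal \<Rightarrow> 'g nspace \<Rightarrow> 'f nspace \<Rightarrow> ('g \<Rightarrow> 'f) \<Rightarrow> real" where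
  "strongly_summing_norm p G F u = Inf {C. 0 < C \<and> strongly_summing_bound p G F u C}"

definition cohen_LipL_bound ::
  "ereal \<Rightarrow> 'x pmspace \<Rightarrow> 'e nspace \<Rightarrow> 'f nspace \<Rightarrow> ('x \<times> 'e \<Rightarrow> 'f) \<Rightarrow> real \<Rightarrow> bool" where
  "cohen_LipL_bound p X E F T C \<longleftrightarrow>
     (\<forall>n x y e z.
        (\<forall>i<n. x i \<in> pts X \<and> y i \<in> pts X \<and> e i \<in> carrier E \<and> z i \<in> carrier (dual F)) \<longrightarrow>
        (\<Sum>i<n. \<bar>z i (T (x i, e i) \<ominus>\<^bsub>F\<^esub> T (y i, e i))\<bar>)
          \<le> C * lp_norm p n (\<lambda>i. pdist X (x i) (y i) * nrm E (e i)) * weak_norm (conj_exp p) F n z)"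

definition cohen_LipL ::
  "ereal \<Rightarrow> 'x pmspace \<Rightarrow> 'e nspace \<Rightarrow> 'f nspace \<Rightarrow> ('x \<times> 'e \<Rightarrow> 'f) set" where
  "cohen_LipL p X E F = {T \<in> carrier (LipL0 X E F). \<exists>C>0. cohen_LipL_bound p X E F T C}"

definition cohen_LipL_norm ::
  "ereal \<Rightarrow> 'x pmspace \<Rightarrow> 'e nspace \<Rightarrow> 'f nspace \<Rightarrow> ('x \<times> 'e \<Rightarrow> 'f) \<Rightarrow> real" where
  "cohen_LipL_norm p X E F T = Inf {C. 0 < C \<and> cohen_LipL_bound p X E F T C}"


section \<open>Classes of operators over a universe\<close>

text \<open>A class of operators is a pair of two families: its components, and the norms on them.\<close>

type_synonym 'u lin_class = "'u nspace \<Rightarrow> 'u nspace \<Rightarrow> ('u \<Rightarrow> 'u) set"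
type_synonym 'u lin_class_norm = "'u nspace \<Rightarrow> 'u nspace \<Rightarrow> ('u \<Rightarrow> 'u) \<Rightarrow> real"
type_synonym 'u LipL_class =
  "'u pmspace \<Rightarrow> 'u nspace \<Rightarrow> 'u nspace \<Rightarrow> ('u \<times> 'u \<Rightarrow> 'u) set"
type_synonym 'u LipL_class_norm =
  "'u pmspace \<Rightarrow> 'u nspace \<Rightarrow> 'u nspace \<Rightarrow> ('u \<times> 'u \<Rightarrow> 'u) \<Rightarrow> real"

definition factorization ::
  "'u lin_class \<Rightarrow> 'u pmspace \<Rightarrow> 'u nspace \<Rightarrow> 'u nspace \<Rightarrow> ('u \<times> 'u \<Rightarrow> 'u)
    \<Rightarrow> 'u nspace \<Rightarrow> ('u \<times> 'u \<Rightarrow> 'u) \<Rightarrow> ('u \<Rightarrow> 'u) \<Rightarrow> bool" where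
  "factorization I X E F T G S u \<longleftrightarrow>
     banach_space G \<and> S \<in> carrier (LipL0 X E G) \<and> u \<in> I G F \<and>
     T = compose (pts X \<times> carrier E) u S"

definition composition_ideal :: "'u lin_class \<Rightarrow> 'u LipL_class" where
  "composition_ideal I X E F =
     {T \<in> carrier (LipL0 X E F). \<exists>G S u. factorization I X E F T G S u}"

definition composition_ideal_norm :: "'u lin_class \<Rightarrow> 'u lin_class_norm \<Rightarrow> 'u LipL_class_norm" where
  "composition_ideal_norm I N X E F T =
     Inf {N G F u * LipL_norm X E G S | G S u. factorization I X E F T G S u}"

text \<open>The copies of the real line, as a pointed metric space and as a Banach space, along an
  injection of the reals into the universe. If there is no such injection, then the universe
  contains no Banach space other than the trivial ones.\<close>

definition real_pmspace_copy :: "(real \<Rightarrow> 'u) \<Rightarrow> 'u pmspace" where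
  "real_pmspace_copy j =
     \<lparr>met = metric (range j, \<lambda>a b. dist (the_inv j a) (the_inv j b)), base = j 0\<rparr>"

definition real_nspace_copy :: "(real \<Rightarrow> 'u) \<Rightarrow> 'u nspace" where
  "real_nspace_copy j = \<lparr>carrier = range j, monoid.mult = undefined, one = undefined,
     zero = j 0, add = (\<lambda>a b. j (the_inv j a + the_inv j b)), Module.module.smult = (\<lambda>c a. j (c * the_inv j a)),
     nrm = (\<lambda>a. \<bar>the_inv j a\<bar>)\<rparr>"

definition real_mult_copy :: "(real \<Rightarrow> 'u) \<Rightarrow> 'u \<times> 'u \<Rightarrow> 'u" where
  "real_mult_copy j = (\<lambda>(a, b)\<in>range j \<times> range j. j (the_inv j a * the_inv j b))"

definition banach_LipL_ideal :: "'u LipL_class \<Rightarrow> 'u LipL_class_norm \<Rightarrow> bool" where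
  "banach_LipL_ideal I N \<longleftrightarrow>
     (\<forall>X E F. pointed_metric_space X \<and> banach_space E \<and> banach_space F \<longrightarrow>
        submodule (I X E F) real_ring (LipL0 X E F) \<and>
        (\<forall>f\<in>sharp X. \<forall>\<phi>\<in>carrier (dual E). \<forall>z\<in>carrier F.
           (\<lambda>(x, e)\<in>pts X \<times> carrier E. (f x * \<phi> e) \<odot>\<^bsub>F\<^esub> z) \<in> I X E F) \<and>
        banach_space ((LipL0 X E F)\<lparr>carrier := I X E F, nrm := N X E F\<rparr>) \<and>
        (\<forall>T\<in>I X E F. LipL_norm X E F T \<le> N X E F T)) \<and>
     (\<forall>j. inj j \<longrightarrow>
        real_mult_copy j \<in> I (real_pmspace_copy j) (real_nspace_copy j) (real_nspace_copy j) \<and>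
        N (real_pmspace_copy j) (real_nspace_copy j) (real_nspace_copy j) (real_mult_copy j) = 1) \<and>
     (\<forall>X X\<^sub>0 E E\<^sub>0 F\<^sub>0 F f v T u.
        pointed_metric_space X \<and> pointed_metric_space X\<^sub>0 \<and>
        banach_space E \<and> banach_space E\<^sub>0 \<and> banach_space F\<^sub>0 \<and> banach_space F \<and>
        f \<in> Lip0 X X\<^sub>0 \<and> v \<in> carrier (blin E E\<^sub>0) \<and> T \<in> I X\<^sub>0 E\<^sub>0 F\<^sub>0 \<and> u \<in> carrier (blin F\<^sub>0 F) \<longrightarrow>
        (let uTfv = (\<lambda>(x, e)\<in>pts X \<times> carrier E. u (T (f x, v e))) in
           uTfv \<in> I X E F \<and>
           N X E F uTfv \<le> nrm (blin F\<^sub>0 F) u * N X\<^sub>0 E\<^sub>0 F\<^sub>0 T * Lip X X\<^sub>0 f * nrm (blin E E\<^sub>0) v))"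

end

theory Submission
  imports Defs
begin

text \<open>
  An operator \<open>u \<circ> S\<close> with \<open>u\<close> strongly \<open>p\<close>-summing is Cohen strongly \<open>p\<close>-summing: apply the
  inequality for \<open>u\<close> to the vectors \<open>S (x\<^sub>i, e\<^sub>i) \<ominus> S (y\<^sub>i, e\<^sub>i)\<close>, whose norms are at most
  \<open>LipL(S) d(x\<^sub>i, y\<^sub>i) \<parallel>e\<^sub>i\<parallel>\<close> (\<open>composition_cohen_bound\<close>).

  For the converse, let \<open>T\<close> be Cohen strongly \<open>p\<close>-summing with the constant \<open>C\<close>, and let \<open>K\<close> be the set
  of the differences \<open>T (x, e) \<ominus> T (y, e)\<close> with \<open>d(x, y) \<parallel>e\<parallel> \<le> 1\<close>. The intermediate space \<open>G\<close> is the
  subspace of \<open>F\<close> spanned by the bipolar of \<open>K\<close>, with this bipolar as unit ball. By construction \<open>T\<close> is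
  Lip-linear into \<open>G\<close> with constant 1, and it remains to see that the inclusion of \<open>G\<close> into \<open>F\<close> is
  strongly \<open>p\<close>-summing with the constant \<open>C\<close>. Since \<open>\<bar>z g\<bar> \<le> \<parallel>g\<parallel> sup\<^sub>K \<bar>z\<bar>\<close> for each functional \<open>z\<close>, and
  the supremum is almost attained at some element of \<open>K\<close>, the inequality for vectors \<open>g\<^sub>i\<close> of \<open>G\<close>
  follows from the one for \<open>T\<close> at points \<open>x\<^sub>i\<close>, \<open>y\<^sub>i\<close>, \<open>e\<^sub>i\<close> with \<open>d(x\<^sub>i, y\<^sub>i) \<parallel>e\<^sub>i\<parallel> \<le> \<parallel>g\<^sub>i\<parallel>\<close>
  (\<open>strongly_summing_inclusion\<close>).

  Usually one linearizes \<open>T\<close> on a completed tensor product of \<open>X\<close> and \<open>E\<close>. That space can have a larger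
  cardinality than the type on which \<open>X\<close>, \<open>E\<close> and \<open>F\<close> live, whereas \<open>G\<close> is a set of vectors of \<open>F\<close>.

  That the norm of \<open>G\<close> and the Cohen norm dominate the given norms, and are definite, rests on norming
  functionals, hence on the Hahn--Banach theorem, which is proved here for normed spaces with
  carriers. The other axioms of a Banach Lip-linear ideal follow from closure properties of the
  defining inequality: under pointwise limits (\<open>cohen_ball_closed\<close>), under composition
  (\<open>cohen_ideal_property\<close>), and from Hoelder's inequality for the operators of rank one.
\<close>


section \<open>Real vector spaces and normed spaces with carriers\<close>

lemma real_moduleI:
  fixes V :: "'v nspace" (structure)
  assumes "\<zero> \<in> carrier V"
    and "\<And>v w. \<lbrakk>v \<in> carrier V; w \<in> carrier V\<rbrakk> \<Longrightarrow> v \<oplus> w \<in> carrier V"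
    and "\<And>c v. v \<in> carrier V \<Longrightarrow> c \<odot> v \<in> carrier V"
    and "\<And>u v w. \<lbrakk>u \<in> carrier V; v \<in> carrier V; w \<in> carrier V\<rbrakk> \<Longrightarrow> (u \<oplus> v) \<oplus> w = u \<oplus> (v \<oplus> w)"
    and "\<And>v w. \<lbrakk>v \<in> carrier V; w \<in> carrier V\<rbrakk> \<Longrightarrow> v \<oplus> w = w \<oplus> v"
    and "\<And>v. v \<in> carrier V \<Longrightarrow> \<zero> \<oplus> v = v"
    and l_distr: "\<And>a b v. v \<in> carrier V \<Longrightarrow> (a + b) \<odot> v = a \<odot> v \<oplus> b \<odot> v"
    and "\<And>a v w. \<lbrakk>v \<in> carrier V; w \<in> carrier V\<rbrakk> \<Longrightarrow> a \<odot> (v \<oplus> w) = a \<odot> v \<oplus> a \<odot> w"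
    and "\<And>a b v. v \<in> carrier V \<Longrightarrow> (a * b) \<odot> v = a \<odot> (b \<odot> v)"
    and one: "\<And>v. v \<in> carrier V \<Longrightarrow> 1 \<odot> v = v"
    and null: "\<And>v. v \<in> carrier V \<Longrightarrow> 0 \<odot> v = \<zero>"
  shows "Module.module real_ring V"
proof (rule Module.moduleI[OF cring_real_ring])
  have "(- 1) \<odot> v \<oplus> v = \<zero>" if "v \<in> carrier V" for v
    using l_distr[of v "- 1" 1] one[of v] null[of v] that by simp
  then have "\<exists>y\<in>carrier V. y \<oplus> v = \<zero>" if "v \<in> carrier V" for v
    using that assms(3) by blast
  then show "abelian_group V"
    by (intro abelian_groupI assms)
qed (use assms in \<open>auto simp: real_ring_def\<close>)

context normed_space
begin

lemma scale_closed [simp, intro]: "v \<in> carrier V \<Longrightarrow> c \<odot> v \<in> carrier V"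
  by (rule smult_closed) (simp add: real_ring_def)

lemma scale_add_left: "v \<in> carrier V \<Longrightarrow> (a + b) \<odot> v = a \<odot> v \<oplus> b \<odot> v"
  using smult_l_distr[of a b v] by (simp add: real_ring_def)

lemma scale_add_right:
  "\<lbrakk>v \<in> carrier V; w \<in> carrier V\<rbrakk> \<Longrightarrow> a \<odot> (v \<oplus> w) = a \<odot> v \<oplus> a \<odot> w"
  using smult_r_distr[of a v w] by (simp add: real_ring_def)

lemma scale_scale: "v \<in> carrier V \<Longrightarrow> a \<odot> (b \<odot> v) = (a * b) \<odot> v"
  using smult_assoc1[of a b v] by (simp add: real_ring_def)

lemma scale_one [simp]: "v \<in> carrier V \<Longrightarrow> 1 \<odot> v = v"
  using smult_one[of v] by (simp add: real_ring_def)

lemma scale_null [simp]: "v \<in> carrier V \<Longrightarrow> 0 \<odot> v = \<zero>"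
  using smult_l_null[of v] by (simp add: real_ring_def)

lemma scale_zero [simp]: "c \<odot> \<zero> = \<zero>"
  using smult_r_null[of c] by (simp add: real_ring_def)

lemma uminus_eq: "v \<in> carrier V \<Longrightarrow> \<ominus> v = (- 1) \<odot> v"
  using scale_add_left[of v "- 1" 1] by (intro M.minus_equality) auto

lemma diff_eq: "\<lbrakk>v \<in> carrier V; w \<in> carrier V\<rbrakk> \<Longrightarrow> v \<ominus> w = v \<oplus> (- 1) \<odot> w"
  by (simp add: a_minus_def uminus_eq)

lemma diff_closed [simp, intro]: "\<lbrakk>v \<in> carrier V; w \<in> carrier V\<rbrakk> \<Longrightarrow> v \<ominus> w \<in> carrier V"
  by (simp add: diff_eq)

lemma diff_self [simp]: "v \<in> carrier V \<Longrightarrow> v \<ominus> v = \<zero>"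
  using scale_add_left[of v 1 "- 1"] by (simp add: diff_eq)

lemma diff_zero [simp]: "v \<in> carrier V \<Longrightarrow> v \<ominus> \<zero> = v"
  by (simp add: diff_eq)

lemma diff_telescope:
  assumes "u \<in> carrier V" "v \<in> carrier V" "w \<in> carrier V"
  shows "(u \<ominus> v) \<oplus> (v \<ominus> w) = u \<ominus> w"
proof -
  have "(u \<ominus> v) \<oplus> (v \<ominus> w) = u \<oplus> ((\<ominus> v \<oplus> v) \<oplus> \<ominus> w)"
    using assms by (simp add: a_minus_def M.a_assoc del: M.l_neg)
  then show ?thesis
    using assms by (simp add: a_minus_def M.l_neg)
qed

lemma diff_add_diff:
  assumes "a \<in> carrier V" "b \<in> carrier V" "c \<in> carrier V" "d \<in> carrier V"
  shows "(a \<oplus> b) \<ominus> (c \<oplus> d) = (a \<ominus> c) \<oplus> (b \<ominus> d)"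
  using assms by (simp add: diff_eq scale_add_right M.a_ac)

lemma scale_diff:
  assumes "a \<in> carrier V" "b \<in> carrier V"
  shows "c \<odot> a \<ominus> c \<odot> b = c \<odot> (a \<ominus> b)"
  using assms by (simp add: diff_eq scale_add_right scale_scale mult.commute)

lemma diff_swap:
  assumes "v \<in> carrier V" "w \<in> carrier V"
  shows "v \<ominus> w = (- 1) \<odot> (w \<ominus> v)"
  using assms by (simp add: diff_eq scale_add_right scale_scale M.a_comm)

lemma add_uminus_cancel:
  assumes "v \<in> carrier V" "w \<in> carrier V"
  shows "v \<oplus> w \<oplus> (- 1) \<odot> v = w"
proof -
  have "v \<oplus> w \<oplus> (- 1) \<odot> v = w \<oplus> (v \<ominus> v)"
    using assms by (simp only: diff_eq M.a_comm[of v w] M.a_assoc scale_closed)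
  then show ?thesis
    using assms by simp
qed

lemma diff_diff_self:
  assumes "v \<in> carrier V" "w \<in> carrier V"
  shows "v \<ominus> (v \<ominus> w) = w"
proof -
  have "v \<ominus> (v \<ominus> w) = v \<oplus> (w \<ominus> v)"
    using assms by (simp only: diff_eq[of v "v \<ominus> w"] diff_swap[of w v] diff_closed)
  also have "\<dots> = v \<oplus> w \<oplus> (- 1) \<odot> v"
    using assms by (simp add: diff_eq M.a_assoc)
  finally show ?thesis
    using assms by (simp add: add_uminus_cancel)
qed

lemma diff_diff_diff:
  assumes "u \<in> carrier V" "v \<in> carrier V" "w \<in> carrier V"
  shows "(u \<ominus> v) \<ominus> (u \<ominus> w) = w \<ominus> v"
proof -
  have "(u \<ominus> v) \<ominus> (u \<ominus> w) = (u \<ominus> v) \<oplus> (w \<ominus> u)"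
    using assms by (simp only: diff_eq[of "u \<ominus> v" "u \<ominus> w"] diff_swap[of w u] diff_closed)
  also have "\<dots> = (w \<ominus> u) \<oplus> (u \<ominus> v)"
    using assms by (intro M.a_comm) auto
  finally show ?thesis
    using assms by (simp add: diff_telescope)
qed

lemma diff_eq_zero_iff:
  assumes v: "v \<in> carrier V" and w: "w \<in> carrier V"
  shows "v \<ominus> w = \<zero> \<longleftrightarrow> v = w"
  using diff_diff_self[OF v w] v w by auto

lemma nrm_zero [simp]: "nrm V \<zero> = 0"
  by (simp add: nrm_eq_0)

lemma nrm_diff_commute: "\<lbrakk>v \<in> carrier V; w \<in> carrier V\<rbrakk> \<Longrightarrow> nrm V (v \<ominus> w) = nrm V (w \<ominus> v)"
  by (subst diff_swap) (simp_all add: nrm_smult)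

lemma nrm_diff_triangle:
  assumes "u \<in> carrier V" "v \<in> carrier V" "w \<in> carrier V"
  shows "nrm V (u \<ominus> w) \<le> nrm V (u \<ominus> v) + nrm V (v \<ominus> w)"
  using assms nrm_triangle[of "u \<ominus> v" "v \<ominus> w"] by (simp add: diff_telescope)

lemma zero_in_unit_ball: "\<zero> \<in> unit_ball V"
  by (simp add: unit_ball_def)

lemma Metric_space_norm:
  "Metric_space (carrier V) (\<lambda>v w. if v \<in> carrier V \<and> w \<in> carrier V then nrm V (v \<ominus> w) else 0)"
  using nrm_diff_triangle
  by unfold_locales
     (auto simp: nrm_nonneg nrm_diff_commute nrm_eq_0 diff_eq_zero_iff)

lemma mcomplete_norm_metric_iff:
  "mcomplete_of (norm_metric V) \<longleftrightarrow>
    (\<forall>\<sigma>. (\<forall>n. \<sigma> n \<in> carrier V) \<and> (\<forall>\<epsilon>>0. \<exists>M. \<forall>m\<ge>M. \<forall>n\<ge>M. nrm V (\<sigma> m \<ominus> \<sigma> n) < \<epsilon>) \<longrightarrow>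
       (\<exists>l\<in>carrier V. (\<lambda>n. nrm V (\<sigma> n \<ominus> l)) \<longlonglongrightarrow> 0))"
proof -
  interpret N: Metric_space "carrier V"
    "\<lambda>v w. if v \<in> carrier V \<and> w \<in> carrier V then nrm V (v \<ominus> w) else 0"
    by (rule Metric_space_norm)
  have lim: "limitin N.mtopology \<sigma> l sequentially \<longleftrightarrow>
      l \<in> carrier V \<and> (\<lambda>n. nrm V (\<sigma> n \<ominus> l)) \<longlonglongrightarrow> 0" if "\<forall>n. \<sigma> n \<in> carrier V" for \<sigma> l
    unfolding N.limit_metric_sequentially LIMSEQ_iff using that by (auto simp: nrm_nonneg)
  have cau: "N.MCauchy \<sigma> \<longleftrightarrow> (\<forall>n. \<sigma> n \<in> carrier V) \<and>
      (\<forall>\<epsilon>>0. \<exists>M. \<forall>m\<ge>M. \<forall>n\<ge>M. nrm V (\<sigma> m \<ominus> \<sigma> n) < \<epsilon>)" for \<sigma>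
  proof (cases "\<forall>n. \<sigma> n \<in> carrier V")
    case True
    then show ?thesis
      unfolding N.MCauchy_def by (simp add: image_subset_iff)
  qed (auto simp: N.MCauchy_def)
  show ?thesis
    unfolding norm_metric_def N.mcomplete_of N.mcomplete_def cau
    by (intro iff_allI imp_cong refl) (auto simp: lim)
qed

end

lemma banach_space_limit:
  assumes "banach_space V" and "\<And>n. \<sigma> n \<in> carrier V"
    and "\<And>\<epsilon>. \<epsilon> > 0 \<Longrightarrow> \<exists>M. \<forall>m\<ge>M. \<forall>n\<ge>M. nrm V (\<sigma> m \<ominus>\<^bsub>V\<^esub> \<sigma> n) < \<epsilon>"
  obtains l where "l \<in> carrier V" "(\<lambda>n. nrm V (\<sigma> n \<ominus>\<^bsub>V\<^esub> l)) \<longlonglongrightarrow> 0"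
proof -
  interpret normed_space V
    using assms(1) by (simp add: banach_space_def)
  show thesis
    using assms that unfolding banach_space_def mcomplete_norm_metric_iff by metis
qed

lemma banach_spaceI:
  assumes "normed_space V"
    and "\<And>\<sigma>. \<lbrakk>\<And>n. \<sigma> n \<in> carrier V;
          \<And>\<epsilon>. \<epsilon> > 0 \<Longrightarrow> \<exists>M. \<forall>m\<ge>M. \<forall>n\<ge>M. nrm V (\<sigma> m \<ominus>\<^bsub>V\<^esub> \<sigma> n) < \<epsilon>\<rbrakk>
        \<Longrightarrow> \<exists>l\<in>carrier V. (\<lambda>n. nrm V (\<sigma> n \<ominus>\<^bsub>V\<^esub> l)) \<longlonglongrightarrow> 0"
  shows "banach_space V"
proof -
  interpret normed_space V
    by fact
  show ?thesis
    unfolding banach_space_def mcomplete_norm_metric_iff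
    using assms by auto
qed

lemma normed_space_of_banach_space: "banach_space V \<Longrightarrow> normed_space V"
  by (simp add: banach_space_def)

lemma normed_space_real_line: "normed_space real_line"
  by (simp add: banach_space_nspace_of_type normed_space_of_banach_space)

lemma real_line_simps [simp]:
  "carrier real_line = UNIV" "\<zero>\<^bsub>real_line\<^esub> = 0" "a \<oplus>\<^bsub>real_line\<^esub> b = a + b"
  "c \<odot>\<^bsub>real_line\<^esub> a = c * a" "nrm real_line a = \<bar>a\<bar>"
  by (simp_all add: nspace_of_type_def)


text \<open>Both the completeness of the space of Cohen strongly summing operators and that of the space
  through which such an operator factors are instances of one fact. The norm of \<open>W\<close> dominates
  enough linear maps \<open>ev i\<close> into a Banach space, so the limit of a Cauchy sequence can be found along
  these maps; if the balls of \<open>W\<close> are closed for this weaker convergence, then the limit belongs to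
  \<open>W\<close> and is a limit in norm.\<close>

lemma banach_space_by_evaluations:
  fixes ev :: "'i \<Rightarrow> 'w \<Rightarrow> 'f"
  assumes W: "normed_space W" and F: "banach_space F"
    and ev_closed: "\<And>i w. \<lbrakk>i \<in> I; w \<in> carrier W\<rbrakk> \<Longrightarrow> ev i w \<in> carrier F"
    and ev_diff: "\<And>i v w. \<lbrakk>i \<in> I; v \<in> carrier W; w \<in> carrier W\<rbrakk>
        \<Longrightarrow> ev i (v \<ominus>\<^bsub>W\<^esub> w) = ev i v \<ominus>\<^bsub>F\<^esub> ev i w"
    and ev_bound: "\<And>i. i \<in> I \<Longrightarrow> \<exists>c. \<forall>w\<in>carrier W. nrm F (ev i w) \<le> c * nrm W w"
    and ev_inj: "\<And>v w. \<lbrakk>v \<in> carrier W; w \<in> carrier W; \<And>i. i \<in> I \<Longrightarrow> ev i v = ev i w\<rbrakk> \<Longrightarrow> v = w"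
    and balls_closed: "\<And>\<sigma> l r. \<lbrakk>\<And>n. \<sigma> n \<in> carrier W; \<And>n. nrm W (\<sigma> n) \<le> r;
        \<And>i. i \<in> I \<Longrightarrow> l i \<in> carrier F;
        \<And>i. i \<in> I \<Longrightarrow> (\<lambda>n. nrm F (ev i (\<sigma> n) \<ominus>\<^bsub>F\<^esub> l i)) \<longlonglongrightarrow> 0\<rbrakk>
      \<Longrightarrow> \<exists>w\<in>carrier W. nrm W w \<le> r \<and> (\<forall>i\<in>I. ev i w = l i)"
  shows "banach_space W"
proof (rule banach_spaceI[OF W])
  interpret W: normed_space W by fact
  interpret F: normed_space F using F by (rule normed_space_of_banach_space)
  fix \<sigma> :: "nat \<Rightarrow> 'w"
  assume \<sigma>: "\<And>n. \<sigma> n \<in> carrier W"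
    and cau: "\<And>\<epsilon>. \<epsilon> > 0 \<Longrightarrow> \<exists>M. \<forall>m\<ge>M. \<forall>n\<ge>M. nrm W (\<sigma> m \<ominus>\<^bsub>W\<^esub> \<sigma> n) < \<epsilon>"
  have "\<exists>l. l \<in> carrier F \<and> (\<lambda>n. nrm F (ev i (\<sigma> n) \<ominus>\<^bsub>F\<^esub> l)) \<longlonglongrightarrow> 0" if i: "i \<in> I" for i
  proof -
    obtain c where c: "\<forall>w\<in>carrier W. nrm F (ev i w) \<le> c * nrm W w"
      using ev_bound[OF i] by blast
    have "\<exists>M. \<forall>m\<ge>M. \<forall>n\<ge>M. nrm F (ev i (\<sigma> m) \<ominus>\<^bsub>F\<^esub> ev i (\<sigma> n)) < \<epsilon>" if "\<epsilon> > 0" for \<epsilon>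
    proof -
      obtain M where M: "\<forall>m\<ge>M. \<forall>n\<ge>M. nrm W (\<sigma> m \<ominus>\<^bsub>W\<^esub> \<sigma> n) < \<epsilon> / (\<bar>c\<bar> + 1)"
        using cau[of "\<epsilon> / (\<bar>c\<bar> + 1)"] \<open>\<epsilon> > 0\<close> by auto
      have "nrm F (ev i (\<sigma> m) \<ominus>\<^bsub>F\<^esub> ev i (\<sigma> n)) < \<epsilon>" if "m \<ge> M" "n \<ge> M" for m n
      proof -
        let ?d = "\<sigma> m \<ominus>\<^bsub>W\<^esub> \<sigma> n"
        have "nrm F (ev i (\<sigma> m) \<ominus>\<^bsub>F\<^esub> ev i (\<sigma> n)) \<le> c * nrm W ?d"
          using c \<sigma> ev_diff[OF i] by (metis W.diff_closed)
        also have "\<dots> \<le> (\<bar>c\<bar> + 1) * nrm W ?d"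
          by (intro mult_right_mono) (auto simp: W.nrm_nonneg \<sigma>)
        also have "\<dots> < \<epsilon>"
          using M that by (auto simp: field_simps add_pos_nonneg)
        finally show ?thesis .
      qed
      then show ?thesis by blast
    qed
    then show ?thesis
      using banach_space_limit[OF F, of "\<lambda>n. ev i (\<sigma> n)"] ev_closed[OF i \<sigma>] by metis
  qed
  then obtain l where l: "\<And>i. i \<in> I \<Longrightarrow> l i \<in> carrier F"
    and lim: "\<And>i. i \<in> I \<Longrightarrow> (\<lambda>n. nrm F (ev i (\<sigma> n) \<ominus>\<^bsub>F\<^esub> l i)) \<longlonglongrightarrow> 0"
    by metis
  \<comment> \<open>The balls are closed, so a bound on the differences \<open>\<sigma> m \<ominus> \<sigma> n\<close> persists as \<open>n\<close> tends to
    infinity. For \<open>r = 1\<close> this produces the limit, and for small \<open>r\<close> it shows convergence in norm.\<close>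
  have tail: "\<exists>w\<in>carrier W. nrm W w \<le> r \<and> (\<forall>i\<in>I. ev i w = ev i (\<sigma> m) \<ominus>\<^bsub>F\<^esub> l i)"
    if M: "\<forall>m\<ge>M. \<forall>n\<ge>M. nrm W (\<sigma> m \<ominus>\<^bsub>W\<^esub> \<sigma> n) < r" and m: "m \<ge> M" for M m r
  proof (rule balls_closed)
    show "\<sigma> m \<ominus>\<^bsub>W\<^esub> \<sigma> (n + M) \<in> carrier W" "nrm W (\<sigma> m \<ominus>\<^bsub>W\<^esub> \<sigma> (n + M)) \<le> r" for n
      using \<sigma> M m by (auto intro!: less_imp_le)
    fix i assume i: "i \<in> I"
    show "ev i (\<sigma> m) \<ominus>\<^bsub>F\<^esub> l i \<in> carrier F"
      using i l \<sigma> ev_closed by auto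
    have "nrm F (ev i (\<sigma> m \<ominus>\<^bsub>W\<^esub> \<sigma> k) \<ominus>\<^bsub>F\<^esub> (ev i (\<sigma> m) \<ominus>\<^bsub>F\<^esub> l i)) = nrm F (ev i (\<sigma> k) \<ominus>\<^bsub>F\<^esub> l i)"
      for k
    proof -
      let ?a = "ev i (\<sigma> m)" and ?b = "ev i (\<sigma> k)"
      have "?a \<in> carrier F" "?b \<in> carrier F" "l i \<in> carrier F"
        using i \<sigma> l ev_closed by auto
      then have "(?a \<ominus>\<^bsub>F\<^esub> ?b) \<ominus>\<^bsub>F\<^esub> (?a \<ominus>\<^bsub>F\<^esub> l i) = l i \<ominus>\<^bsub>F\<^esub> ?b"
        by (rule F.diff_diff_diff)
      then show ?thesis
        using i \<sigma> l ev_closed by (simp add: ev_diff F.nrm_diff_commute)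
    qed
    then show "(\<lambda>n. nrm F (ev i (\<sigma> m \<ominus>\<^bsub>W\<^esub> \<sigma> (n + M)) \<ominus>\<^bsub>F\<^esub> (ev i (\<sigma> m) \<ominus>\<^bsub>F\<^esub> l i))) \<longlonglongrightarrow> 0"
      using LIMSEQ_ignore_initial_segment[OF lim[OF i], of M] by simp
  qed
  obtain M where "\<forall>m\<ge>M. \<forall>n\<ge>M. nrm W (\<sigma> m \<ominus>\<^bsub>W\<^esub> \<sigma> n) < 1"
    using cau[of 1] by auto
  from tail[OF this order.refl] obtain w where w: "w \<in> carrier W"
    "\<forall>i\<in>I. ev i w = ev i (\<sigma> M) \<ominus>\<^bsub>F\<^esub> l i"
    by blast
  define a where "a = \<sigma> M \<ominus>\<^bsub>W\<^esub> w"
  have a: "a \<in> carrier W"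
    using \<sigma> w by (simp add: a_def)
  have ev_a: "ev i a = l i" if i: "i \<in> I" for i
  proof -
    have "ev i (\<sigma> M) \<in> carrier F" "l i \<in> carrier F"
      using i \<sigma> l ev_closed by auto
    then have "ev i (\<sigma> M) \<ominus>\<^bsub>F\<^esub> (ev i (\<sigma> M) \<ominus>\<^bsub>F\<^esub> l i) = l i"
      by (rule F.diff_diff_self)
    then show ?thesis
      using i \<sigma> w by (simp add: a_def ev_diff)
  qed
  have "\<exists>N. \<forall>m\<ge>N. norm (nrm W (\<sigma> m \<ominus>\<^bsub>W\<^esub> a) - 0) < \<epsilon>" if "\<epsilon> > 0" for \<epsilon>
  proof -
    obtain N where N: "\<forall>m\<ge>N. \<forall>n\<ge>N. nrm W (\<sigma> m \<ominus>\<^bsub>W\<^esub> \<sigma> n) < \<epsilon> / 2"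
      using cau[OF half_gt_zero[OF \<open>\<epsilon> > 0\<close>]] by blast
    have "nrm W (\<sigma> m \<ominus>\<^bsub>W\<^esub> a) < \<epsilon>" if m: "m \<ge> N" for m
    proof -
      obtain v where v: "v \<in> carrier W" "nrm W v \<le> \<epsilon> / 2" "\<forall>i\<in>I. ev i v = ev i (\<sigma> m) \<ominus>\<^bsub>F\<^esub> l i"
        using tail[OF N m] by blast
      have "v = \<sigma> m \<ominus>\<^bsub>W\<^esub> a"
        by (rule ev_inj) (use v a \<sigma> ev_a ev_diff in auto)
      with v \<open>\<epsilon> > 0\<close> show ?thesis by simp
    qed
    then show ?thesis
      using a \<sigma> by (auto simp: W.nrm_nonneg intro!: exI[of _ N])
  qed
  then show "\<exists>l\<in>carrier W. (\<lambda>n. nrm W (\<sigma> n \<ominus>\<^bsub>W\<^esub> l)) \<longlonglongrightarrow> 0"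
    using a unfolding LIMSEQ_iff by blast
qed


section \<open>The Hahn--Banach theorem\<close>

context normed_space
begin

definition sublinear :: "('v \<Rightarrow> real) \<Rightarrow> bool" where
  "sublinear q \<longleftrightarrow>
     (\<forall>v\<in>carrier V. \<forall>w\<in>carrier V. q (v \<oplus> w) \<le> q v + q w) \<and>
     (\<forall>v\<in>carrier V. \<forall>c>0. q (c \<odot> v) \<le> c * q v)"

lemma sublinear_add: "\<lbrakk>sublinear q; v \<in> carrier V; w \<in> carrier V\<rbrakk> \<Longrightarrow> q (v \<oplus> w) \<le> q v + q w"
  by (simp add: sublinear_def)

lemma sublinear_scale:
  assumes "sublinear q" "v \<in> carrier V" "c > 0"
  shows "q (c \<odot> v) = c * q v"
proof (rule antisym)
  show "q (c \<odot> v) \<le> c * q v"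
    using assms by (simp add: sublinear_def)
  have "q (inverse c \<odot> (c \<odot> v)) \<le> inverse c * q (c \<odot> v)"
    using assms unfolding sublinear_def by (metis positive_imp_inverse_positive scale_closed)
  then show "c * q v \<le> q (c \<odot> v)"
    using assms by (simp add: scale_scale field_simps)
qed

lemma sublinear_zero:
  assumes "sublinear q"
  shows "q \<zero> = 0"
  using sublinear_scale[OF assms, of \<zero> 2] by simp

lemma sublinear_scale_nonneg:
  assumes "sublinear q" "v \<in> carrier V" "c \<ge> 0"
  shows "q (c \<odot> v) = c * q v"
  using assms sublinear_scale sublinear_zero by (cases "c = 0") auto

lemma sublinear_lower:
  assumes "sublinear q" "v \<in> carrier V"
  shows "- q ((- 1) \<odot> v) \<le> q v"
proof -
  have "v \<oplus> (- 1) \<odot> v = \<zero>"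
    using assms diff_eq[of v v] by simp
  then show ?thesis
    using sublinear_add[OF assms, of "(- 1) \<odot> v"] assms(2) sublinear_zero[OF assms(1)] by simp
qed

lemma sublinear_nrm: "sublinear (nrm V)"
  by (simp add: sublinear_def nrm_triangle nrm_smult)

text \<open>The greatest sublinear functional below \<open>q\<close> that is at most \<open>- q y\<close> at \<open>- y\<close>.\<close>

definition shift :: "('v \<Rightarrow> real) \<Rightarrow> 'v \<Rightarrow> 'v \<Rightarrow> real" where
  "shift q y v = (if v \<in> carrier V then INF t\<in>{0..}. q (v \<oplus> t \<odot> y) - t * q y else 0)"

context
  fixes q y
  assumes q: "sublinear q" and y: "y \<in> carrier V"
begin

lemma shift_bdd_below:
  assumes v: "v \<in> carrier V"
  shows "bdd_below ((\<lambda>t. q (v \<oplus> t \<odot> y) - t * q y) ` {0..})"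
proof (rule bdd_belowI2)
  fix t :: real assume t: "t \<in> {0..}"
  have "t \<odot> y = (v \<oplus> t \<odot> y) \<oplus> (- 1) \<odot> v"
    using v y by (simp add: add_uminus_cancel)
  then have "t * q y \<le> q (v \<oplus> t \<odot> y) + q ((- 1) \<odot> v)"
    using sublinear_add[OF q, of "v \<oplus> t \<odot> y" "(- 1) \<odot> v"] sublinear_scale_nonneg[OF q y] v y t
    by simp
  then show "- q ((- 1) \<odot> v) \<le> q (v \<oplus> t \<odot> y) - t * q y"
    by simp
qed

lemma shift_le:
  assumes "v \<in> carrier V" "t \<ge> 0"
  shows "shift q y v \<le> q (v \<oplus> t \<odot> y) - t * q y"
  unfolding shift_def using assms shift_bdd_below[OF assms(1)]
  by (auto intro: cINF_lower)

lemma shift_greatest: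
  assumes "v \<in> carrier V" "\<And>t. t \<ge> 0 \<Longrightarrow> c \<le> q (v \<oplus> t \<odot> y) - t * q y"
  shows "c \<le> shift q y v"
  unfolding shift_def using assms by (auto intro: cINF_greatest)

lemma shift_le_self: "v \<in> carrier V \<Longrightarrow> shift q y v \<le> q v"
  using shift_le[of v 0] y by simp

lemma sublinear_shift: "sublinear (shift q y)"
  unfolding sublinear_def
proof (intro conjI ballI allI impI)
  fix v w assume v: "v \<in> carrier V" and w: "w \<in> carrier V"
  have step: "shift q y (v \<oplus> w) \<le> (q (v \<oplus> s \<odot> y) - s * q y) + (q (w \<oplus> t \<odot> y) - t * q y)"
    if "s \<ge> 0" "t \<ge> 0" for s t
  proof -
    have "(v \<oplus> w) \<oplus> (s + t) \<odot> y = (v \<oplus> s \<odot> y) \<oplus> (w \<oplus> t \<odot> y)"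
      using v w y by (simp add: scale_add_left M.a_ac)
    then have "q ((v \<oplus> w) \<oplus> (s + t) \<odot> y) \<le> q (v \<oplus> s \<odot> y) + q (w \<oplus> t \<odot> y)"
      using sublinear_add[OF q, of "v \<oplus> s \<odot> y" "w \<oplus> t \<odot> y"] v w y by simp
    moreover have "shift q y (v \<oplus> w) \<le> q ((v \<oplus> w) \<oplus> (s + t) \<odot> y) - (s + t) * q y"
      using that v w by (intro shift_le) auto
    ultimately show ?thesis
      by (simp add: algebra_simps)
  qed
  have "shift q y (v \<oplus> w) - (q (w \<oplus> t \<odot> y) - t * q y) \<le> shift q y v" if "t \<ge> 0" for t
    by (rule shift_greatest[OF v]) (use step that in \<open>simp add: algebra_simps\<close>)
  then have "shift q y (v \<oplus> w) - shift q y v \<le> shift q y w"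
    by (intro shift_greatest[OF w]) (simp add: algebra_simps)
  then show "shift q y (v \<oplus> w) \<le> shift q y v + shift q y w"
    by simp
next
  fix v c assume v: "v \<in> carrier V" and c: "(c::real) > 0"
  have "shift q y (c \<odot> v) / c \<le> q (v \<oplus> t \<odot> y) - t * q y" if "t \<ge> 0" for t
  proof -
    have "q (c \<odot> v \<oplus> (c * t) \<odot> y) = c * q (v \<oplus> t \<odot> y)"
      using sublinear_scale[OF q, of "v \<oplus> t \<odot> y" c] v y c by (simp add: scale_add_right scale_scale)
    then have "shift q y (c \<odot> v) \<le> c * q (v \<oplus> t \<odot> y) - c * t * q y"
      using shift_le[of "c \<odot> v" "c * t"] c v that by simp
    then show ?thesis
      using c by (simp add: field_simps)
  qed
  then have "shift q y (c \<odot> v) / c \<le> shift q y v"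
    by (rule shift_greatest[OF v])
  then show "shift q y (c \<odot> v) \<le> c * shift q y v"
    using c by (simp add: field_simps)
qed

end

text \<open>A minimal sublinear functional \<open>m\<close> is linear, because \<open>shift m y\<close> is again sublinear and below
  \<open>m\<close>, hence equal to \<open>m\<close>, and this gives \<open>m v + m y \<le> m (v \<oplus> y)\<close>. Minimal elements exist by Zorn's
  lemma: the pointwise infimum of a chain of sublinear functionals is sublinear.\<close>

theorem hahn_banach:
  assumes b: "sublinear b"
  obtains m where
    "\<And>v w. \<lbrakk>v \<in> carrier V; w \<in> carrier V\<rbrakk> \<Longrightarrow> m (v \<oplus> w) = m v + m w"
    "\<And>c v. v \<in> carrier V \<Longrightarrow> m (c \<odot> v) = c * m v"
    "\<And>v. v \<in> carrier V \<Longrightarrow> m v \<le> b v"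
proof -
  define \<Q> where "\<Q> = {q. sublinear q \<and> (\<forall>v. v \<notin> carrier V \<longrightarrow> q v = 0) \<and> (\<forall>v\<in>carrier V. q v \<le> b v)}"
  let ?P = "\<lambda>q r. \<forall>v. r v \<le> (q v :: real)"
  have "\<exists>m\<in>\<Q>. \<forall>q\<in>\<Q>. ?P m q \<longrightarrow> q = m"
  proof (rule predicate_Zorn)
    show "partial_order_on \<Q> (relation_of ?P \<Q>)"
      by (rule partial_order_on_relation_ofI) (auto intro!: ext intro: order_trans antisym)
    fix C assume C: "C \<in> Chains (relation_of ?P \<Q>)"
    show "\<exists>u\<in>\<Q>. \<forall>a\<in>C. ?P a u"
    proof (cases "C = {}")
      case True
      have "(\<lambda>v. if v \<in> carrier V then b v else 0) \<in> \<Q>"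
        using b by (auto simp: \<Q>_def sublinear_def)
      with True show ?thesis by blast
    next
      case False
      have rel: "q \<in> \<Q> \<and> (?P q r \<or> ?P r q)" if "q \<in> C" "r \<in> C" for q r
        using C that by (auto simp: Chains_def relation_of_def)
      then have CQ: "C \<subseteq> \<Q>" by blast
      have chain: "?P q r \<or> ?P r q" if "q \<in> C" "r \<in> C" for q r
        using rel[OF that] by (rule conjunct2)
      define u where "u v = (INF q\<in>C. q v)" for v
      have bdd: "bdd_below ((\<lambda>q. q v) ` C)" for v
      proof (cases "v \<in> carrier V")
        case True
        have "- b ((- 1) \<odot> v) \<le> q v" if "q \<in> C" for q
        proof -
          have "q \<in> \<Q>"
            using CQ that by blast
          then have "- q ((- 1) \<odot> v) \<le> q v" "q ((- 1) \<odot> v) \<le> b ((- 1) \<odot> v)"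
            using sublinear_lower[of q v] True by (auto simp: \<Q>_def)
          then show ?thesis by simp
        qed
        then show ?thesis by (rule bdd_belowI2)
      next
        case out: False
        have "0 \<le> q v" if "q \<in> C" for q
          using out that CQ by (auto simp: \<Q>_def)
        then show ?thesis by (rule bdd_belowI2)
      qed
      have u_le: "u v \<le> q v" if "q \<in> C" for q v
        unfolding u_def using bdd that by (rule cINF_lower)
      have u_greatest: "c \<le> u v" if "\<And>q. q \<in> C \<Longrightarrow> c \<le> q v" for c v
        unfolding u_def using False that by (rule cINF_greatest)
      have "sublinear u"
        unfolding sublinear_def
      proof (intro conjI ballI allI impI)
        fix v w assume v: "v \<in> carrier V" and w: "w \<in> carrier V"
        have step: "u (v \<oplus> w) \<le> q v + r w" if qr: "q \<in> C" "r \<in> C" for q r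
        proof -
          obtain s where s: "s \<in> C" "s v \<le> q v" "s w \<le> r w"
            using chain[OF qr] qr by (metis order.refl)
          have "sublinear s"
            using s CQ by (auto simp: \<Q>_def)
          then have "u (v \<oplus> w) \<le> s v + s w"
            using u_le[OF s(1), of "v \<oplus> w"] sublinear_add[of s v w] v w by simp
          with s show ?thesis by simp
        qed
        have "u (v \<oplus> w) - r w \<le> u v" if "r \<in> C" for r
          by (rule u_greatest) (use step that in \<open>simp add: algebra_simps\<close>)
        then have "u (v \<oplus> w) - u v \<le> u w"
          by (intro u_greatest) (simp add: algebra_simps)
        then show "u (v \<oplus> w) \<le> u v + u w" by simp
      next
        fix v c assume v: "v \<in> carrier V" and c: "(c::real) > 0"
        have "u (c \<odot> v) / c \<le> q v" if "q \<in> C" for q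
        proof -
          have "q (c \<odot> v) = c * q v"
            using that CQ v c by (intro sublinear_scale) (auto simp: \<Q>_def)
          then show ?thesis
            using u_le[OF that, of "c \<odot> v"] c by (simp add: field_simps)
        qed
        then have "u (c \<odot> v) / c \<le> u v" by (rule u_greatest)
        then show "u (c \<odot> v) \<le> c * u v"
          using c by (simp add: field_simps)
      qed
      moreover have "u v = 0" if "v \<notin> carrier V" for v
      proof -
        have "q v = 0" if "q \<in> C" for q
          using CQ that \<open>v \<notin> carrier V\<close> by (auto simp: \<Q>_def)
        then have "(\<lambda>q. q v) ` C = (\<lambda>q. 0) ` C"
          by (intro image_cong refl)
        then show ?thesis
          using False by (simp add: u_def image_constant_conv)
      qed
      moreover have "u v \<le> b v" if "v \<in> carrier V" for v
      proof -
        obtain q where "q \<in> C" "q \<in> \<Q>"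
          using False CQ by blast
        then show ?thesis
          using u_le[of q v] that by (auto simp: \<Q>_def)
      qed
      ultimately have "u \<in> \<Q>" by (simp add: \<Q>_def)
      then show ?thesis using u_le by (intro bexI[of _ u]) auto
    qed
  qed
  then obtain m where m: "m \<in> \<Q>" and min: "\<And>q. \<lbrakk>q \<in> \<Q>; \<forall>v. q v \<le> m v\<rbrakk> \<Longrightarrow> q = m"
    by blast
  have sub: "sublinear m" and le: "v \<in> carrier V \<Longrightarrow> m v \<le> b v"
    and out: "v \<notin> carrier V \<Longrightarrow> m v = 0" for v
    using m by (auto simp: \<Q>_def)
  have add: "m (v \<oplus> w) = m v + m w" if v: "v \<in> carrier V" and w: "w \<in> carrier V" for v w
  proof (rule antisym)
    show "m (v \<oplus> w) \<le> m v + m w"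
      using sub v w by (rule sublinear_add)
    have le_m: "shift m w x \<le> m x" for x
      using shift_le_self[OF sub w] out[of x] by (cases "x \<in> carrier V") (auto simp: shift_def)
    have "shift m w \<in> \<Q>"
      using sublinear_shift[OF sub w] order_trans[OF le_m le] by (auto simp: \<Q>_def shift_def)
    then have "shift m w = m"
      using le_m by (intro min) auto
    then show "m v + m w \<le> m (v \<oplus> w)"
      using shift_le[OF sub w v, of 1] w by simp
  qed
  have "m (c \<odot> v) = c * m v" if v: "v \<in> carrier V" for c v
  proof (cases "c \<ge> 0")
    case True
    then show ?thesis
      using sublinear_scale_nonneg[OF sub v] by blast
  next
    case False
    have "m (c \<odot> v) + m ((- c) \<odot> v) = 0"
      using add[of "c \<odot> v" "(- c) \<odot> v"] scale_add_left[OF v, of c "- c"] sublinear_zero[OF sub] v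
      by simp
    moreover have "m ((- c) \<odot> v) = - c * m v"
      using sublinear_scale_nonneg[OF sub v, of "- c"] False by simp
    ultimately show ?thesis by simp
  qed
  with add le show thesis
    by (intro that[of m])
qed

text \<open>A linear functional below \<open>shift (nrm V) (- v)\<close> is below the norm and at most \<open>- nrm V v\<close> at \<open>v\<close>.\<close>

lemma norming_functional:
  assumes v: "v \<in> carrier V"
  obtains m where
    "\<And>u w. \<lbrakk>u \<in> carrier V; w \<in> carrier V\<rbrakk> \<Longrightarrow> m (u \<oplus> w) = m u + m w"
    "\<And>c w. w \<in> carrier V \<Longrightarrow> m (c \<odot> w) = c * m w"
    "\<And>w. w \<in> carrier V \<Longrightarrow> \<bar>m w\<bar> \<le> nrm V w"
    "\<bar>m v\<bar> = nrm V v"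
proof -
  let ?y = "(- 1) \<odot> v"
  have y: "?y \<in> carrier V" using v by simp
  obtain m where m: "\<And>u w. \<lbrakk>u \<in> carrier V; w \<in> carrier V\<rbrakk> \<Longrightarrow> m (u \<oplus> w) = m u + m w"
    "\<And>c w. w \<in> carrier V \<Longrightarrow> m (c \<odot> w) = c * m w"
    "\<And>w. w \<in> carrier V \<Longrightarrow> m w \<le> shift (nrm V) ?y w"
    using hahn_banach[OF sublinear_shift[OF sublinear_nrm y]] by blast
  have le: "m w \<le> nrm V w" if "w \<in> carrier V" for w
    using m(3)[OF that] shift_le_self[OF sublinear_nrm y that] by simp
  have abs: "\<bar>m w\<bar> \<le> nrm V w" if "w \<in> carrier V" for w
    using le[OF that] le[of "(- 1) \<odot> w"] that m(2)[OF that, of "- 1"] by (simp add: nrm_smult)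
  have "v \<oplus> 1 \<odot> ?y = \<zero>"
    using diff_eq[OF v v] v by simp
  then have "shift (nrm V) ?y v \<le> - nrm V v"
    using shift_le[OF sublinear_nrm y v, of 1] v by (simp add: nrm_smult)
  then have "m v \<le> - nrm V v"
    using m(3)[OF v] by simp
  then have "\<bar>m v\<bar> = nrm V v"
    using abs[OF v] by simp
  with m(1,2) abs show thesis
    by (intro that[of m])
qed

end


section \<open>Least admissible constants\<close>

text \<open>The norms of Lip-linear, of Cohen strongly summing and of strongly summing operators, and
  also the norm of the intermediate space of the factorization, are infima of the positive constants
  in an inequality. The constants admitted by an inequality \<open>l \<le> C * r\<close> with \<open>0 \<le> r\<close> form a closed set that contains with
  each constant all larger ones, and this is preserved under universal quantification; hence the
  infimum is itself admitted.\<close>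

definition admissible :: "(real \<Rightarrow> bool) \<Rightarrow> bool" where
  "admissible P \<longleftrightarrow> (\<forall>C D. P C \<longrightarrow> C \<le> D \<longrightarrow> P D) \<and> (\<forall>C. (\<forall>\<epsilon>>0. P (C + \<epsilon>)) \<longrightarrow> P C)"

named_theorems admissible_intros

lemma admissible_le [admissible_intros]:
  assumes "0 \<le> r"
  shows "admissible (\<lambda>C. l \<le> C * r)"
  unfolding admissible_def
proof (intro conjI allI impI)
  fix C D assume "l \<le> C * r" "C \<le> D"
  then show "l \<le> D * r"
    using assms mult_right_mono[of C D r] by linarith
next
  fix C assume *: "\<forall>\<epsilon>>0. l \<le> (C + \<epsilon>) * r"
  show "l \<le> C * r"
  proof (rule field_le_epsilon)
    fix e :: real assume e: "e > 0"
    have "l \<le> (C + e / (r + 1)) * r"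
      using * e assms by simp
    also have "\<dots> \<le> C * r + e"
      using e assms by (simp add: field_simps)
    finally show "l \<le> C * r + e" .
  qed
qed

lemma admissible_le2 [admissible_intros]:
  assumes "0 \<le> r" "0 \<le> s"
  shows "admissible (\<lambda>C. l \<le> C * r * s)"
  using admissible_le[of "r * s" l] assms by (simp add: mult.assoc)

lemma admissible_all [admissible_intros]: "(\<And>x. admissible (P x)) \<Longrightarrow> admissible (\<lambda>C. \<forall>x. P x C)"
  unfolding admissible_def by blast

lemma admissible_ball [admissible_intros]:
  "(\<And>x. x \<in> A \<Longrightarrow> admissible (P x)) \<Longrightarrow> admissible (\<lambda>C. \<forall>x\<in>A. P x C)"
  unfolding admissible_def by blast

lemma admissible_imp [admissible_intros]: "(Q \<Longrightarrow> admissible P) \<Longrightarrow> admissible (\<lambda>C. Q \<longrightarrow> P C)"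
  unfolding admissible_def by blast

lemma admissible_mono: "\<lbrakk>admissible P; P C; C \<le> D\<rbrakk> \<Longrightarrow> P D"
  unfolding admissible_def by blast

lemma admissible_ex_pos:
  assumes "admissible P" "P C"
  shows "\<exists>D>0. P D"
  using admissible_mono[OF assms, of "max C 1"] by (intro exI[of _ "max C 1"]) auto

lemma Inf_admissible_nonneg:
  assumes "\<exists>C>0. P C"
  shows "0 \<le> Inf {C::real. 0 < C \<and> P C}"
  by (rule cInf_greatest) (use assms in auto)

lemma Inf_admissible_le:
  assumes P: "admissible P" and C: "P C" "0 \<le> C"
  shows "Inf {C::real. 0 < C \<and> P C} \<le> C"
proof (rule field_le_epsilon)
  fix e :: real assume "e > 0"
  then have "0 < C + e \<and> P (C + e)"
    using admissible_mono[OF P C(1), of "C + e"] C(2) by simp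
  then show "Inf {C. 0 < C \<and> P C} \<le> C + e"
    by (intro cInf_lower) (auto intro!: bdd_belowI[of _ 0])
qed

lemma Inf_admissible:
  assumes P: "admissible P" and ex: "\<exists>C>0. P C"
  shows "P (Inf {C::real. 0 < C \<and> P C})"
proof -
  let ?S = "{C::real. 0 < C \<and> P C}"
  have "P (Inf ?S + \<epsilon>)" if "\<epsilon> > 0" for \<epsilon>
  proof -
    have "?S \<noteq> {}" "Inf ?S < Inf ?S + \<epsilon>"
      using ex that by auto
    then obtain C where "C \<in> ?S" "C < Inf ?S + \<epsilon>"
      by (metis cInf_lessD)
    then show ?thesis
      using admissible_mono[OF P, of C] by simp
  qed
  then show ?thesis
    using P unfolding admissible_def by blast
qed


section \<open>Spaces of functions and of operators\<close>

lemma fun_nspace_simps [simp]: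
  "carrier (fun_nspace A W M N) = M"
  "\<zero>\<^bsub>fun_nspace A W M N\<^esub> = (\<lambda>a\<in>A. \<zero>\<^bsub>W\<^esub>)"
  "f \<oplus>\<^bsub>fun_nspace A W M N\<^esub> g = (\<lambda>a\<in>A. f a \<oplus>\<^bsub>W\<^esub> g a)"
  "c \<odot>\<^bsub>fun_nspace A W M N\<^esub> f = (\<lambda>a\<in>A. c \<odot>\<^bsub>W\<^esub> f a)"
  "nrm (fun_nspace A W M N) = N"
  by (simp_all add: fun_nspace_def)

text \<open>One inequality suffices for the homogeneity of \<open>N\<close>: the other one follows by scaling back with
  the inverse.\<close>

lemma normed_space_fun_nspace:
  assumes W: "normed_space W"
    and ext: "M \<subseteq> extensional A"
    and vals: "\<And>f a. \<lbrakk>f \<in> M; a \<in> A\<rbrakk> \<Longrightarrow> f a \<in> carrier W"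
    and zero: "(\<lambda>a\<in>A. \<zero>\<^bsub>W\<^esub>) \<in> M"
    and add: "\<And>f g. \<lbrakk>f \<in> M; g \<in> M\<rbrakk> \<Longrightarrow> (\<lambda>a\<in>A. f a \<oplus>\<^bsub>W\<^esub> g a) \<in> M"
    and scale: "\<And>c f. f \<in> M \<Longrightarrow> (\<lambda>a\<in>A. c \<odot>\<^bsub>W\<^esub> f a) \<in> M"
    and nonneg: "\<And>f. f \<in> M \<Longrightarrow> 0 \<le> N f"
    and definite: "\<And>f a. \<lbrakk>f \<in> M; N f = 0; a \<in> A\<rbrakk> \<Longrightarrow> f a = \<zero>\<^bsub>W\<^esub>"
    and N_scale: "\<And>c f. f \<in> M \<Longrightarrow> N (\<lambda>a\<in>A. c \<odot>\<^bsub>W\<^esub> f a) \<le> \<bar>c\<bar> * N f"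
    and N_add: "\<And>f g. \<lbrakk>f \<in> M; g \<in> M\<rbrakk> \<Longrightarrow> N (\<lambda>a\<in>A. f a \<oplus>\<^bsub>W\<^esub> g a) \<le> N f + N g"
  shows "normed_space (fun_nspace A W M N)"
proof -
  interpret W: normed_space W by fact
  have eqI: "f = g" if "f \<in> extensional A" "g \<in> extensional A" "\<And>a. a \<in> A \<Longrightarrow> f a = g a" for f g
    using that by (rule extensionalityI)
  have M_ext: "f \<in> extensional A" if "f \<in> M" for f
    using that ext by blast
  have "Module.module real_ring (fun_nspace A W M N)"
    by (rule real_moduleI; simp add: zero add scale; rule eqI)
       (simp_all add: vals M_ext W.M.a_assoc W.M.a_comm W.M.a_lcomm W.scale_add_left
          W.scale_add_right W.scale_scale)
  moreover have "N (\<lambda>a\<in>A. \<zero>\<^bsub>W\<^esub>) = 0"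
  proof -
    have "(\<lambda>a\<in>A. 0 \<odot>\<^bsub>W\<^esub> (\<lambda>a\<in>A. \<zero>\<^bsub>W\<^esub>) a) = (\<lambda>a\<in>A. \<zero>\<^bsub>W\<^esub>)"
      by (rule eqI) auto
    then show ?thesis
      using N_scale[OF zero, of 0] nonneg[OF zero] by simp
  qed
  moreover have "f = (\<lambda>a\<in>A. \<zero>\<^bsub>W\<^esub>)" if "f \<in> M" "N f = 0" for f
    by (rule eqI) (use that M_ext definite in auto)
  moreover have "N (\<lambda>a\<in>A. c \<odot>\<^bsub>W\<^esub> f a) = \<bar>c\<bar> * N f" if f: "f \<in> M" for c f
  proof (rule antisym[OF N_scale[OF f]])
    show "\<bar>c\<bar> * N f \<le> N (\<lambda>a\<in>A. c \<odot>\<^bsub>W\<^esub> f a)"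
    proof (cases "c = 0")
      case True
      then show ?thesis
        using nonneg[OF scale[OF f]] by simp
    next
      case False
      have "(\<lambda>a\<in>A. inverse c \<odot>\<^bsub>W\<^esub> (\<lambda>a\<in>A. c \<odot>\<^bsub>W\<^esub> f a) a) = f"
        by (rule eqI) (use f M_ext False vals in \<open>auto simp: W.scale_scale\<close>)
      then have "N f \<le> \<bar>inverse c\<bar> * N (\<lambda>a\<in>A. c \<odot>\<^bsub>W\<^esub> f a)"
        using N_scale[OF scale[OF f], of "inverse c" c] by simp
      with False show ?thesis
        by (simp add: field_simps abs_inverse)
    qed
  qed
  ultimately show ?thesis
    by (intro normed_space.intro normed_space_axioms.intro)
       (auto simp: nonneg N_add)
qed

lemma fun_nspace_diff:
  assumes "normed_space W" "normed_space (fun_nspace A W M N)"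
    and "f \<in> M" "g \<in> M" "f \<in> A \<rightarrow> carrier W" "g \<in> A \<rightarrow> carrier W" "a \<in> A"
  shows "(f \<ominus>\<^bsub>fun_nspace A W M N\<^esub> g) a = f a \<ominus>\<^bsub>W\<^esub> g a"
proof -
  interpret W: normed_space W by fact
  interpret Z: normed_space "fun_nspace A W M N" by fact
  show ?thesis
    using assms Z.diff_eq[of f g] W.diff_eq[of "f a" "g a"] by (auto simp: Pi_iff)
qed

lemma linear_onD:
  assumes "linear_on V W u"
  shows "v \<in> carrier V \<Longrightarrow> u v \<in> carrier W"
    and "\<lbrakk>v \<in> carrier V; w \<in> carrier V\<rbrakk> \<Longrightarrow> u (v \<oplus>\<^bsub>V\<^esub> w) = u v \<oplus>\<^bsub>W\<^esub> u w"
    and "v \<in> carrier V \<Longrightarrow> u (c \<odot>\<^bsub>V\<^esub> v) = c \<odot>\<^bsub>W\<^esub> u v"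
  using assms by (auto simp: linear_on_def)

lemma linear_on_diff:
  assumes "normed_space V" "normed_space W" "linear_on V W u" "v \<in> carrier V" "w \<in> carrier V"
  shows "u (v \<ominus>\<^bsub>V\<^esub> w) = u v \<ominus>\<^bsub>W\<^esub> u w"
proof -
  interpret V: normed_space V by fact
  interpret W: normed_space W by fact
  show ?thesis
    using assms by (simp add: V.diff_eq W.diff_eq linear_onD)
qed

lemma linear_on_zero:
  assumes "normed_space V" "normed_space W" "linear_on V W u"
  shows "u \<zero>\<^bsub>V\<^esub> = \<zero>\<^bsub>W\<^esub>"
proof -
  interpret V: normed_space V by fact
  interpret W: normed_space W by fact
  show ?thesis
    using linear_onD(3)[OF assms(3), of "\<zero>\<^bsub>V\<^esub>" 0] linear_onD(1)[OF assms(3), of "\<zero>\<^bsub>V\<^esub>"] by simp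
qed

lemma real_line_diff [simp]: "a \<ominus>\<^bsub>real_line\<^esub> b = a - b"
proof -
  interpret normed_space real_line by (rule normed_space_real_line)
  show ?thesis by (simp add: diff_eq)
qed

lemma carrier_blin:
  "u \<in> carrier (blin V W) \<longleftrightarrow> u \<in> extensional (carrier V) \<and> linear_on V W u \<and>
     (\<exists>C. \<forall>v\<in>carrier V. nrm W (u v) \<le> C * nrm V v)"
  by (simp add: blin_def)

context
  fixes V :: "'v nspace" and W :: "'w nspace"
  assumes V: "normed_space V" and W: "normed_space W"
begin

interpretation V: normed_space V by (rule V)
interpretation W: normed_space W by (rule W)

lemma blin_norm_upper:
  assumes "u \<in> carrier (blin V W)" "v \<in> unit_ball V"
  shows "nrm W (u v) \<le> nrm (blin V W) u"
proof -
  obtain C where C: "\<forall>v\<in>carrier V. nrm W (u v) \<le> C * nrm V v"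
    using assms by (auto simp: carrier_blin)
  have "nrm W (u w) \<le> \<bar>C\<bar>" if "w \<in> unit_ball V" for w
  proof -
    have w: "w \<in> carrier V" "nrm V w \<le> 1" "0 \<le> nrm V w"
      using that V.nrm_nonneg by (auto simp: unit_ball_def)
    then have "C * nrm V w \<le> \<bar>C\<bar> * 1"
      by (intro mult_mono) auto
    with C w show ?thesis by fastforce
  qed
  then have "bdd_above ((\<lambda>v. nrm W (u v)) ` unit_ball V)"
    by (rule bdd_aboveI2)
  then show ?thesis
    using assms(2) unfolding blin_def fun_nspace_simps by (intro cSUP_upper)
qed

lemma blin_norm_nonneg:
  assumes "u \<in> carrier (blin V W)"
  shows "0 \<le> nrm (blin V W) u"
proof -
  have "0 \<le> nrm W (u \<zero>\<^bsub>V\<^esub>)"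
    using assms by (intro W.nrm_nonneg) (auto simp: carrier_blin linear_on_def)
  then show ?thesis
    using blin_norm_upper[OF assms V.zero_in_unit_ball] by simp
qed

lemma blin_norm_bound:
  assumes u: "u \<in> carrier (blin V W)" and v: "v \<in> carrier V"
  shows "nrm W (u v) \<le> nrm (blin V W) u * nrm V v"
proof (cases "v = \<zero>\<^bsub>V\<^esub>")
  case True
  then show ?thesis
    using u linear_on_zero[OF V W, of u] by (simp add: carrier_blin)
next
  case False
  then have pos: "nrm V v > 0"
    using v V.nrm_nonneg V.nrm_eq_0 by (metis less_eq_real_def)
  let ?w = "inverse (nrm V v) \<odot>\<^bsub>V\<^esub> v"
  have "?w \<in> unit_ball V"
    using v pos by (simp add: unit_ball_def V.nrm_smult)
  then have "nrm W (u ?w) \<le> nrm (blin V W) u"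
    by (rule blin_norm_upper[OF u])
  moreover have "nrm W (u ?w) = inverse (nrm V v) * nrm W (u v)"
    using u v pos linear_onD[of V W u] by (simp add: carrier_blin W.nrm_smult)
  ultimately have "inverse (nrm V v) * nrm W (u v) \<le> nrm (blin V W) u"
    by simp
  then show ?thesis
    using pos by (simp add: field_simps)
qed

lemma blin_norm_le:
  assumes "\<And>v. v \<in> unit_ball V \<Longrightarrow> nrm W (u v) \<le> C"
  shows "nrm (blin V W) u \<le> C"
  unfolding blin_def fun_nspace_simps
  by (rule cSUP_least) (use assms V.zero_in_unit_ball in auto)

lemma blin_norm_le_bound:
  assumes "\<And>v. v \<in> carrier V \<Longrightarrow> nrm W (u v) \<le> C * nrm V v" "0 \<le> C"
  shows "nrm (blin V W) u \<le> C"
proof (rule blin_norm_le)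
  fix v assume "v \<in> unit_ball V"
  then have v: "v \<in> carrier V" "nrm V v \<le> 1"
    by (auto simp: unit_ball_def)
  have "nrm W (u v) \<le> C * nrm V v" "C * nrm V v \<le> C * 1"
    using assms v by (blast, intro mult_left_mono)
  then show "nrm W (u v) \<le> C" by simp
qed

lemma normed_space_blin: "normed_space (blin V W)"
proof -
  let ?M = "carrier (blin V W)" and ?N = "nrm (blin V W)"
  have "normed_space (fun_nspace (carrier V) W ?M ?N)"
  proof (rule normed_space_fun_nspace[OF W])
    show "?M \<subseteq> extensional (carrier V)"
      by (auto simp: carrier_blin)
    show "f a \<in> carrier W" if "f \<in> ?M" "a \<in> carrier V" for f a
      using that by (auto simp: carrier_blin linear_onD)
    show "(\<lambda>a\<in>carrier V. \<zero>\<^bsub>W\<^esub>) \<in> ?M"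
      by (auto simp: carrier_blin linear_on_def intro!: exI[of _ 0])
    show "0 \<le> ?N f" if "f \<in> ?M" for f
      using that by (rule blin_norm_nonneg)
    show "f a = \<zero>\<^bsub>W\<^esub>" if "f \<in> ?M" "?N f = 0" "a \<in> carrier V" for f a
    proof -
      have fa: "f a \<in> carrier W"
        using that by (auto simp: carrier_blin linear_onD)
      then show ?thesis
        using blin_norm_bound[of f a] that W.nrm_nonneg[OF fa] W.nrm_eq_0[OF fa] by simp
    qed
  next
    fix f g assume f: "f \<in> ?M" and g: "g \<in> ?M"
    have closed: "f a \<in> carrier W" "g a \<in> carrier W" if "a \<in> carrier V" for a
      using that f g by (auto simp: carrier_blin linear_onD)
    have le: "nrm W (f a \<oplus>\<^bsub>W\<^esub> g a) \<le> (?N f + ?N g) * nrm V a" if "a \<in> carrier V" for a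
      using W.nrm_triangle[OF closed[OF that]] blin_norm_bound[OF f that] blin_norm_bound[OF g that]
      by (simp add: algebra_simps)
    show "(\<lambda>a\<in>carrier V. f a \<oplus>\<^bsub>W\<^esub> g a) \<in> ?M"
      unfolding carrier_blin
    proof (intro conjI exI ballI)
      show "linear_on V W (\<lambda>a\<in>carrier V. f a \<oplus>\<^bsub>W\<^esub> g a)"
        using f g closed by (auto simp: carrier_blin linear_on_def W.scale_add_right W.M.a_ac)
    qed (use le in auto)
    show "?N (\<lambda>a\<in>carrier V. f a \<oplus>\<^bsub>W\<^esub> g a) \<le> ?N f + ?N g"
      by (rule blin_norm_le_bound) (use le f g blin_norm_nonneg in auto)
  next
    fix c f assume f: "f \<in> ?M"
    have closed: "f a \<in> carrier W" if "a \<in> carrier V" for a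
      using that f by (auto simp: carrier_blin linear_onD)
    have le: "nrm W (c \<odot>\<^bsub>W\<^esub> f a) \<le> (\<bar>c\<bar> * ?N f) * nrm V a" if "a \<in> carrier V" for a
      using closed[OF that] blin_norm_bound[OF f that]
      by (simp add: W.nrm_smult mult.assoc mult_left_mono)
    show "(\<lambda>a\<in>carrier V. c \<odot>\<^bsub>W\<^esub> f a) \<in> ?M"
      unfolding carrier_blin
    proof (intro conjI exI ballI)
      show "linear_on V W (\<lambda>a\<in>carrier V. c \<odot>\<^bsub>W\<^esub> f a)"
        using f closed
        by (auto simp: carrier_blin linear_on_def W.scale_add_right W.scale_scale mult.commute)
    qed (use le in auto)
    show "?N (\<lambda>a\<in>carrier V. c \<odot>\<^bsub>W\<^esub> f a) \<le> \<bar>c\<bar> * ?N f"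
      by (rule blin_norm_le_bound) (use le f blin_norm_nonneg in auto)
  qed
  moreover have "fun_nspace (carrier V) W ?M ?N = blin V W"
    by (simp add: blin_def)
  ultimately show ?thesis by simp
qed

end

lemma blin_compose:
  assumes "u \<in> carrier (blin V W)" "w \<in> carrier (blin W Z)"
    and "normed_space V" "normed_space W" "normed_space Z"
  shows "compose (carrier V) w u \<in> carrier (blin V Z)"
  unfolding carrier_blin
proof (intro conjI exI ballI)
  have u: "linear_on V W u" and w: "linear_on W Z w"
    using assms by (auto simp: carrier_blin)
  interpret V: normed_space V by fact
  show "linear_on V Z (compose (carrier V) w u)"
    using u w by (auto simp: linear_on_def compose_def Pi_iff)
  fix v assume v: "v \<in> carrier V"
  have uv: "u v \<in> carrier W" using u v by (rule linear_onD)
  have "nrm Z (w (u v)) \<le> nrm (blin W Z) w * nrm W (u v)"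
    using assms uv by (intro blin_norm_bound) auto
  also have "\<dots> \<le> nrm (blin W Z) w * (nrm (blin V W) u * nrm V v)"
    using assms v by (intro mult_left_mono blin_norm_bound blin_norm_nonneg) auto
  finally show "nrm Z (compose (carrier V) w u v)
      \<le> nrm (blin W Z) w * nrm (blin V W) u * nrm V v"
    using v by (simp add: compose_def mult.assoc)
qed simp

context
  fixes F :: "'f nspace"
  assumes F: "normed_space F"
begin

interpretation F: normed_space F by (rule F)

lemma normed_space_dual: "normed_space (dual F)"
  by (rule normed_space_blin[OF F normed_space_real_line])

lemma dual_bound: "\<lbrakk>z \<in> carrier (dual F); v \<in> carrier F\<rbrakk> \<Longrightarrow> \<bar>z v\<bar> \<le> nrm (dual F) z * nrm F v"
  using blin_norm_bound[OF F normed_space_real_line] by fastforce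

lemma dual_add: "\<lbrakk>z \<in> carrier (dual F); v \<in> carrier F; w \<in> carrier F\<rbrakk> \<Longrightarrow> z (v \<oplus>\<^bsub>F\<^esub> w) = z v + z w"
  by (simp add: carrier_blin linear_on_def)

lemma dual_scale: "\<lbrakk>z \<in> carrier (dual F); v \<in> carrier F\<rbrakk> \<Longrightarrow> z (c \<odot>\<^bsub>F\<^esub> v) = c * z v"
  by (simp add: carrier_blin linear_on_def)

lemma dual_zero: "z \<in> carrier (dual F) \<Longrightarrow> z \<zero>\<^bsub>F\<^esub> = 0"
  using linear_on_zero[OF F normed_space_real_line] by (simp add: carrier_blin)

lemma dual_diff: "\<lbrakk>z \<in> carrier (dual F); v \<in> carrier F; w \<in> carrier F\<rbrakk> \<Longrightarrow> z (v \<ominus>\<^bsub>F\<^esub> w) = z v - z w"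
  using linear_on_diff[OF F normed_space_real_line] by (simp add: carrier_blin)

lemma dualI:
  assumes "\<And>v w. \<lbrakk>v \<in> carrier F; w \<in> carrier F\<rbrakk> \<Longrightarrow> m (v \<oplus>\<^bsub>F\<^esub> w) = m v + m w"
    and "\<And>c v. v \<in> carrier F \<Longrightarrow> m (c \<odot>\<^bsub>F\<^esub> v) = c * m v"
    and "\<And>v. v \<in> carrier F \<Longrightarrow> \<bar>m v\<bar> \<le> C * nrm F v"
  shows "restrict m (carrier F) \<in> carrier (dual F)"
  using assms by (auto simp: carrier_blin linear_on_def intro!: exI[of _ C])

lemma dual_norm_le:
  assumes "\<And>v. v \<in> carrier F \<Longrightarrow> \<bar>m v\<bar> \<le> C * nrm F v" "0 \<le> C"
  shows "nrm (dual F) (restrict m (carrier F)) \<le> C"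
  using assms by (intro blin_norm_le_bound[OF F normed_space_real_line]) auto

lemma norming_dual:
  assumes v: "v \<in> carrier F"
  obtains z where "z \<in> carrier (dual F)" "nrm (dual F) z \<le> 1" "\<bar>z v\<bar> = nrm F v"
proof -
  obtain m where m: "\<And>u w. \<lbrakk>u \<in> carrier F; w \<in> carrier F\<rbrakk> \<Longrightarrow> m (u \<oplus>\<^bsub>F\<^esub> w) = m u + m w"
    "\<And>c w. w \<in> carrier F \<Longrightarrow> m (c \<odot>\<^bsub>F\<^esub> w) = c * m w"
    "\<And>w. w \<in> carrier F \<Longrightarrow> \<bar>m w\<bar> \<le> nrm F w"
    "\<bar>m v\<bar> = nrm F v"
    using F.norming_functional[OF v] by metis
  show thesis
  proof (rule that)
    show "restrict m (carrier F) \<in> carrier (dual F)"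
      using m by (intro dualI[of _ 1]) auto
    show "nrm (dual F) (restrict m (carrier F)) \<le> 1"
      using m by (intro dual_norm_le) auto
    show "\<bar>restrict m (carrier F) v\<bar> = nrm F v"
      using m v by simp
  qed
qed

end


section \<open>The norms on finite families\<close>

context
  fixes p :: ereal
  assumes p: "1 \<le> p"
begin

lemma lp_norm_cases:
  obtains "p = \<infinity>" | r where "p = ereal r" "r \<ge> 1"
  using p by (cases p) auto

lemma lp_norm_nonneg: "0 \<le> lp_norm p n a"
  by (auto simp: lp_norm_def)

lemma lp_norm_mono:
  assumes "\<And>i. i < n \<Longrightarrow> \<bar>a i\<bar> \<le> \<bar>b i\<bar>"
  shows "lp_norm p n a \<le> lp_norm p n b"
proof (rule lp_norm_cases)
  assume "p = \<infinity>"
  have "\<bar>a i\<bar> \<le> Max (insert 0 ((\<lambda>i. \<bar>b i\<bar>) ` {..<n}))" if "i < n" for i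
    using assms[OF that] that by (intro order_trans[OF _ Max_ge]) auto
  then show ?thesis
    using \<open>p = \<infinity>\<close> by (auto simp: lp_norm_def)
next
  fix r assume "p = ereal r" "r \<ge> 1"
  then show ?thesis
    using assms by (auto simp: lp_norm_def intro!: powr_mono2 sum_mono sum_nonneg)
qed

lemma lp_norm_scale: "lp_norm p n (\<lambda>i. c * a i) = \<bar>c\<bar> * lp_norm p n a"
proof (rule lp_norm_cases)
  assume "p = \<infinity>"
  have "mono (\<lambda>x. \<bar>c\<bar> * x)"
    by (auto intro!: monoI mult_left_mono)
  then have "\<bar>c\<bar> * Max (insert 0 ((\<lambda>i. \<bar>a i\<bar>) ` {..<n}))
      = Max ((\<lambda>x. \<bar>c\<bar> * x) ` insert 0 ((\<lambda>i. \<bar>a i\<bar>) ` {..<n}))"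
    by (rule mono_Max_commute) auto
  then show ?thesis
    using \<open>p = \<infinity>\<close> by (simp add: lp_norm_def image_image abs_mult)
next
  fix r assume r: "p = ereal r" "r \<ge> 1"
  have "(\<Sum>i<n. \<bar>c * a i\<bar> powr r) = \<bar>c\<bar> powr r * (\<Sum>i<n. \<bar>a i\<bar> powr r)"
    by (simp add: abs_mult powr_mult sum_distrib_left)
  then show ?thesis
    using r by (simp add: lp_norm_def powr_mult powr_powr sum_nonneg)
qed

lemma lp_norm_single: "lp_norm p 1 a = \<bar>a 0\<bar>"
  by (rule lp_norm_cases) (auto simp: lp_norm_def powr_powr lessThan_Suc)

end

lemma conj_exp_ge_1: "1 < p \<Longrightarrow> 1 \<le> conj_exp p"
  by (cases p) (auto simp: conj_exp_def one_ereal_def field_simps)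

text \<open>Young's inequality for the entries divided by the norms of the families. For \<open>p = \<infinity>\<close> the
  conjugate exponent is 1 and the maximum is pulled out of the sum.\<close>

lemma lp_norm_Hoelder:
  assumes p: "1 < p"
  shows "(\<Sum>i<n. \<bar>a i * b i\<bar>) \<le> lp_norm p n a * lp_norm (conj_exp p) n b"
proof (cases "p = \<infinity>")
  case True
  let ?m = "Max (insert 0 ((\<lambda>i. \<bar>a i\<bar>) ` {..<n}))"
  have "(\<Sum>i<n. \<bar>a i * b i\<bar>) \<le> (\<Sum>i<n. ?m * \<bar>b i\<bar>)"
    unfolding abs_mult by (intro sum_mono mult_right_mono) auto
  then show ?thesis
    using True by (simp add: lp_norm_def conj_exp_def one_ereal_def sum_distrib_left sum_nonneg)
next
  case False
  then obtain r where r: "p = ereal r" "r > 1"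
    using p by (cases p) auto
  define s where "s = r / (r - 1)"
  have s: "s > 1" "1 / r + 1 / s = 1"
    using r by (auto simp: s_def field_simps)
  define A where "A = (\<Sum>i<n. \<bar>a i\<bar> powr r)"
  define B where "B = (\<Sum>i<n. \<bar>b i\<bar> powr s)"
  have AB: "lp_norm p n a = A powr (1 / r)" "lp_norm (conj_exp p) n b = B powr (1 / s)"
    using r by (auto simp: lp_norm_def conj_exp_def A_def B_def s_def)
  show ?thesis
  proof (cases "A = 0 \<or> B = 0")
    case True
    then have "\<forall>i<n. a i * b i = 0"
      by (auto simp: A_def B_def sum_nonneg_eq_0_iff)
    then have "(\<Sum>i<n. \<bar>a i * b i\<bar>) = 0"
      by (intro sum.neutral) auto
    then show ?thesis
      by (simp add: AB)
  next
    case False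
    then have pos: "A > 0" "B > 0"
      by (auto simp: A_def B_def order.not_eq_order_implies_strict sum_nonneg)
    let ?A = "A powr (1 / r)" and ?B = "B powr (1 / s)"
    have "\<bar>a i * b i\<bar> \<le> ?A * ?B * (\<bar>a i\<bar> powr r / (A * r) + \<bar>b i\<bar> powr s / (B * s))" for i
    proof -
      have "(\<bar>a i\<bar> / ?A) * (\<bar>b i\<bar> / ?B) \<le> (\<bar>a i\<bar> / ?A) powr r / r + (\<bar>b i\<bar> / ?B) powr s / s"
        using r s by (intro Youngs_inequality) auto
      also have "\<dots> = \<bar>a i\<bar> powr r / (A * r) + \<bar>b i\<bar> powr s / (B * s)"
        using pos r s by (simp add: powr_divide powr_powr)
      finally show ?thesis
        using pos by (simp add: field_simps abs_mult)
    qed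
    then have "(\<Sum>i<n. \<bar>a i * b i\<bar>)
        \<le> (\<Sum>i<n. ?A * ?B * (\<bar>a i\<bar> powr r / (A * r) + \<bar>b i\<bar> powr s / (B * s)))"
      by (intro sum_mono)
    also have "\<dots> = ?A * ?B * (A / (A * r) + B / (B * s))"
      by (simp only: sum_distrib_left[symmetric] sum.distrib sum_divide_distrib[symmetric]
          A_def[symmetric] B_def[symmetric])
    also have "A / (A * r) + B / (B * s) = 1"
      using pos s by simp
    finally show ?thesis
      by (simp add: AB)
  qed
qed

lemma weak_norm_least:
  assumes "normed_space F"
    and "\<And>\<phi>. \<phi> \<in> unit_ball (dual (dual F)) \<Longrightarrow> lp_norm q n (\<lambda>i. \<phi> (z i)) \<le> B"
  shows "weak_norm q F n z \<le> B"
proof -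
  interpret DD: normed_space "dual (dual F)"
    by (intro normed_space_dual assms)
  show ?thesis
    unfolding weak_norm_def by (rule cSUP_least) (use assms DD.zero_in_unit_ball in auto)
qed

lemma bidual_ball_bound:
  assumes F: "normed_space F" and "\<phi> \<in> unit_ball (dual (dual F))" "w \<in> carrier (dual F)"
  shows "\<bar>\<phi> w\<bar> \<le> nrm (dual F) w"
proof -
  interpret D: normed_space "dual F" by (rule normed_space_dual[OF F])
  have "\<bar>\<phi> w\<bar> \<le> nrm (dual (dual F)) \<phi> * nrm (dual F) w"
    using assms by (intro dual_bound[OF D.normed_space_axioms]) (auto simp: unit_ball_def)
  also have "\<dots> \<le> 1 * nrm (dual F) w"
    using assms by (intro mult_right_mono D.nrm_nonneg) (auto simp: unit_ball_def)
  finally show ?thesis by simp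
qed

context
  fixes F :: "'f nspace" and q :: ereal and n :: nat and z :: "nat \<Rightarrow> 'f \<Rightarrow> real"
  assumes F: "normed_space F" and q: "1 \<le> q" and z: "\<And>i. i < n \<Longrightarrow> z i \<in> carrier (dual F)"
begin

interpretation F: normed_space F by (rule F)
interpretation D: normed_space "dual F" by (rule normed_space_dual[OF F])
interpretation DD: normed_space "dual (dual F)" by (rule normed_space_dual[OF D.normed_space_axioms])

lemma weak_norm_upper:
  assumes "\<phi> \<in> unit_ball (dual (dual F))"
  shows "lp_norm q n (\<lambda>i. \<phi> (z i)) \<le> weak_norm q F n z"
  unfolding weak_norm_def
proof (rule cSUP_upper[OF assms])
  show "bdd_above ((\<lambda>\<phi>. lp_norm q n (\<lambda>i. \<phi> (z i))) ` unit_ball (dual (dual F)))"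
  proof (rule bdd_aboveI2)
    fix \<phi> assume "\<phi> \<in> unit_ball (dual (dual F))"
    then show "lp_norm q n (\<lambda>i. \<phi> (z i)) \<le> lp_norm q n (\<lambda>i. nrm (dual F) (z i))"
      using z bidual_ball_bound[OF F] D.nrm_nonneg by (intro lp_norm_mono[OF q]) fastforce
  qed
qed

lemma weak_norm_nonneg: "0 \<le> weak_norm q F n z"
  using weak_norm_upper[OF DD.zero_in_unit_ball] lp_norm_nonneg[OF q] by (rule order_trans[rotated])

text \<open>Evaluation at \<open>v\<close>, divided by the norm of \<open>v\<close>, belongs to the unit ball of the bidual.\<close>

lemma lp_norm_eval_le:
  assumes v: "v \<in> carrier F"
  shows "lp_norm q n (\<lambda>i. z i v) \<le> nrm F v * weak_norm q F n z"
proof (cases "v = \<zero>\<^bsub>F\<^esub>")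
  case True
  then have "lp_norm q n (\<lambda>i. z i v) \<le> lp_norm q n (\<lambda>i. 0 * z i v)"
    using z by (intro lp_norm_mono[OF q]) (auto simp: dual_zero[OF F])
  then show ?thesis
    using True unfolding lp_norm_scale[OF q] by simp
next
  case False
  then have pos: "nrm F v > 0"
    using v F.nrm_nonneg F.nrm_eq_0 by (metis less_eq_real_def)
  let ?\<phi> = "\<lambda>w\<in>carrier (dual F). w v / nrm F v"
  have le: "\<bar>w v / nrm F v\<bar> \<le> 1 * nrm (dual F) w" if "w \<in> carrier (dual F)" for w
    using dual_bound[OF F that v] pos by (simp add: field_simps)
  have "?\<phi> \<in> carrier (dual (dual F))"
    using le v by (intro dualI[OF D.normed_space_axioms, of _ 1]) (auto simp: blin_def add_divide_distrib)
  moreover have "nrm (dual (dual F)) ?\<phi> \<le> 1"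
    using le by (intro dual_norm_le[OF D.normed_space_axioms]) auto
  ultimately have "?\<phi> \<in> unit_ball (dual (dual F))"
    by (simp add: unit_ball_def)
  then have "lp_norm q n (\<lambda>i. ?\<phi> (z i)) \<le> weak_norm q F n z"
    by (rule weak_norm_upper)
  moreover have "lp_norm q n (\<lambda>i. z i v) \<le> lp_norm q n (\<lambda>i. nrm F v * ?\<phi> (z i))"
    using z pos by (intro lp_norm_mono[OF q]) auto
  ultimately show ?thesis
    using pos unfolding lp_norm_scale[OF q] by (simp add: mult_left_mono order_trans)
qed

text \<open>The second adjoint of \<open>u\<close>, divided by the norm of \<open>u\<close>, maps the unit ball of the bidual of \<open>E\<close>
  into that of \<open>F\<close>. If \<open>u\<close> has norm 0, then all functionals \<open>z i \<circ> u\<close> vanish.\<close>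

lemma weak_norm_compose:
  assumes E: "normed_space E" and u: "u \<in> carrier (blin E F)"
  shows "weak_norm q E n (\<lambda>i. compose (carrier E) (z i) u) \<le> nrm (blin E F) u * weak_norm q F n z"
proof (rule weak_norm_least[OF E])
  interpret E: normed_space E by fact
  interpret ED: normed_space "dual E" by (rule normed_space_dual[OF E])
  let ?c = "nrm (blin E F) u"
  let ?u' = "\<lambda>w. compose (carrier E) w u"
  have c: "0 \<le> ?c"
    using u by (rule blin_norm_nonneg[OF E F])
  have u': "?u' w \<in> carrier (dual E)" if "w \<in> carrier (dual F)" for w
    using u that E F normed_space_real_line by (rule blin_compose)
  have u_closed: "u v \<in> carrier F" if "v \<in> carrier E" for v
    using u that by (auto simp: carrier_blin linear_onD)
  have norm_u': "nrm (dual E) (?u' w) \<le> ?c * nrm (dual F) w" if w: "w \<in> carrier (dual F)" for w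
    unfolding compose_def
  proof (rule dual_norm_le[OF E])
    fix v assume v: "v \<in> carrier E"
    have "\<bar>w (u v)\<bar> \<le> nrm (dual F) w * nrm F (u v)"
      using w v u_closed by (intro dual_bound[OF F]) auto
    also have "\<dots> \<le> nrm (dual F) w * (?c * nrm E v)"
      using blin_norm_bound[OF E F u v] D.nrm_nonneg[OF w] by (rule mult_left_mono)
    finally show "\<bar>w (u v)\<bar> \<le> (?c * nrm (dual F) w) * nrm E v"
      by (simp add: mult_ac)
  qed (use c w D.nrm_nonneg in auto)
  fix \<phi> assume \<phi>: "\<phi> \<in> unit_ball (dual (dual E))"
  then have \<phi>': "\<phi> \<in> carrier (dual (dual E))"
    by (simp add: unit_ball_def)
  have le: "\<bar>\<phi> (?u' w)\<bar> \<le> ?c * nrm (dual F) w" if "w \<in> carrier (dual F)" for w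
  proof -
    have "\<bar>\<phi> (?u' w)\<bar> \<le> nrm (dual (dual E)) \<phi> * nrm (dual E) (?u' w)"
      using \<phi>' u' that by (intro dual_bound[OF ED.normed_space_axioms]) auto
    also have "\<dots> \<le> 1 * nrm (dual E) (?u' w)"
      using \<phi> u'[OF that] by (intro mult_right_mono ED.nrm_nonneg) (auto simp: unit_ball_def)
    finally show ?thesis
      using norm_u'[OF that] by simp
  qed
  show "lp_norm q n (\<lambda>i. \<phi> (?u' (z i))) \<le> ?c * weak_norm q F n z"
  proof (cases "?c = 0")
    case True
    have "lp_norm q n (\<lambda>i. \<phi> (?u' (z i))) \<le> lp_norm q n (\<lambda>i. 0 * \<phi> (?u' (z i)))"
      using le z True by (intro lp_norm_mono[OF q]) fastforce
    then show ?thesis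
      using True unfolding lp_norm_scale[OF q] by simp
  next
    case False
    with c have pos: "?c > 0" by simp
    let ?\<psi> = "\<lambda>w\<in>carrier (dual F). \<phi> (?u' w) / ?c"
    have le1: "\<bar>\<phi> (?u' w) / ?c\<bar> \<le> 1 * nrm (dual F) w" if "w \<in> carrier (dual F)" for w
      using le[OF that] pos by (simp add: field_simps)
    have "?\<psi> \<in> carrier (dual (dual F))"
    proof (rule dualI[OF D.normed_space_axioms _ _ le1])
      fix w w' assume w: "w \<in> carrier (dual F)" and w': "w' \<in> carrier (dual F)"
      have "?u' (w \<oplus>\<^bsub>dual F\<^esub> w') = ?u' w \<oplus>\<^bsub>dual E\<^esub> ?u' w'"
        using u_closed by (auto simp: blin_def compose_def restrict_def)
      then show "\<phi> (?u' (w \<oplus>\<^bsub>dual F\<^esub> w')) / ?c = \<phi> (?u' w) / ?c + \<phi> (?u' w') / ?c"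
        using dual_add[OF ED.normed_space_axioms \<phi>' u'[OF w] u'[OF w']] by (simp add: add_divide_distrib)
    next
      fix c w assume w: "w \<in> carrier (dual F)"
      have "?u' (c \<odot>\<^bsub>dual F\<^esub> w) = c \<odot>\<^bsub>dual E\<^esub> ?u' w"
        using u_closed by (auto simp: blin_def compose_def restrict_def)
      then show "\<phi> (?u' (c \<odot>\<^bsub>dual F\<^esub> w)) / ?c = c * (\<phi> (?u' w) / ?c)"
        using dual_scale[OF ED.normed_space_axioms \<phi>' u'[OF w]] by simp
    qed
    moreover have "nrm (dual (dual F)) ?\<psi> \<le> 1"
      using le1 by (intro dual_norm_le[OF D.normed_space_axioms]) auto
    ultimately have "?\<psi> \<in> unit_ball (dual (dual F))"
      by (simp add: unit_ball_def)
    then have "lp_norm q n (\<lambda>i. ?\<psi> (z i)) \<le> weak_norm q F n z"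
      by (rule weak_norm_upper)
    moreover have "lp_norm q n (\<lambda>i. \<phi> (?u' (z i))) \<le> lp_norm q n (\<lambda>i. ?c * ?\<psi> (z i))"
      using z pos by (intro lp_norm_mono[OF q]) auto
    ultimately show ?thesis
      using pos unfolding lp_norm_scale[OF q] by (simp add: mult_left_mono order_trans)
  qed
qed

end

lemma weak_norm_single:
  assumes F: "normed_space F" and q: "1 \<le> q" and z: "z \<in> carrier (dual F)"
  shows "weak_norm q F 1 (\<lambda>_. z) \<le> nrm (dual F) z"
proof (rule weak_norm_least[OF F])
  fix \<phi> assume "\<phi> \<in> unit_ball (dual (dual F))"
  then show "lp_norm q 1 (\<lambda>_. \<phi> z) \<le> nrm (dual F) z"
    unfolding lp_norm_single[OF q] using z by (rule bidual_ball_bound[OF F])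
qed


section \<open>Weak limits\<close>

context
  fixes F :: "'f nspace"
  assumes F: "normed_space F"
begin

interpretation F: normed_space F by (rule F)

lemma dual_separates:
  assumes v: "v \<in> carrier F" and w: "w \<in> carrier F"
    and eq: "\<And>z. z \<in> carrier (dual F) \<Longrightarrow> z v = z w"
  shows "v = w"
proof -
  have vw: "v \<ominus>\<^bsub>F\<^esub> w \<in> carrier F"
    using v w by simp
  obtain z where z: "z \<in> carrier (dual F)" "\<bar>z (v \<ominus>\<^bsub>F\<^esub> w)\<bar> = nrm F (v \<ominus>\<^bsub>F\<^esub> w)"
    using norming_dual[OF F vw] by metis
  then have "nrm F (v \<ominus>\<^bsub>F\<^esub> w) = 0"
    using eq[OF z(1)] dual_diff[OF F z(1) v w] by simp
  then show ?thesis
    using F.nrm_eq_0[OF vw] F.diff_eq_zero_iff[OF v w] by simp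
qed

lemma tendsto_dual:
  assumes z: "z \<in> carrier (dual F)" and \<sigma>: "\<And>n. \<sigma> n \<in> carrier F" and l: "l \<in> carrier F"
    and lim: "(\<lambda>n. nrm F (\<sigma> n \<ominus>\<^bsub>F\<^esub> l)) \<longlonglongrightarrow> 0"
  shows "(\<lambda>n. z (\<sigma> n)) \<longlonglongrightarrow> z l"
proof -
  have "norm (z (\<sigma> n) - z l) \<le> nrm (dual F) z * nrm F (\<sigma> n \<ominus>\<^bsub>F\<^esub> l)" for n
    using dual_bound[OF F z, of "\<sigma> n \<ominus>\<^bsub>F\<^esub> l"] dual_diff[OF F z \<sigma> l] \<sigma> l by simp
  then have "(\<lambda>n. z (\<sigma> n) - z l) \<longlonglongrightarrow> 0"
    by (rule Lim_null_comparison[OF always_eventually[OF allI] tendsto_mult_right_zero[OF lim]])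
  then show ?thesis
    by (rule LIM_zero_cancel)
qed

end


section \<open>Lip-linear and Cohen strongly summing operators\<close>

lemma carrier_LipL0:
  "T \<in> carrier (LipL0 X E F) \<longleftrightarrow>
     T \<in> extensional (pts X \<times> carrier E) \<and> (\<forall>x\<in>pts X. linear_on E F (\<lambda>e. T (x, e))) \<and>
     (\<exists>C>0. LipL_bound X E F T C) \<and> (\<forall>e\<in>carrier E. T (base X, e) = \<zero>\<^bsub>F\<^esub>)"
  by (simp add: LipL0_def)

lemma LipL0_simps [simp]:
  "\<zero>\<^bsub>LipL0 X E F\<^esub> = (\<lambda>a\<in>pts X \<times> carrier E. \<zero>\<^bsub>F\<^esub>)"
  "S \<oplus>\<^bsub>LipL0 X E F\<^esub> T = (\<lambda>a\<in>pts X \<times> carrier E. S a \<oplus>\<^bsub>F\<^esub> T a)"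
  "c \<odot>\<^bsub>LipL0 X E F\<^esub> T = (\<lambda>a\<in>pts X \<times> carrier E. c \<odot>\<^bsub>F\<^esub> T a)"
  by (simp_all add: LipL0_def)

lemma LipL_boundD:
  "\<lbrakk>LipL_bound X E F T C; x \<in> pts X; y \<in> pts X; e \<in> carrier E\<rbrakk>
    \<Longrightarrow> nrm F (T (x, e) \<ominus>\<^bsub>F\<^esub> T (y, e)) \<le> C * pdist X x y * nrm E e"
  by (simp add: LipL_bound_def)

locale LipL_setting =
  fixes X :: "'x pmspace" and E :: "'e nspace" and F :: "'f nspace"
  assumes X: "pointed_metric_space X" and E: "normed_space E" and F: "normed_space F"
begin

sublocale E: normed_space E by (rule E)
sublocale F: normed_space F by (rule F)

lemma base_in_pts: "base X \<in> pts X"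
  using X by (simp add: pointed_metric_space_def)

lemma LipL0_closed:
  "\<lbrakk>T \<in> carrier (LipL0 X E F); x \<in> pts X; e \<in> carrier E\<rbrakk> \<Longrightarrow> T (x, e) \<in> carrier F"
  by (auto simp: carrier_LipL0 linear_on_def)

lemma admissible_LipL_bound: "admissible (LipL_bound X E F T)"
  unfolding LipL_bound_def by (intro admissible_intros) (auto simp: E.nrm_nonneg)

lemma LipL_bound_norm: "T \<in> carrier (LipL0 X E F) \<Longrightarrow> LipL_bound X E F T (LipL_norm X E F T)"
  unfolding LipL_norm_def
  by (rule Inf_admissible[OF admissible_LipL_bound]) (simp add: carrier_LipL0)

lemma LipL_norm_nonneg: "T \<in> carrier (LipL0 X E F) \<Longrightarrow> 0 \<le> LipL_norm X E F T"
  unfolding LipL_norm_def by (rule Inf_admissible_nonneg) (simp add: carrier_LipL0)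

lemma LipL_norm_le: "\<lbrakk>LipL_bound X E F T C; 0 \<le> C\<rbrakk> \<Longrightarrow> LipL_norm X E F T \<le> C"
  unfolding LipL_norm_def by (rule Inf_admissible_le[OF admissible_LipL_bound])

lemma LipL0_I:
  assumes "T \<in> extensional (pts X \<times> carrier E)"
    and "\<And>x. x \<in> pts X \<Longrightarrow> linear_on E F (\<lambda>e. T (x, e))"
    and "\<And>e. e \<in> carrier E \<Longrightarrow> T (base X, e) = \<zero>\<^bsub>F\<^esub>"
    and "LipL_bound X E F T C"
  shows "T \<in> carrier (LipL0 X E F)"
  using assms admissible_ex_pos[OF admissible_LipL_bound] by (auto simp: carrier_LipL0)

lemma LipL0_eq_zero:
  assumes T: "T \<in> carrier (LipL0 X E F)" and "LipL_bound X E F T 0"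
    and x: "x \<in> pts X" and e: "e \<in> carrier E"
  shows "T (x, e) = \<zero>\<^bsub>F\<^esub>"
proof -
  have Txe: "T (x, e) \<in> carrier F"
    using LipL0_closed[OF T x e] .
  have "nrm F (T (x, e) \<ominus>\<^bsub>F\<^esub> T (base X, e)) \<le> 0"
    using assms base_in_pts unfolding LipL_bound_def by fastforce
  moreover have "T (base X, e) = \<zero>\<^bsub>F\<^esub>"
    using T e by (simp add: carrier_LipL0)
  ultimately have "nrm F (T (x, e)) = 0"
    using Txe F.nrm_nonneg[OF Txe] by simp
  then show ?thesis
    using F.nrm_eq_0[OF Txe] by simp
qed

lemma zero_LipL0: "(\<lambda>a\<in>pts X \<times> carrier E. \<zero>\<^bsub>F\<^esub>) \<in> carrier (LipL0 X E F)"
  by (rule LipL0_I[of _ 0]) (auto simp: linear_on_def LipL_bound_def base_in_pts)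

lemma LipL_bound_add:
  assumes S: "S \<in> carrier (LipL0 X E F)" and T: "T \<in> carrier (LipL0 X E F)"
    and "LipL_bound X E F S C" "LipL_bound X E F T D"
  shows "LipL_bound X E F (\<lambda>a\<in>pts X \<times> carrier E. S a \<oplus>\<^bsub>F\<^esub> T a) (C + D)"
  unfolding LipL_bound_def
proof (intro ballI)
  fix x y e assume A: "x \<in> pts X" "y \<in> pts X" "e \<in> carrier E"
  let ?S = "S (x, e) \<ominus>\<^bsub>F\<^esub> S (y, e)" and ?T = "T (x, e) \<ominus>\<^bsub>F\<^esub> T (y, e)"
  have "nrm F (?S \<oplus>\<^bsub>F\<^esub> ?T) \<le> nrm F ?S + nrm F ?T"
    using A S T by (intro F.nrm_triangle) (auto simp: LipL0_closed)
  moreover have "nrm F ?S \<le> C * pdist X x y * nrm E e" "nrm F ?T \<le> D * pdist X x y * nrm E e"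
    using assms A unfolding LipL_bound_def by blast+
  ultimately show "nrm F ((\<lambda>a\<in>pts X \<times> carrier E. S a \<oplus>\<^bsub>F\<^esub> T a) (x, e) \<ominus>\<^bsub>F\<^esub>
      (\<lambda>a\<in>pts X \<times> carrier E. S a \<oplus>\<^bsub>F\<^esub> T a) (y, e)) \<le> (C + D) * pdist X x y * nrm E e"
    using A S T by (simp add: LipL0_closed F.diff_add_diff algebra_simps)
qed

lemma add_LipL0:
  assumes S: "S \<in> carrier (LipL0 X E F)" and T: "T \<in> carrier (LipL0 X E F)"
  shows "(\<lambda>a\<in>pts X \<times> carrier E. S a \<oplus>\<^bsub>F\<^esub> T a) \<in> carrier (LipL0 X E F)"
proof (rule LipL0_I)
  show "linear_on E F (\<lambda>e. (\<lambda>a\<in>pts X \<times> carrier E. S a \<oplus>\<^bsub>F\<^esub> T a) (x, e))" if x: "x \<in> pts X" for x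
  proof -
    have "linear_on E F (\<lambda>e. S (x, e))" "linear_on E F (\<lambda>e. T (x, e))"
      using S T x by (auto simp: carrier_LipL0)
    then show ?thesis
      using x by (auto simp: linear_on_def F.scale_add_right F.M.a_ac Pi_iff)
  qed
  show "LipL_bound X E F (\<lambda>a\<in>pts X \<times> carrier E. S a \<oplus>\<^bsub>F\<^esub> T a)
      (LipL_norm X E F S + LipL_norm X E F T)"
    using S T by (intro LipL_bound_add LipL_bound_norm)
qed (use S T base_in_pts in \<open>auto simp: carrier_LipL0\<close>)

lemma LipL_bound_scale:
  assumes T: "T \<in> carrier (LipL0 X E F)" and "LipL_bound X E F T C"
  shows "LipL_bound X E F (\<lambda>a\<in>pts X \<times> carrier E. c \<odot>\<^bsub>F\<^esub> T a) (\<bar>c\<bar> * C)"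
  unfolding LipL_bound_def
proof (intro ballI)
  fix x y e assume A: "x \<in> pts X" "y \<in> pts X" "e \<in> carrier E"
  have "nrm F (T (x, e) \<ominus>\<^bsub>F\<^esub> T (y, e)) \<le> C * pdist X x y * nrm E e"
    using assms A unfolding LipL_bound_def by blast
  then show "nrm F ((\<lambda>a\<in>pts X \<times> carrier E. c \<odot>\<^bsub>F\<^esub> T a) (x, e) \<ominus>\<^bsub>F\<^esub>
      (\<lambda>a\<in>pts X \<times> carrier E. c \<odot>\<^bsub>F\<^esub> T a) (y, e)) \<le> \<bar>c\<bar> * C * pdist X x y * nrm E e"
    using A T by (simp add: LipL0_closed F.scale_diff F.nrm_smult mult.assoc mult_left_mono)
qed

lemma scale_LipL0:
  assumes T: "T \<in> carrier (LipL0 X E F)"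
  shows "(\<lambda>a\<in>pts X \<times> carrier E. c \<odot>\<^bsub>F\<^esub> T a) \<in> carrier (LipL0 X E F)"
proof (rule LipL0_I)
  show "linear_on E F (\<lambda>e. (\<lambda>a\<in>pts X \<times> carrier E. c \<odot>\<^bsub>F\<^esub> T a) (x, e))" if x: "x \<in> pts X" for x
  proof -
    have "linear_on E F (\<lambda>e. T (x, e))"
      using T x by (auto simp: carrier_LipL0)
    then show ?thesis
      using x by (auto simp: linear_on_def F.scale_add_right F.scale_scale mult.commute Pi_iff)
  qed
  show "LipL_bound X E F (\<lambda>a\<in>pts X \<times> carrier E. c \<odot>\<^bsub>F\<^esub> T a) (\<bar>c\<bar> * LipL_norm X E F T)"
    using T by (intro LipL_bound_scale LipL_bound_norm)
qed (use T base_in_pts in \<open>auto simp: carrier_LipL0\<close>)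

lemma normed_space_LipL0: "normed_space (LipL0 X E F)"
proof -
  let ?M = "carrier (LipL0 X E F)" and ?N = "LipL_norm X E F"
  have "normed_space (fun_nspace (pts X \<times> carrier E) F ?M ?N)"
  proof (rule normed_space_fun_nspace[OF F])
    show "f a = \<zero>\<^bsub>F\<^esub>" if "f \<in> ?M" "?N f = 0" "a \<in> pts X \<times> carrier E" for f a
      using LipL0_eq_zero[OF that(1)] LipL_bound_norm[OF that(1)] that(2,3) by (cases a) auto
    show "f a \<in> carrier F" if "f \<in> ?M" "a \<in> pts X \<times> carrier E" for f a
      using LipL0_closed that by (cases a) auto
    show "?N (\<lambda>a\<in>pts X \<times> carrier E. f a \<oplus>\<^bsub>F\<^esub> g a) \<le> ?N f + ?N g" if "f \<in> ?M" "g \<in> ?M" for f g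
      using that by (intro LipL_norm_le LipL_bound_add LipL_bound_norm add_nonneg_nonneg LipL_norm_nonneg)
    show "?N (\<lambda>a\<in>pts X \<times> carrier E. c \<odot>\<^bsub>F\<^esub> f a) \<le> \<bar>c\<bar> * ?N f" if "f \<in> ?M" for c f
      using that
      by (intro LipL_norm_le LipL_bound_scale LipL_bound_norm mult_nonneg_nonneg LipL_norm_nonneg) auto
    show "?M \<subseteq> extensional (pts X \<times> carrier E)"
      by (auto simp: carrier_LipL0)
  qed (simp_all add: zero_LipL0 add_LipL0 scale_LipL0 LipL_norm_nonneg)
  moreover have "fun_nspace (pts X \<times> carrier E) F ?M ?N = LipL0 X E F"
    by (simp add: LipL0_def)
  ultimately show ?thesis by simp
qed

end

locale cohen_setting = LipL_setting X E F
  for X :: "'x pmspace" and E :: "'e nspace" and F :: "'f nspace" +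
  fixes p :: ereal
  assumes p: "1 < p"
begin

lemma p_ge_1: "1 \<le> p"
  using p by simp

lemma q_ge_1: "1 \<le> conj_exp p"
  using p by (rule conj_exp_ge_1)

lemma admissible_cohen: "admissible (cohen_LipL_bound p X E F T)"
  unfolding cohen_LipL_bound_def
  by (intro admissible_intros)
     (auto simp: lp_norm_nonneg[OF p_ge_1] intro!: weak_norm_nonneg[OF F q_ge_1])

lemma cohen_bound_norm: "T \<in> cohen_LipL p X E F \<Longrightarrow> cohen_LipL_bound p X E F T (cohen_LipL_norm p X E F T)"
  unfolding cohen_LipL_norm_def
  by (rule Inf_admissible[OF admissible_cohen]) (simp add: cohen_LipL_def)

lemma cohen_norm_nonneg: "T \<in> cohen_LipL p X E F \<Longrightarrow> 0 \<le> cohen_LipL_norm p X E F T"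
  unfolding cohen_LipL_norm_def by (rule Inf_admissible_nonneg) (simp add: cohen_LipL_def)

lemma cohen_norm_le: "\<lbrakk>cohen_LipL_bound p X E F T C; 0 \<le> C\<rbrakk> \<Longrightarrow> cohen_LipL_norm p X E F T \<le> C"
  unfolding cohen_LipL_norm_def by (rule Inf_admissible_le[OF admissible_cohen])

lemma cohen_LipL_LipL0: "T \<in> cohen_LipL p X E F \<Longrightarrow> T \<in> carrier (LipL0 X E F)"
  by (simp add: cohen_LipL_def)

lemma cohen_LipL_boundD:
  assumes "cohen_LipL_bound p X E F T C"
    and "\<And>i. i < n \<Longrightarrow> x i \<in> pts X" "\<And>i. i < n \<Longrightarrow> y i \<in> pts X"
    and "\<And>i. i < n \<Longrightarrow> e i \<in> carrier E" "\<And>i. i < n \<Longrightarrow> z i \<in> carrier (dual F)"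
  shows "(\<Sum>i<n. \<bar>z i (T (x i, e i) \<ominus>\<^bsub>F\<^esub> T (y i, e i))\<bar>)
    \<le> C * lp_norm p n (\<lambda>i. pdist X (x i) (y i) * nrm E (e i)) * weak_norm (conj_exp p) F n z"
  using assms unfolding cohen_LipL_bound_def by blast

text \<open>One instance of the inequality, for a family of length 1 and a functional that norms the
  difference of the two values, gives the Lipschitz estimate.\<close>

lemma cohen_bound_imp_LipL_bound:
  assumes bound: "cohen_LipL_bound p X E F T C" and C: "0 \<le> C"
    and T: "\<And>x e. \<lbrakk>x \<in> pts X; e \<in> carrier E\<rbrakk> \<Longrightarrow> T (x, e) \<in> carrier F"
  shows "LipL_bound X E F T C"
  unfolding LipL_bound_def
proof (intro ballI)
  fix x y e assume A: "x \<in> pts X" "y \<in> pts X" "e \<in> carrier E"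
  let ?d = "pdist X x y * nrm E e" and ?v = "T (x, e) \<ominus>\<^bsub>F\<^esub> T (y, e)"
  have "?v \<in> carrier F"
    using A T by simp
  then obtain z where z: "z \<in> carrier (dual F)" "nrm (dual F) z \<le> 1" "\<bar>z ?v\<bar> = nrm F ?v"
    using norming_dual[OF F] by metis
  have d: "0 \<le> ?d"
    using E.nrm_nonneg[OF A(3)] by simp
  have "nrm F ?v \<le> C * lp_norm p 1 (\<lambda>_. ?d) * weak_norm (conj_exp p) F 1 (\<lambda>_. z)"
    using cohen_LipL_boundD[OF bound, of 1 "\<lambda>_. x" "\<lambda>_. y" "\<lambda>_. e" "\<lambda>_. z"] A z by simp
  also have "\<dots> = C * ?d * weak_norm (conj_exp p) F 1 (\<lambda>_. z)"
    using d by (simp only: lp_norm_single[OF p_ge_1] abs_of_nonneg)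
  also have "\<dots> \<le> C * ?d * 1"
    using weak_norm_single[OF F q_ge_1 z(1)] z(2) C d by (intro mult_left_mono) auto
  finally show "nrm F ?v \<le> C * pdist X x y * nrm E e"
    by (simp add: mult.assoc)
qed

lemma cohen_LipL_I:
  assumes "T \<in> extensional (pts X \<times> carrier E)"
    and lin: "\<And>x. x \<in> pts X \<Longrightarrow> linear_on E F (\<lambda>e. T (x, e))"
    and "\<And>e. e \<in> carrier E \<Longrightarrow> T (base X, e) = \<zero>\<^bsub>F\<^esub>"
    and bound: "cohen_LipL_bound p X E F T C" and "0 \<le> C"
  shows "T \<in> cohen_LipL p X E F"
proof -
  have "LipL_bound X E F T C"
    by (rule cohen_bound_imp_LipL_bound) (use assms linear_onD(1)[OF lin] in auto)
  then have "T \<in> carrier (LipL0 X E F)"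
    using assms by (intro LipL0_I)
  then show ?thesis
    using admissible_ex_pos[OF admissible_cohen bound] by (simp add: cohen_LipL_def)
qed

lemma LipL_norm_le_cohen_norm:
  assumes T: "T \<in> cohen_LipL p X E F"
  shows "LipL_norm X E F T \<le> cohen_LipL_norm p X E F T"
  using assms cohen_LipL_LipL0[OF T]
  by (intro LipL_norm_le cohen_bound_imp_LipL_bound cohen_bound_norm cohen_norm_nonneg)
     (auto simp: LipL0_closed)

lemma zero_cohen: "(\<lambda>a\<in>pts X \<times> carrier E. \<zero>\<^bsub>F\<^esub>) \<in> cohen_LipL p X E F"
  by (rule cohen_LipL_I[of _ 0])
     (auto simp: linear_on_def cohen_LipL_bound_def base_in_pts dual_zero[OF F])

lemma cohen_bound_add:
  assumes S: "S \<in> carrier (LipL0 X E F)" and T: "T \<in> carrier (LipL0 X E F)"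
    and bounds: "cohen_LipL_bound p X E F S C" "cohen_LipL_bound p X E F T D"
  shows "cohen_LipL_bound p X E F (\<lambda>a\<in>pts X \<times> carrier E. S a \<oplus>\<^bsub>F\<^esub> T a) (C + D)"
  unfolding cohen_LipL_bound_def
proof (intro allI impI)
  fix n :: nat and x y e z
  assume A: "\<forall>i<n. x i \<in> pts X \<and> y i \<in> pts X \<and> e i \<in> carrier E \<and> z i \<in> carrier (dual F)"
  let ?ST = "\<lambda>a\<in>pts X \<times> carrier E. S a \<oplus>\<^bsub>F\<^esub> T a"
  let ?d = "\<lambda>T i. T (x i, e i) \<ominus>\<^bsub>F\<^esub> T (y i, e i)"
  let ?R = "lp_norm p n (\<lambda>i. pdist X (x i) (y i) * nrm E (e i)) * weak_norm (conj_exp p) F n z"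
  have "z i (?d ?ST i) = z i (?d S i) + z i (?d T i)" if "i < n" for i
    using A that S T by (simp add: LipL0_closed F.diff_add_diff dual_add[OF F])
  then have "(\<Sum>i<n. \<bar>z i (?d ?ST i)\<bar>) \<le> (\<Sum>i<n. \<bar>z i (?d S i)\<bar>) + (\<Sum>i<n. \<bar>z i (?d T i)\<bar>)"
    unfolding sum.distrib[symmetric] by (intro sum_mono) (simp add: abs_triangle_ineq)
  also have "\<dots> \<le> C * ?R + D * ?R"
    using cohen_LipL_boundD[OF bounds(1), of n x y e z] cohen_LipL_boundD[OF bounds(2), of n x y e z] A
    by (simp add: mult.assoc)
  finally show "(\<Sum>i<n. \<bar>z i (?d ?ST i)\<bar>) \<le> (C + D) *
      lp_norm p n (\<lambda>i. pdist X (x i) (y i) * nrm E (e i)) * weak_norm (conj_exp p) F n z"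
    by (simp add: algebra_simps)
qed

lemma cohen_bound_scale:
  assumes T: "T \<in> carrier (LipL0 X E F)" and bound: "cohen_LipL_bound p X E F T C"
  shows "cohen_LipL_bound p X E F (\<lambda>a\<in>pts X \<times> carrier E. c \<odot>\<^bsub>F\<^esub> T a) (\<bar>c\<bar> * C)"
  unfolding cohen_LipL_bound_def
proof (intro allI impI)
  fix n :: nat and x y e z
  assume A: "\<forall>i<n. x i \<in> pts X \<and> y i \<in> pts X \<and> e i \<in> carrier E \<and> z i \<in> carrier (dual F)"
  let ?cT = "\<lambda>a\<in>pts X \<times> carrier E. c \<odot>\<^bsub>F\<^esub> T a"
  let ?d = "\<lambda>T i. T (x i, e i) \<ominus>\<^bsub>F\<^esub> T (y i, e i)"
  let ?R = "lp_norm p n (\<lambda>i. pdist X (x i) (y i) * nrm E (e i)) * weak_norm (conj_exp p) F n z"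
  have "z i (?d ?cT i) = c * z i (?d T i)" if "i < n" for i
    using A that T by (simp add: LipL0_closed F.scale_diff dual_scale[OF F])
  then have "(\<Sum>i<n. \<bar>z i (?d ?cT i)\<bar>) = \<bar>c\<bar> * (\<Sum>i<n. \<bar>z i (?d T i)\<bar>)"
    by (simp add: abs_mult sum_distrib_left)
  also have "\<dots> \<le> \<bar>c\<bar> * (C * ?R)"
    using cohen_LipL_boundD[OF bound, of n x y e z] A by (intro mult_left_mono) (auto simp: mult.assoc)
  finally show "(\<Sum>i<n. \<bar>z i (?d ?cT i)\<bar>) \<le> \<bar>c\<bar> * C *
      lp_norm p n (\<lambda>i. pdist X (x i) (y i) * nrm E (e i)) * weak_norm (conj_exp p) F n z"
    by (simp add: mult.assoc)
qed

lemma add_cohen: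
  assumes "S \<in> cohen_LipL p X E F" "T \<in> cohen_LipL p X E F"
  shows "(\<lambda>a\<in>pts X \<times> carrier E. S a \<oplus>\<^bsub>F\<^esub> T a) \<in> cohen_LipL p X E F"
  using assms add_LipL0[of S T] admissible_ex_pos[OF admissible_cohen] cohen_bound_add[of S T]
  unfolding cohen_LipL_def by blast

lemma scale_cohen:
  assumes "T \<in> cohen_LipL p X E F"
  shows "(\<lambda>a\<in>pts X \<times> carrier E. c \<odot>\<^bsub>F\<^esub> T a) \<in> cohen_LipL p X E F"
  using assms scale_LipL0[of T] admissible_ex_pos[OF admissible_cohen] cohen_bound_scale[of T]
  unfolding cohen_LipL_def by blast

lemma submodule_cohen: "submodule (cohen_LipL p X E F) real_ring (LipL0 X E F)"
proof -
  interpret L: normed_space "LipL0 X E F" by (rule normed_space_LipL0)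
  show ?thesis
  proof (rule L.submoduleI)
    show "\<ominus>\<^bsub>LipL0 X E F\<^esub> T \<in> cohen_LipL p X E F" if "T \<in> cohen_LipL p X E F" for T
      using that scale_cohen[OF that, of "- 1"] by (simp add: L.uminus_eq cohen_LipL_LipL0)
  qed (use cohen_LipL_LipL0 in \<open>auto simp: zero_cohen add_cohen scale_cohen\<close>)
qed

lemma normed_space_cohen:
  "normed_space (fun_nspace (pts X \<times> carrier E) F (cohen_LipL p X E F) (cohen_LipL_norm p X E F))"
    (is "normed_space (fun_nspace ?A F ?M ?N)")
proof (rule normed_space_fun_nspace[OF F])
  show "?M \<subseteq> extensional ?A"
    using cohen_LipL_LipL0 by (auto simp: carrier_LipL0)
  show "f a \<in> carrier F" if "f \<in> ?M" "a \<in> ?A" for f a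
    using LipL0_closed cohen_LipL_LipL0 that by (cases a) auto
  show "f a = \<zero>\<^bsub>F\<^esub>" if "f \<in> ?M" "?N f = 0" "a \<in> ?A" for f a
  proof -
    have "LipL_bound X E F f 0"
      using admissible_mono[OF admissible_LipL_bound LipL_bound_norm, of f 0]
        cohen_LipL_LipL0 LipL_norm_le_cohen_norm[of f] that by simp
    then show ?thesis
      using LipL0_eq_zero[of f] cohen_LipL_LipL0 that by (cases a) auto
  qed
  show "?N (\<lambda>a\<in>?A. f a \<oplus>\<^bsub>F\<^esub> g a) \<le> ?N f + ?N g" if "f \<in> ?M" "g \<in> ?M" for f g
    using that
    by (intro cohen_norm_le cohen_bound_add cohen_bound_norm add_nonneg_nonneg cohen_norm_nonneg
        cohen_LipL_LipL0)
  show "?N (\<lambda>a\<in>?A. c \<odot>\<^bsub>F\<^esub> f a) \<le> \<bar>c\<bar> * ?N f" if "f \<in> ?M" for c f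
    using that
    by (intro cohen_norm_le cohen_bound_scale cohen_bound_norm mult_nonneg_nonneg cohen_norm_nonneg
        cohen_LipL_LipL0) auto
qed (simp_all add: zero_cohen add_cohen scale_cohen cohen_norm_nonneg)

text \<open>A pointwise limit of operators with the constant \<open>r\<close> has the constant \<open>r\<close>, because each
  instance of the inequality involves finitely many values. Linearity passes to the limit by testing
  with functionals.\<close>

lemma cohen_ball_closed:
  assumes \<sigma>: "\<And>n. \<sigma> n \<in> cohen_LipL p X E F" and bound: "\<And>n. cohen_LipL_norm p X E F (\<sigma> n) \<le> r"
    and l: "\<And>a. a \<in> pts X \<times> carrier E \<Longrightarrow> l a \<in> carrier F"
    and lim: "\<And>a. a \<in> pts X \<times> carrier E \<Longrightarrow> (\<lambda>n. nrm F (\<sigma> n a \<ominus>\<^bsub>F\<^esub> l a)) \<longlonglongrightarrow> 0"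
  shows "restrict l (pts X \<times> carrier E) \<in> cohen_LipL p X E F"
    and "cohen_LipL_norm p X E F (restrict l (pts X \<times> carrier E)) \<le> r"
proof -
  let ?T = "restrict l (pts X \<times> carrier E)"
  have \<sigma>': "\<sigma> n \<in> carrier (LipL0 X E F)" for n
    using \<sigma> by (rule cohen_LipL_LipL0)
  have r: "0 \<le> r"
    using cohen_norm_nonneg[OF \<sigma>] bound by (rule order_trans)
  have zlim: "(\<lambda>n. z (\<sigma> n (x, e))) \<longlonglongrightarrow> z (l (x, e))"
    if "z \<in> carrier (dual F)" "x \<in> pts X" "e \<in> carrier E" for z x e
    using that l lim \<sigma>' LipL0_closed by (intro tendsto_dual[OF F]) auto
  have lin: "linear_on E F (\<lambda>e. \<sigma> n (x, e))" if "x \<in> pts X" for n x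
    using \<sigma>' that by (auto simp: carrier_LipL0)
  have bound_T: "cohen_LipL_bound p X E F ?T r"
    unfolding cohen_LipL_bound_def
  proof (intro allI impI)
    fix n :: nat and x y e z
    assume A: "\<forall>i<n. x i \<in> pts X \<and> y i \<in> pts X \<and> e i \<in> carrier E \<and> z i \<in> carrier (dual F)"
    let ?d = "\<lambda>T i. T (x i, e i) \<ominus>\<^bsub>F\<^esub> T (y i, e i)"
    have "(\<lambda>k. z i (?d (\<sigma> k) i)) \<longlonglongrightarrow> z i (?d ?T i)" if "i < n" for i
    proof -
      have "z i (?d (\<sigma> k) i) = z i (\<sigma> k (x i, e i)) - z i (\<sigma> k (y i, e i))" for k
        using A that \<sigma>' LipL0_closed by (intro dual_diff[OF F]) auto
      moreover have "z i (?d ?T i) = z i (l (x i, e i)) - z i (l (y i, e i))"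
        using A that l by (simp add: dual_diff[OF F])
      moreover have "(\<lambda>k. z i (\<sigma> k (x i, e i)) - z i (\<sigma> k (y i, e i)))
          \<longlonglongrightarrow> z i (l (x i, e i)) - z i (l (y i, e i))"
        using A that zlim by (intro tendsto_diff) auto
      ultimately show ?thesis by simp
    qed
    then have "(\<lambda>k. \<Sum>i<n. \<bar>z i (?d (\<sigma> k) i)\<bar>) \<longlonglongrightarrow> (\<Sum>i<n. \<bar>z i (?d ?T i)\<bar>)"
      by (intro tendsto_sum tendsto_rabs) auto
    moreover have "(\<Sum>i<n. \<bar>z i (?d (\<sigma> k) i)\<bar>)
        \<le> r * lp_norm p n (\<lambda>i. pdist X (x i) (y i) * nrm E (e i)) * weak_norm (conj_exp p) F n z" for k
      using admissible_mono[OF admissible_cohen cohen_bound_norm[OF \<sigma>] bound, of k] A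
      by (intro cohen_LipL_boundD) auto
    ultimately show "(\<Sum>i<n. \<bar>z i (?d ?T i)\<bar>)
        \<le> r * lp_norm p n (\<lambda>i. pdist X (x i) (y i) * nrm E (e i)) * weak_norm (conj_exp p) F n z"
      by (intro LIMSEQ_le_const2) auto
  qed
  show "?T \<in> cohen_LipL p X E F"
  proof (rule cohen_LipL_I[OF _ _ _ bound_T r])
    fix x assume x: "x \<in> pts X"
    have "l (x, e \<oplus>\<^bsub>E\<^esub> e') = l (x, e) \<oplus>\<^bsub>F\<^esub> l (x, e')" if e: "e \<in> carrier E" "e' \<in> carrier E" for e e'
    proof (rule dual_separates[OF F])
      fix z assume z: "z \<in> carrier (dual F)"
      have "z (\<sigma> n (x, e \<oplus>\<^bsub>E\<^esub> e')) = z (\<sigma> n (x, e)) + z (\<sigma> n (x, e'))" for n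
        using e x \<sigma>' by (simp add: linear_onD(2)[OF lin] dual_add[OF F z] LipL0_closed)
      then have "(\<lambda>n. z (\<sigma> n (x, e \<oplus>\<^bsub>E\<^esub> e'))) \<longlonglongrightarrow> z (l (x, e)) + z (l (x, e'))"
        using tendsto_add[OF zlim[OF z x e(1)] zlim[OF z x e(2)]] by simp
      then show "z (l (x, e \<oplus>\<^bsub>E\<^esub> e')) = z (l (x, e) \<oplus>\<^bsub>F\<^esub> l (x, e'))"
        using zlim[OF z x, of "e \<oplus>\<^bsub>E\<^esub> e'"] e x l by (simp add: dual_add[OF F z] LIMSEQ_unique)
    qed (use e x l in auto)
    moreover have "l (x, c \<odot>\<^bsub>E\<^esub> e) = c \<odot>\<^bsub>F\<^esub> l (x, e)" if e: "e \<in> carrier E" for c e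
    proof (rule dual_separates[OF F])
      fix z assume z: "z \<in> carrier (dual F)"
      have "z (\<sigma> n (x, c \<odot>\<^bsub>E\<^esub> e)) = c * z (\<sigma> n (x, e))" for n
        using e x \<sigma>' by (simp add: linear_onD(3)[OF lin] dual_scale[OF F z] LipL0_closed)
      then have "(\<lambda>n. z (\<sigma> n (x, c \<odot>\<^bsub>E\<^esub> e))) \<longlonglongrightarrow> c * z (l (x, e))"
        using tendsto_mult_left[OF zlim[OF z x e]] by simp
      then show "z (l (x, c \<odot>\<^bsub>E\<^esub> e)) = z (c \<odot>\<^bsub>F\<^esub> l (x, e))"
        using zlim[OF z x, of "c \<odot>\<^bsub>E\<^esub> e"] e x l by (simp add: dual_scale[OF F z] LIMSEQ_unique)
    qed (use e x l in auto)
    ultimately show "linear_on E F (\<lambda>e. ?T (x, e))"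
      using x l by (auto simp: linear_on_def)
  next
    fix e assume e: "e \<in> carrier E"
    have "l (base X, e) = \<zero>\<^bsub>F\<^esub>"
    proof (rule dual_separates[OF F])
      fix z assume z: "z \<in> carrier (dual F)"
      have "z (\<sigma> n (base X, e)) = 0" for n
        using \<sigma>' e dual_zero[OF F z] by (simp add: carrier_LipL0)
      then show "z (l (base X, e)) = z \<zero>\<^bsub>F\<^esub>"
        using zlim[OF z base_in_pts e] by (simp add: dual_zero[OF F z] LIMSEQ_const_iff)
    qed (use e l base_in_pts in auto)
    then show "?T (base X, e) = \<zero>\<^bsub>F\<^esub>"
      using e base_in_pts by simp
  qed auto
  show "cohen_LipL_norm p X E F ?T \<le> r"
    using bound_T r by (rule cohen_norm_le)
qed

lemma banach_space_cohen:
  assumes "banach_space F"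
  shows "banach_space ((LipL0 X E F)\<lparr>carrier := cohen_LipL p X E F, nrm := cohen_LipL_norm p X E F\<rparr>)"
proof -
  let ?A = "pts X \<times> carrier E" and ?M = "cohen_LipL p X E F" and ?N = "cohen_LipL_norm p X E F"
  have closed: "T a \<in> carrier F" if "a \<in> ?A" "T \<in> ?M" for T a
    using LipL0_closed cohen_LipL_LipL0 that by (cases a) auto
  have "banach_space (fun_nspace ?A F ?M ?N)"
  proof (rule banach_space_by_evaluations[where ev = "\<lambda>a T. T a" and I = ?A, OF normed_space_cohen assms])
    fix a assume a: "a \<in> ?A"
    then obtain x e where xe: "a = (x, e)" "x \<in> pts X" "e \<in> carrier E"
      by auto
    show "T a \<in> carrier F" if "T \<in> carrier (fun_nspace ?A F ?M ?N)" for T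
      using closed a that by simp
    show "(S \<ominus>\<^bsub>fun_nspace ?A F ?M ?N\<^esub> T) a = S a \<ominus>\<^bsub>F\<^esub> T a"
      if "S \<in> carrier (fun_nspace ?A F ?M ?N)" "T \<in> carrier (fun_nspace ?A F ?M ?N)" for S T
      using that a closed by (intro fun_nspace_diff[OF F normed_space_cohen]) auto
    show "\<exists>c. \<forall>T\<in>carrier (fun_nspace ?A F ?M ?N). nrm F (T a) \<le> c * nrm (fun_nspace ?A F ?M ?N) T"
    proof (intro exI ballI)
      fix T assume "T \<in> carrier (fun_nspace ?A F ?M ?N)"
      then have T: "T \<in> ?M" by simp
      have T': "T \<in> carrier (LipL0 X E F)"
        using T by (rule cohen_LipL_LipL0)
      have "nrm F (T (x, e) \<ominus>\<^bsub>F\<^esub> T (base X, e)) \<le> ?N T * pdist X x (base X) * nrm E e"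
        using admissible_mono[OF admissible_LipL_bound LipL_bound_norm[OF T'] LipL_norm_le_cohen_norm[OF T]]
          xe base_in_pts unfolding LipL_bound_def by blast
      then show "nrm F (T a) \<le> (pdist X x (base X) * nrm E e) * nrm (fun_nspace ?A F ?M ?N) T"
        using T' xe LipL0_closed[OF T' xe(2,3)] by (simp add: carrier_LipL0 mult_ac)
    qed
  next
    fix S T assume "S \<in> carrier (fun_nspace ?A F ?M ?N)" "T \<in> carrier (fun_nspace ?A F ?M ?N)"
      and eq: "\<And>a. a \<in> ?A \<Longrightarrow> S a = T a"
    then have "S \<in> extensional ?A" "T \<in> extensional ?A"
      using cohen_LipL_LipL0 by (auto simp: carrier_LipL0)
    then show "S = T"
      using eq by (rule extensionalityI)
  next
    fix \<sigma> :: "nat \<Rightarrow> 'x \<times> 'e \<Rightarrow> 'f" and l r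
    assume "\<And>n. \<sigma> n \<in> carrier (fun_nspace ?A F ?M ?N)" "\<And>n. nrm (fun_nspace ?A F ?M ?N) (\<sigma> n) \<le> r"
      and "\<And>a. a \<in> ?A \<Longrightarrow> l a \<in> carrier F"
      and "\<And>a. a \<in> ?A \<Longrightarrow> (\<lambda>n. nrm F (\<sigma> n a \<ominus>\<^bsub>F\<^esub> l a)) \<longlonglongrightarrow> 0"
    then have "restrict l ?A \<in> ?M \<and> ?N (restrict l ?A) \<le> r"
      by (intro conjI cohen_ball_closed[of \<sigma>]) auto
    then show "\<exists>T\<in>carrier (fun_nspace ?A F ?M ?N). nrm (fun_nspace ?A F ?M ?N) T \<le> r \<and> (\<forall>a\<in>?A. T a = l a)"
      by (intro bexI[of _ "restrict l ?A"]) auto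
  qed
  moreover have "(LipL0 X E F)\<lparr>carrier := ?M, nrm := ?N\<rparr> = fun_nspace ?A F ?M ?N"
    by (simp add: LipL0_def fun_nspace_def)
  ultimately show ?thesis by simp
qed

end


section \<open>Stability under composition, and operators of rank one\<close>

lemma cohen_settingI:
  "\<lbrakk>pointed_metric_space X; normed_space E; normed_space F; 1 < p\<rbrakk> \<Longrightarrow> cohen_setting X E F p"
  by (simp add: cohen_setting_def cohen_setting_axioms_def LipL_setting_def)

text \<open>The differences of a rank one operator are scalar multiples of \<open>v\<close>, so Hoelder's inequality
  separates the scalars from the numbers \<open>z i v\<close>.\<close>

lemma (in cohen_setting) rank_one_bound:
  fixes f :: "'x \<Rightarrow> real" and \<phi> :: "'e \<Rightarrow> real"
  assumes f: "\<And>x y. \<lbrakk>x \<in> pts X; y \<in> pts X\<rbrakk> \<Longrightarrow> \<bar>f x - f y\<bar> \<le> L * pdist X x y"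
    and \<phi>: "\<And>e. e \<in> carrier E \<Longrightarrow> \<bar>\<phi> e\<bar> \<le> K * nrm E e"
    and v: "v \<in> carrier F" and LK: "0 \<le> L" "0 \<le> K"
  shows "cohen_LipL_bound p X E F (\<lambda>(x, e)\<in>pts X \<times> carrier E. (f x * \<phi> e) \<odot>\<^bsub>F\<^esub> v) (L * K * nrm F v)"
  unfolding cohen_LipL_bound_def
proof (intro allI impI)
  fix n :: nat and x y e z
  assume A: "\<forall>i<n. x i \<in> pts X \<and> y i \<in> pts X \<and> e i \<in> carrier E \<and> z i \<in> carrier (dual F)"
  let ?T = "\<lambda>(x, e)\<in>pts X \<times> carrier E. (f x * \<phi> e) \<odot>\<^bsub>F\<^esub> v"
  let ?a = "\<lambda>i. (f (x i) - f (y i)) * \<phi> (e i)"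
  let ?d = "\<lambda>i. pdist X (x i) (y i) * nrm E (e i)"
  let ?W = "weak_norm (conj_exp p) F n z"
  have W: "0 \<le> ?W"
    using A by (intro weak_norm_nonneg[OF F q_ge_1]) auto
  have "z i (?T (x i, e i) \<ominus>\<^bsub>F\<^esub> ?T (y i, e i)) = ?a i * z i v" if "i < n" for i
    using A that v by (simp add: dual_diff[OF F] dual_scale[OF F] algebra_simps)
  then have "(\<Sum>i<n. \<bar>z i (?T (x i, e i) \<ominus>\<^bsub>F\<^esub> ?T (y i, e i))\<bar>) = (\<Sum>i<n. \<bar>?a i * z i v\<bar>)"
    by simp
  also have "\<dots> \<le> lp_norm p n ?a * lp_norm (conj_exp p) n (\<lambda>i. z i v)"
    by (rule lp_norm_Hoelder[OF p])
  also have "\<dots> \<le> (L * K * lp_norm p n ?d) * (nrm F v * ?W)"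
  proof (rule mult_mono)
    have "\<bar>?a i\<bar> \<le> \<bar>(L * K) * ?d i\<bar>" if "i < n" for i
    proof -
      have "\<bar>?a i\<bar> \<le> (L * pdist X (x i) (y i)) * (K * nrm E (e i))"
        unfolding abs_mult using A that f \<phi> LK by (intro mult_mono) auto
      also have "\<dots> = \<bar>(L * K) * ?d i\<bar>"
        using A that LK E.nrm_nonneg by (simp add: mult_ac)
      finally show ?thesis .
    qed
    then have "lp_norm p n ?a \<le> lp_norm p n (\<lambda>i. (L * K) * ?d i)"
      by (rule lp_norm_mono[OF p_ge_1])
    then show "lp_norm p n ?a \<le> L * K * lp_norm p n ?d"
      unfolding lp_norm_scale[OF p_ge_1] using LK by simp
    show "lp_norm (conj_exp p) n (\<lambda>i. z i v) \<le> nrm F v * ?W"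
      using A v by (intro lp_norm_eval_le[OF F q_ge_1]) auto
  qed (use LK lp_norm_nonneg[OF p_ge_1] lp_norm_nonneg[OF q_ge_1] in auto)
  finally show "(\<Sum>i<n. \<bar>z i (?T (x i, e i) \<ominus>\<^bsub>F\<^esub> ?T (y i, e i))\<bar>)
      \<le> L * K * nrm F v * lp_norm p n ?d * ?W"
    by (simp add: mult_ac)
qed

lemma (in cohen_setting) rank_one_cohen:
  assumes f: "\<And>x y. \<lbrakk>x \<in> pts X; y \<in> pts X\<rbrakk> \<Longrightarrow> \<bar>f x - f y\<bar> \<le> L * pdist X x y" "f (base X) = 0"
    and \<phi>: "\<phi> \<in> carrier (dual E)" and v: "v \<in> carrier F" and L: "0 \<le> L"
  shows "(\<lambda>(x, e)\<in>pts X \<times> carrier E. (f x * \<phi> e) \<odot>\<^bsub>F\<^esub> v) \<in> cohen_LipL p X E F"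
proof (rule cohen_LipL_I)
  show "cohen_LipL_bound p X E F (\<lambda>(x, e)\<in>pts X \<times> carrier E. (f x * \<phi> e) \<odot>\<^bsub>F\<^esub> v)
      (L * nrm (dual E) \<phi> * nrm F v)"
    using f(1) dual_bound[OF E \<phi>] v L blin_norm_nonneg[OF E normed_space_real_line \<phi>]
    by (rule rank_one_bound)
  show "0 \<le> L * nrm (dual E) \<phi> * nrm F v"
    using L blin_norm_nonneg[OF E normed_space_real_line \<phi>] F.nrm_nonneg[OF v] by simp
  show "linear_on E F (\<lambda>e. (\<lambda>(x, e)\<in>pts X \<times> carrier E. (f x * \<phi> e) \<odot>\<^bsub>F\<^esub> v) (x, e))"
    if "x \<in> pts X" for x
    using that v by (auto simp: linear_on_def dual_add[OF E \<phi>] dual_scale[OF E \<phi>] distrib_left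
        F.scale_add_left F.scale_scale mult_ac)
qed (use f(2) v base_in_pts in auto)

lemma Lip_bound:
  assumes f: "f \<in> Lip0 X Y" and xy: "x \<in> pts X" "y \<in> pts X"
  shows "0 \<le> Lip X Y f" "pdist Y (f x) (f y) \<le> Lip X Y f * pdist X x y"
proof -
  let ?S = "{C. 0 \<le> C \<and> (\<forall>x\<in>pts X. \<forall>y\<in>pts X. pdist Y (f x) (f y) \<le> C * pdist X x y)}"
  obtain B where B: "B > 0" "\<forall>x\<in>pts X. \<forall>y\<in>pts X. pdist Y (f x) (f y) \<le> B * pdist X x y"
    using f by (auto simp: Lip0_def Lipschitz_continuous_map_pos)
  then have ne: "?S \<noteq> {}"
    by (auto intro!: exI[of _ B])
  show "0 \<le> Lip X Y f"
    unfolding Lip_def by (rule cInf_greatest[OF ne]) auto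
  show "pdist Y (f x) (f y) \<le> Lip X Y f * pdist X x y"
  proof (cases "x = y")
    case True
    then have d: "pdist X x y = 0"
      using xy by simp
    have "pdist Y (f x) (f y) \<le> B * pdist X x y"
      using B xy by blast
    with d show ?thesis by simp
  next
    case False
    then have pos: "pdist X x y > 0"
      using xy mdist_nonneg mdist_zero by (metis less_eq_real_def)
    have "pdist Y (f x) (f y) / pdist X x y \<le> Lip X Y f"
      unfolding Lip_def by (rule cInf_greatest[OF ne]) (use xy pos in \<open>auto simp: field_simps\<close>)
    then show ?thesis
      using pos by (simp add: field_simps)
  qed
qed

text \<open>A functional \<open>z\<close> applied to a difference of values of \<open>S\<close> is \<open>z \<circ> u\<close> applied to a difference of
  values of \<open>T\<close>. The functions \<open>f\<close> and \<open>v\<close> act on the strong norm of the family, and \<open>u\<close> on the weak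
  norm of the functionals.\<close>

lemma cohen_ideal_property:
  fixes X :: "'x pmspace" and E :: "'e nspace" and F :: "'f nspace"
    and X0 :: "'y pmspace" and E0 :: "'g nspace" and F0 :: "'h nspace"
  assumes "cohen_setting X E F p" "cohen_setting X0 E0 F0 p"
    and f: "f \<in> Lip0 X X0" and v: "v \<in> carrier (blin E E0)"
    and T: "T \<in> cohen_LipL p X0 E0 F0" and u: "u \<in> carrier (blin F0 F)"
  defines "S \<equiv> \<lambda>(x, e)\<in>pts X \<times> carrier E. u (T (f x, v e))"
  shows "S \<in> cohen_LipL p X E F"
    and "cohen_LipL_norm p X E F S
      \<le> nrm (blin F0 F) u * cohen_LipL_norm p X0 E0 F0 T * Lip X X0 f * nrm (blin E E0) v"
proof -
  interpret A: cohen_setting X E F p by fact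
  interpret B: cohen_setting X0 E0 F0 p by fact
  let ?u = "nrm (blin F0 F) u" and ?v = "nrm (blin E E0) v"
  let ?L = "Lip X X0 f" and ?C = "cohen_LipL_norm p X0 E0 F0 T"
  have u_lin: "linear_on F0 F u" and v_lin: "linear_on E E0 v"
    using u v by (auto simp: carrier_blin)
  have f_closed: "f x \<in> pts X0" if "x \<in> pts X" for x
    using f that by (auto simp: Lip0_def Lipschitz_continuous_map_def)
  have T': "T \<in> carrier (LipL0 X0 E0 F0)"
    using T by (rule B.cohen_LipL_LipL0)
  have T_lin: "linear_on E0 F0 (\<lambda>e. T (x, e))" if "x \<in> pts X0" for x
    using T' that by (auto simp: carrier_LipL0)
  have v_closed: "v e \<in> carrier E0" if "e \<in> carrier E" for e
    using linear_onD(1)[OF v_lin that] .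
  have T_closed: "T (f x, v e) \<in> carrier F0" if "x \<in> pts X" "e \<in> carrier E" for x e
    using B.LipL0_closed[OF T' f_closed[OF that(1)] v_closed[OF that(2)]] .
  have nonneg: "0 \<le> ?u" "0 \<le> ?v" "0 \<le> ?L" "0 \<le> ?C"
    using blin_norm_nonneg[OF B.F A.F u] blin_norm_nonneg[OF A.E B.E v]
      Lip_bound(1)[OF f A.base_in_pts A.base_in_pts] B.cohen_norm_nonneg[OF T] by auto
  have bound: "cohen_LipL_bound p X E F S (?u * ?C * ?L * ?v)"
    unfolding cohen_LipL_bound_def
  proof (intro allI impI)
    fix n :: nat and x y e z
    assume A: "\<forall>i<n. x i \<in> pts X \<and> y i \<in> pts X \<and> e i \<in> carrier E \<and> z i \<in> carrier (dual F)"
    let ?z = "\<lambda>i. compose (carrier F0) (z i) u"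
    let ?d = "\<lambda>i. pdist X (x i) (y i) * nrm E (e i)"
    let ?b = "\<lambda>i. pdist X0 (f (x i)) (f (y i)) * nrm E0 (v (e i))"
    let ?W = "weak_norm (conj_exp p) F n z" and ?V = "weak_norm (conj_exp p) F0 n ?z"
    have z': "?z i \<in> carrier (dual F0)" if "i < n" for i
      using A that u by (intro blin_compose[OF u _ B.F A.F normed_space_real_line]) auto
    have "z i (S (x i, e i) \<ominus>\<^bsub>F\<^esub> S (y i, e i))
        = ?z i (T (f (x i), v (e i)) \<ominus>\<^bsub>F0\<^esub> T (f (y i), v (e i)))" if "i < n" for i
      using A that T_closed linear_on_diff[OF B.F A.F u_lin]
      by (simp add: S_def compose_def)
    then have "(\<Sum>i<n. \<bar>z i (S (x i, e i) \<ominus>\<^bsub>F\<^esub> S (y i, e i))\<bar>)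
        = (\<Sum>i<n. \<bar>?z i (T (f (x i), v (e i)) \<ominus>\<^bsub>F0\<^esub> T (f (y i), v (e i)))\<bar>)"
      by simp
    also have "\<dots> \<le> ?C * lp_norm p n ?b * ?V"
      using A z' f_closed v_closed by (intro B.cohen_LipL_boundD B.cohen_bound_norm T) auto
    also have "\<dots> \<le> ?C * (?L * ?v * lp_norm p n ?d) * (?u * ?W)"
    proof (intro mult_mono mult_left_mono)
      have "\<bar>?b i\<bar> \<le> \<bar>(?L * ?v) * ?d i\<bar>" if "i < n" for i
      proof -
        have ei: "e i \<in> carrier E" and xy: "x i \<in> pts X" "y i \<in> pts X"
          using A that by auto
        have "?b i \<le> (?L * pdist X (x i) (y i)) * (?v * nrm E (e i))"
          using Lip_bound(2)[OF f xy] blin_norm_bound[OF A.E B.E v ei] nonneg B.E.nrm_nonneg[OF v_closed[OF ei]]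
          by (intro mult_mono) auto
        moreover have "0 \<le> ?b i" "0 \<le> ?d i"
          using B.E.nrm_nonneg[OF v_closed[OF ei]] A.E.nrm_nonneg[OF ei] by auto
        ultimately show ?thesis
          using nonneg by (simp add: mult_ac)
      qed
      then have "lp_norm p n ?b \<le> lp_norm p n (\<lambda>i. (?L * ?v) * ?d i)"
        by (rule lp_norm_mono[OF A.p_ge_1])
      then show "lp_norm p n ?b \<le> ?L * ?v * lp_norm p n ?d"
        unfolding lp_norm_scale[OF A.p_ge_1] using nonneg by simp
      show "?V \<le> ?u * ?W"
        using A by (intro weak_norm_compose[OF A.F A.q_ge_1 _ B.F u]) auto
      show "0 \<le> ?V"
        using z' by (intro weak_norm_nonneg[OF B.F A.q_ge_1]) auto
    qed (use nonneg lp_norm_nonneg[OF A.p_ge_1] in auto)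
    finally show "(\<Sum>i<n. \<bar>z i (S (x i, e i) \<ominus>\<^bsub>F\<^esub> S (y i, e i))\<bar>)
        \<le> ?u * ?C * ?L * ?v * lp_norm p n ?d * ?W"
      by (simp add: mult_ac)
  qed
  show "S \<in> cohen_LipL p X E F"
  proof (rule A.cohen_LipL_I[OF _ _ _ bound])
    show "linear_on E F (\<lambda>e. S (x, e))" if x: "x \<in> pts X" for x
      unfolding linear_on_def
    proof (intro conjI ballI allI)
      show "(\<lambda>e. S (x, e)) \<in> carrier E \<rightarrow> carrier F"
        using x T_closed linear_onD(1)[OF u_lin] by (auto simp: S_def)
      show "S (x, e \<oplus>\<^bsub>E\<^esub> e') = S (x, e) \<oplus>\<^bsub>F\<^esub> S (x, e')"
        if "e \<in> carrier E" "e' \<in> carrier E" for e e'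
        using x that T_closed v_closed linear_onD(2)[OF v_lin] linear_onD(2)[OF T_lin[OF f_closed[OF x]]]
          linear_onD(2)[OF u_lin]
        by (simp add: S_def)
      show "S (x, c \<odot>\<^bsub>E\<^esub> e) = c \<odot>\<^bsub>F\<^esub> S (x, e)" if "e \<in> carrier E" for c e
        using x that T_closed v_closed linear_onD(3)[OF v_lin] linear_onD(3)[OF T_lin[OF f_closed[OF x]]]
          linear_onD(3)[OF u_lin]
        by (simp add: S_def)
    qed
    show "S (base X, e) = \<zero>\<^bsub>F\<^esub>" if "e \<in> carrier E" for e
      using that f T' v_closed[OF that] A.base_in_pts linear_on_zero[OF B.F A.F u_lin]
      by (simp add: S_def Lip0_def carrier_LipL0)
  qed (use nonneg in \<open>auto simp: S_def\<close>)
  show "cohen_LipL_norm p X E F S \<le> ?u * ?C * ?L * ?v"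
    using bound nonneg by (intro A.cohen_norm_le) auto
qed


section \<open>The multiplication of the reals\<close>

context
  fixes j :: "real \<Rightarrow> 'u" and p :: ereal
  assumes j: "inj j" and p: "1 < p"
begin

lemma inv_j [simp]: "the_inv j (j a) = a"
  using j by (rule the_inv_f_f)

lemma pts_real_copy [simp]: "pts (real_pmspace_copy j) = range j"
  and pdist_real_copy [simp]:
    "pdist (real_pmspace_copy j) = (\<lambda>a b. dist (the_inv j a) (the_inv j b))"
  and base_real_copy [simp]: "base (real_pmspace_copy j) = j 0"
proof -
  interpret Metric_space "range j" "\<lambda>a b. dist (the_inv j a) (the_inv j b)"
    by unfold_locales (auto simp: dist_commute intro: dist_triangle)
  show "pts (real_pmspace_copy j) = range j"
    "pdist (real_pmspace_copy j) = (\<lambda>a b. dist (the_inv j a) (the_inv j b))"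
    "base (real_pmspace_copy j) = j 0"
    by (simp_all add: real_pmspace_copy_def)
qed

lemma real_nspace_copy_simps [simp]:
  "carrier (real_nspace_copy j) = range j" "\<zero>\<^bsub>real_nspace_copy j\<^esub> = j 0"
  "a \<oplus>\<^bsub>real_nspace_copy j\<^esub> b = j (the_inv j a + the_inv j b)"
  "c \<odot>\<^bsub>real_nspace_copy j\<^esub> a = j (c * the_inv j a)"
  "nrm (real_nspace_copy j) a = \<bar>the_inv j a\<bar>"
  by (simp_all add: real_nspace_copy_def)

lemma normed_space_real_copy: "normed_space (real_nspace_copy j)"
proof -
  have "Module.module real_ring (real_nspace_copy j)"
    by (rule real_moduleI) (auto simp: algebra_simps)
  then show ?thesis
    by (intro normed_space.intro normed_space_axioms.intro)
       (auto simp: abs_mult injD[OF j] intro: abs_triangle_ineq)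
qed

text \<open>Multiplication is an operator of rank one, which bounds its norm by 1. The bound from below is
  the Lipschitz estimate for the points 1 and 0 and the vector 1.\<close>

lemma cohen_real_mult:
  "real_mult_copy j \<in> cohen_LipL p (real_pmspace_copy j) (real_nspace_copy j) (real_nspace_copy j)"
  "cohen_LipL_norm p (real_pmspace_copy j) (real_nspace_copy j) (real_nspace_copy j) (real_mult_copy j) = 1"
proof -
  let ?X = "real_pmspace_copy j" and ?E = "real_nspace_copy j"
  interpret cohen_setting ?X ?E ?E p
    by (rule cohen_settingI) (auto simp: p pointed_metric_space_def normed_space_real_copy)
  let ?\<phi> = "\<lambda>a\<in>range j. the_inv j a"
  let ?T = "\<lambda>(x, e)\<in>pts ?X \<times> carrier ?E. (the_inv j x * ?\<phi> e) \<odot>\<^bsub>?E\<^esub> j 1"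
  have T: "real_mult_copy j = ?T"
    by (auto simp: real_mult_copy_def restrict_def fun_eq_iff)
  have \<phi>: "?\<phi> \<in> carrier (dual ?E)"
    using dualI[OF E, of "the_inv j" 1] by auto
  show mem: "real_mult_copy j \<in> cohen_LipL p ?X ?E ?E"
    unfolding T by (rule rank_one_cohen[OF _ _ \<phi>, of _ 1]) (auto simp: dist_real_def)
  have "cohen_LipL_bound p ?X ?E ?E ?T (1 * 1 * nrm ?E (j 1))"
    by (rule rank_one_bound) (auto simp: dist_real_def)
  then have "cohen_LipL_norm p ?X ?E ?E (real_mult_copy j) \<le> 1"
    unfolding T by (intro cohen_norm_le) auto
  moreover have "1 \<le> cohen_LipL_norm p ?X ?E ?E (real_mult_copy j)"
  proof -
    have "nrm ?E (real_mult_copy j (j 1, j 1) \<ominus>\<^bsub>?E\<^esub> real_mult_copy j (j 0, j 1))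
        \<le> LipL_norm ?X ?E ?E (real_mult_copy j) * pdist ?X (j 1) (j 0) * nrm ?E (j 1)"
      by (rule LipL_boundD[OF LipL_bound_norm[OF cohen_LipL_LipL0[OF mem]]]) auto
    then have "1 \<le> LipL_norm ?X ?E ?E (real_mult_copy j)"
      by (simp add: E.diff_eq real_mult_copy_def)
    then show ?thesis
      using LipL_norm_le_cohen_norm[OF mem] by simp
  qed
  ultimately show "cohen_LipL_norm p ?X ?E ?E (real_mult_copy j) = 1"
    by simp
qed

end

theorem banach_LipL_ideal_cohen:
  assumes p: "1 < p"
  shows "banach_LipL_ideal (cohen_LipL p) (cohen_LipL_norm p)"
  unfolding banach_LipL_ideal_def
proof (intro conjI allI impI, goal_cases)
  case (1 X E F)
  then interpret cohen_setting X E F p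
    by (intro cohen_settingI) (auto simp: p normed_space_of_banach_space)
  show ?case
    by (rule submodule_cohen)
next
  case (2 X E F)
  then interpret cohen_setting X E F p
    by (intro cohen_settingI) (auto simp: p normed_space_of_banach_space)
  show ?case
  proof (intro ballI)
    fix f \<phi> v
    assume f: "f \<in> sharp X" and \<phi>: "\<phi> \<in> carrier (dual E)" and v: "v \<in> carrier F"
    then obtain L where "L > 0" "\<forall>x\<in>pts X. \<forall>y\<in>pts X. dist (f x) (f y) \<le> L * pdist X x y"
      by (auto simp: sharp_def Lip0_def Lipschitz_continuous_map_pos)
    then show "(\<lambda>(x, e)\<in>pts X \<times> carrier E. (f x * \<phi> e) \<odot>\<^bsub>F\<^esub> v) \<in> cohen_LipL p X E F"
      using f \<phi> v by (intro rank_one_cohen[of f L]) (auto simp: dist_real_def sharp_def Lip0_def)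
  qed
next
  case (3 X E F)
  then interpret cohen_setting X E F p
    by (intro cohen_settingI) (auto simp: p normed_space_of_banach_space)
  show ?case
    using 3 by (intro banach_space_cohen) auto
next
  case (4 X E F)
  then interpret cohen_setting X E F p
    by (intro cohen_settingI) (auto simp: p normed_space_of_banach_space)
  show ?case
    using LipL_norm_le_cohen_norm by blast
next
  case (5 j)
  then show ?case
    using p by (rule cohen_real_mult(1))
next
  case (6 j)
  then show ?case
    using p by (rule cohen_real_mult(2))
next
  case (7 X X\<^sub>0 E E\<^sub>0 F\<^sub>0 F f v T u)
  then have "cohen_setting X E F p" "cohen_setting X\<^sub>0 E\<^sub>0 F\<^sub>0 p"
    by (auto simp: p normed_space_of_banach_space intro!: cohen_settingI)
  with 7 show ?case
    using cohen_ideal_property[of X E F p X\<^sub>0 E\<^sub>0 F\<^sub>0 f v T u] by (simp add: Let_def)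
qed


section \<open>Factorization\<close>

lemma admissible_strongly_summing:
  assumes "1 < p" "normed_space F" "normed_space G"
  shows "admissible (strongly_summing_bound p G F u)"
  unfolding strongly_summing_bound_def
  using assms conj_exp_ge_1[OF assms(1)]
  by (intro admissible_intros) (auto simp: lp_norm_nonneg intro!: weak_norm_nonneg)

lemma strongly_summing_boundD:
  assumes "strongly_summing_bound p G F u C"
    and "\<And>i. i < n \<Longrightarrow> g i \<in> carrier G" "\<And>i. i < n \<Longrightarrow> z i \<in> carrier (dual F)"
  shows "(\<Sum>i<n. \<bar>z i (u (g i))\<bar>)
    \<le> C * lp_norm p n (\<lambda>i. nrm G (g i)) * weak_norm (conj_exp p) F n z"
  using assms unfolding strongly_summing_bound_def by blast

text \<open>The inequality for \<open>u\<close> at the differences of values of \<open>S\<close>.\<close>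

lemma (in cohen_setting) composition_cohen_bound:
  fixes G :: "'g nspace"
  assumes G: "normed_space G" and S: "S \<in> carrier (LipL0 X E G)"
    and u: "u \<in> strongly_summing p G F"
  shows "cohen_LipL_bound p X E F (compose (pts X \<times> carrier E) u S)
      (strongly_summing_norm p G F u * LipL_norm X E G S)"
    and "0 \<le> strongly_summing_norm p G F u * LipL_norm X E G S"
proof -
  interpret G: LipL_setting X E G
    using X E G by (rule LipL_setting.intro)
  let ?T = "compose (pts X \<times> carrier E) u S"
  let ?C = "strongly_summing_norm p G F u" and ?L = "LipL_norm X E G S"
  have L: "0 \<le> ?L"
    using S by (rule G.LipL_norm_nonneg)
  have ex: "\<exists>C>0. strongly_summing_bound p G F u C"
    using u by (simp add: strongly_summing_def)
  have C: "0 \<le> ?C"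
    unfolding strongly_summing_norm_def using ex by (rule Inf_admissible_nonneg)
  have bound: "strongly_summing_bound p G F u ?C"
    unfolding strongly_summing_norm_def
    using admissible_strongly_summing[OF p F G] ex by (rule Inf_admissible)
  show "0 \<le> ?C * ?L"
    using C L by simp
  show "cohen_LipL_bound p X E F ?T (?C * ?L)"
    unfolding cohen_LipL_bound_def
  proof (intro allI impI)
    fix n :: nat and x y e z
    assume A: "\<forall>i<n. x i \<in> pts X \<and> y i \<in> pts X \<and> e i \<in> carrier E \<and> z i \<in> carrier (dual F)"
    let ?g = "\<lambda>i. S (x i, e i) \<ominus>\<^bsub>G\<^esub> S (y i, e i)"
    let ?d = "\<lambda>i. pdist X (x i) (y i) * nrm E (e i)"
    let ?W = "weak_norm (conj_exp p) F n z"
    have W: "0 \<le> ?W"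
      using A by (intro weak_norm_nonneg[OF F q_ge_1]) auto
    have g: "?g i \<in> carrier G" if "i < n" for i
      using A that S G.LipL0_closed by auto
    have "linear_on G F u"
      using u by (simp add: strongly_summing_def carrier_blin)
    then have "?T (x i, e i) \<ominus>\<^bsub>F\<^esub> ?T (y i, e i) = u (?g i)" if "i < n" for i
      using A that S G.LipL0_closed by (simp add: compose_def linear_on_diff[OF G F])
    then have "(\<Sum>i<n. \<bar>z i (?T (x i, e i) \<ominus>\<^bsub>F\<^esub> ?T (y i, e i))\<bar>) = (\<Sum>i<n. \<bar>z i (u (?g i))\<bar>)"
      by simp
    also have "\<dots> \<le> ?C * lp_norm p n (\<lambda>i. nrm G (?g i)) * ?W"
      using g A by (intro strongly_summing_boundD[OF bound]) auto
    also have "\<dots> \<le> ?C * (?L * lp_norm p n ?d) * ?W"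
    proof (intro mult_right_mono mult_left_mono)
      have "\<bar>nrm G (?g i)\<bar> \<le> \<bar>?L * ?d i\<bar>" if "i < n" for i
      proof -
        have "nrm G (?g i) \<le> ?L * pdist X (x i) (y i) * nrm E (e i)"
          using G.LipL_bound_norm[OF S] A that unfolding LipL_bound_def by blast
        then show ?thesis
          using G.F.nrm_nonneg[OF g[OF that]] by (simp add: mult.assoc)
      qed
      then have "lp_norm p n (\<lambda>i. nrm G (?g i)) \<le> lp_norm p n (\<lambda>i. ?L * ?d i)"
        by (rule lp_norm_mono[OF p_ge_1])
      then show "lp_norm p n (\<lambda>i. nrm G (?g i)) \<le> ?L * lp_norm p n ?d"
        unfolding lp_norm_scale[OF p_ge_1] using L by simp
    qed (use C W in auto)
    finally show "(\<Sum>i<n. \<bar>z i (?T (x i, e i) \<ominus>\<^bsub>F\<^esub> ?T (y i, e i))\<bar>)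
        \<le> ?C * ?L * lp_norm p n ?d * ?W"
      by (simp add: mult_ac)
  qed
qed

locale factor_setting = LipL_setting X E F
  for X :: "'x pmspace" and E :: "'e nspace" and F :: "'f nspace" +
  fixes T :: "'x \<times> 'e \<Rightarrow> 'f"
  assumes T: "T \<in> carrier (LipL0 X E F)"
begin

abbreviation \<Delta> :: "'x \<Rightarrow> 'x \<Rightarrow> 'e \<Rightarrow> 'f" where
  "\<Delta> x y e \<equiv> T (x, e) \<ominus>\<^bsub>F\<^esub> T (y, e)"

lemma \<Delta>_closed: "\<lbrakk>x \<in> pts X; y \<in> pts X; e \<in> carrier E\<rbrakk> \<Longrightarrow> \<Delta> x y e \<in> carrier F"
  using T by (simp add: LipL0_closed)

definition polar_bound :: "('f \<Rightarrow> real) \<Rightarrow> real \<Rightarrow> bool" where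
  "polar_bound z c \<longleftrightarrow> (\<forall>x\<in>pts X. \<forall>y\<in>pts X. \<forall>e\<in>carrier E. \<bar>z (\<Delta> x y e)\<bar> \<le> c * pdist X x y * nrm E e)"

text \<open>This says that \<open>g\<close> belongs to \<open>r\<close> times the bipolar of the set of all \<open>\<Delta> x y e\<close> of weight
  \<open>pdist X x y * nrm E e \<le> 1\<close>, for \<open>r \<ge> 0\<close>. With a constant \<open>c\<close> in place of the supremum of
  \<open>\<bar>z\<bar>\<close> over this set, the inequality is linear in \<open>r\<close>.\<close>

definition bipolar_bound :: "'f \<Rightarrow> real \<Rightarrow> bool" where
  "bipolar_bound g r \<longleftrightarrow> (\<forall>z\<in>carrier (dual F). \<forall>c. 0 \<le> c \<and> polar_bound z c \<longrightarrow> \<bar>z g\<bar> \<le> r * c)"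

definition factor_space :: "'f nspace" where
  "factor_space = F\<lparr>carrier := {g \<in> carrier F. \<exists>r. bipolar_bound g r},
     nrm := \<lambda>g. Inf {r. 0 < r \<and> bipolar_bound g r}\<rparr>"

lemma factor_space_simps [simp]:
  "g \<in> carrier factor_space \<longleftrightarrow> g \<in> carrier F \<and> (\<exists>r. bipolar_bound g r)"
  "\<zero>\<^bsub>factor_space\<^esub> = \<zero>\<^bsub>F\<^esub>"
  "g \<oplus>\<^bsub>factor_space\<^esub> h = g \<oplus>\<^bsub>F\<^esub> h"
  "c \<odot>\<^bsub>factor_space\<^esub> g = c \<odot>\<^bsub>F\<^esub> g"
  by (simp_all add: factor_space_def)

lemma admissible_polar: "admissible (polar_bound z)"
  unfolding polar_bound_def by (intro admissible_intros) (auto simp: E.nrm_nonneg)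

lemma admissible_bipolar: "admissible (bipolar_bound g)"
  unfolding bipolar_bound_def by (intro admissible_intros) auto

lemma bipolar_bound_nrm: "g \<in> carrier factor_space \<Longrightarrow> bipolar_bound g (nrm factor_space g)"
  using Inf_admissible[OF admissible_bipolar, of g] admissible_ex_pos[OF admissible_bipolar, of g]
  by (auto simp: factor_space_def)

lemma factor_nrm_nonneg: "g \<in> carrier factor_space \<Longrightarrow> 0 \<le> nrm factor_space g"
  using Inf_admissible_nonneg[of "bipolar_bound g"] admissible_ex_pos[OF admissible_bipolar, of g]
  by (auto simp: factor_space_def)

lemma factor_nrm_le: "\<lbrakk>bipolar_bound g r; 0 \<le> r\<rbrakk> \<Longrightarrow> nrm factor_space g \<le> r"
  using Inf_admissible_le[OF admissible_bipolar, of g] by (simp add: factor_space_def)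

lemma bipolar_boundD:
  "\<lbrakk>bipolar_bound g r; z \<in> carrier (dual F); 0 \<le> c; polar_bound z c\<rbrakk> \<Longrightarrow> \<bar>z g\<bar> \<le> r * c"
  by (simp add: bipolar_bound_def)

lemma polar_bound_dual:
  assumes z: "z \<in> carrier (dual F)"
  shows "polar_bound z (nrm (dual F) z * LipL_norm X E F T)"
  unfolding polar_bound_def
proof (intro ballI)
  fix x y e assume A: "x \<in> pts X" "y \<in> pts X" "e \<in> carrier E"
  have "\<bar>z (\<Delta> x y e)\<bar> \<le> nrm (dual F) z * nrm F (\<Delta> x y e)"
    using z A by (intro dual_bound[OF F] \<Delta>_closed)
  also have "\<dots> \<le> nrm (dual F) z * (LipL_norm X E F T * pdist X x y * nrm E e)"
    using LipL_bound_norm[OF T] A blin_norm_nonneg[OF F normed_space_real_line z]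
    unfolding LipL_bound_def by (intro mult_left_mono) auto
  finally show "\<bar>z (\<Delta> x y e)\<bar> \<le> nrm (dual F) z * LipL_norm X E F T * pdist X x y * nrm E e"
    by (simp add: mult.assoc)
qed

text \<open>A norming functional of \<open>g\<close> satisfies \<open>polar_bound\<close> with the Lipschitz constant of \<open>T\<close>.\<close>

lemma nrm_le_bipolar:
  assumes g: "g \<in> carrier F" and bound: "bipolar_bound g r"
  shows "nrm F g \<le> LipL_norm X E F T * r"
proof -
  obtain z where z: "z \<in> carrier (dual F)" "nrm (dual F) z \<le> 1" "\<bar>z g\<bar> = nrm F g"
    using norming_dual[OF F g] by metis
  have "nrm (dual F) z * LipL_norm X E F T \<le> 1 * LipL_norm X E F T"
    using z LipL_norm_nonneg[OF T] by (intro mult_right_mono)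
  then have "polar_bound z (LipL_norm X E F T)"
    using admissible_mono[OF admissible_polar polar_bound_dual[OF z(1)]] by simp
  then show ?thesis
    using bipolar_boundD[OF bound z(1) LipL_norm_nonneg[OF T]] z(3) by (simp add: mult.commute)
qed

lemma bipolar_bound_add:
  assumes "g \<in> carrier F" "h \<in> carrier F" "bipolar_bound g r" "bipolar_bound h s"
  shows "bipolar_bound (g \<oplus>\<^bsub>F\<^esub> h) (r + s)"
  unfolding bipolar_bound_def
proof (intro ballI allI impI)
  fix z c assume "z \<in> carrier (dual F)" "0 \<le> c \<and> polar_bound z c"
  then show "\<bar>z (g \<oplus>\<^bsub>F\<^esub> h)\<bar> \<le> (r + s) * c"
    using bipolar_boundD[OF assms(3), of z c] bipolar_boundD[OF assms(4), of z c] assms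
    by (simp add: dual_add[OF F] distrib_right)
qed

lemma bipolar_bound_scale:
  assumes "g \<in> carrier F" "bipolar_bound g r"
  shows "bipolar_bound (a \<odot>\<^bsub>F\<^esub> g) (\<bar>a\<bar> * r)"
  unfolding bipolar_bound_def
proof (intro ballI allI impI)
  fix z c assume "z \<in> carrier (dual F)" "0 \<le> c \<and> polar_bound z c"
  then show "\<bar>z (a \<odot>\<^bsub>F\<^esub> g)\<bar> \<le> \<bar>a\<bar> * r * c"
    using bipolar_boundD[OF assms(2), of z c] assms
    by (simp add: dual_scale[OF F] abs_mult mult.assoc mult_left_mono)
qed

lemma bipolar_bound_zero: "bipolar_bound \<zero>\<^bsub>F\<^esub> 0"
  by (simp add: bipolar_bound_def dual_zero[OF F])

lemma normed_space_factor: "normed_space factor_space"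
proof -
  let ?N = "nrm factor_space"
  have scale_mem: "a \<odot>\<^bsub>F\<^esub> g \<in> carrier factor_space" if "g \<in> carrier factor_space" for a g
    using that bipolar_bound_scale by auto
  have N_scale: "?N (a \<odot>\<^bsub>F\<^esub> g) \<le> \<bar>a\<bar> * ?N g" if g: "g \<in> carrier factor_space" for a g
    using g factor_nrm_nonneg[OF g]
    by (intro factor_nrm_le bipolar_bound_scale bipolar_bound_nrm) auto
  have "Module.module real_ring factor_space"
    by (rule real_moduleI)
       (auto simp: F.M.a_assoc F.M.a_lcomm F.M.a_comm F.scale_add_left F.scale_add_right F.scale_scale
         intro: bipolar_bound_zero bipolar_bound_add bipolar_bound_scale)
  moreover have "?N (a \<odot>\<^bsub>factor_space\<^esub> g) = \<bar>a\<bar> * ?N g" if g: "g \<in> carrier factor_space" for a g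
  proof (cases "a = 0")
    case True
    then show ?thesis
      using N_scale[OF g, of a] factor_nrm_nonneg[OF scale_mem[OF g], of a] by simp
  next
    case False
    then have "inverse a \<odot>\<^bsub>F\<^esub> (a \<odot>\<^bsub>F\<^esub> g) = g"
      using g by (simp add: F.scale_scale)
    then have "?N g \<le> \<bar>inverse a\<bar> * ?N (a \<odot>\<^bsub>F\<^esub> g)"
      using N_scale[OF scale_mem[OF g], of "inverse a" a] by simp
    then have "\<bar>a\<bar> * ?N g \<le> ?N (a \<odot>\<^bsub>F\<^esub> g)"
      using False by (simp add: field_simps abs_inverse)
    then show ?thesis
      using N_scale[OF g, of a] by simp
  qed
  moreover have "?N g = 0 \<longleftrightarrow> g = \<zero>\<^bsub>factor_space\<^esub>" if g: "g \<in> carrier factor_space" for g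
  proof
    assume "?N g = 0"
    then have "nrm F g = 0"
      using nrm_le_bipolar[OF _ bipolar_bound_nrm[OF g]] g F.nrm_nonneg[of g] by simp
    then show "g = \<zero>\<^bsub>factor_space\<^esub>"
      using g by (simp add: F.nrm_eq_0)
  next
    assume "g = \<zero>\<^bsub>factor_space\<^esub>"
    then show "?N g = 0"
      using factor_nrm_le[OF bipolar_bound_zero] factor_nrm_nonneg[OF g] by simp
  qed
  moreover have "?N (g \<oplus>\<^bsub>factor_space\<^esub> h) \<le> ?N g + ?N h"
    if "g \<in> carrier factor_space" "h \<in> carrier factor_space" for g h
    using that factor_nrm_nonneg[OF that(1)] factor_nrm_nonneg[OF that(2)] bipolar_bound_nrm
    unfolding factor_space_simps(3) by (intro factor_nrm_le bipolar_bound_add) auto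
  ultimately show ?thesis
    by (intro normed_space.intro normed_space_axioms.intro factor_nrm_nonneg)
qed

lemma factor_diff:
  assumes "g \<in> carrier factor_space" "h \<in> carrier factor_space"
  shows "g \<ominus>\<^bsub>factor_space\<^esub> h = g \<ominus>\<^bsub>F\<^esub> h"
  using normed_space.diff_eq[OF normed_space_factor assms] assms by (simp add: F.diff_eq)

lemma banach_space_factor:
  assumes "banach_space F"
  shows "banach_space factor_space"
proof (rule banach_space_by_evaluations[where ev = "\<lambda>_ g. g" and I = "{()}",
      OF normed_space_factor assms])
  show "\<exists>c. \<forall>g\<in>carrier factor_space. nrm F g \<le> c * nrm factor_space g"
    using nrm_le_bipolar bipolar_bound_nrm by (intro exI[of _ "LipL_norm X E F T"]) auto
next
  fix \<sigma> :: "nat \<Rightarrow> 'f" and l r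
  assume \<sigma>: "\<And>n. \<sigma> n \<in> carrier factor_space" and r: "\<And>n. nrm factor_space (\<sigma> n) \<le> r"
    and l: "\<And>i. i \<in> {()} \<Longrightarrow> l i \<in> carrier F"
    and lim: "\<And>i. i \<in> {()} \<Longrightarrow> (\<lambda>n. nrm F (\<sigma> n \<ominus>\<^bsub>F\<^esub> l i)) \<longlonglongrightarrow> 0"
  have "bipolar_bound (l ()) r"
    unfolding bipolar_bound_def
  proof (intro ballI allI impI)
    fix z c assume z: "z \<in> carrier (dual F)" and c: "0 \<le> c \<and> polar_bound z c"
    have "(\<lambda>n. \<bar>z (\<sigma> n)\<bar>) \<longlonglongrightarrow> \<bar>z (l ())\<bar>"
      using tendsto_dual[OF F z, of \<sigma> "l ()"] \<sigma> l lim by (intro tendsto_rabs) auto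
    moreover have "\<bar>z (\<sigma> n)\<bar> \<le> r * c" for n
      using admissible_mono[OF admissible_bipolar bipolar_bound_nrm[OF \<sigma>] r] z c
      by (intro bipolar_boundD) auto
    ultimately show "\<bar>z (l ())\<bar> \<le> r * c"
      by (intro LIMSEQ_le_const2) auto
  qed
  moreover have "0 \<le> r"
    using factor_nrm_nonneg[OF \<sigma>] r by (rule order_trans)
  ultimately show "\<exists>g\<in>carrier factor_space. nrm factor_space g \<le> r \<and> (\<forall>i\<in>{()}. g = l i)"
    using l factor_nrm_le by (intro bexI[of _ "l ()"]) auto
qed (auto simp: factor_diff)

lemma bipolar_bound_difference:
  assumes "x \<in> pts X" "y \<in> pts X" "e \<in> carrier E"
  shows "bipolar_bound (\<Delta> x y e) (pdist X x y * nrm E e)"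
  using assms by (auto simp: bipolar_bound_def polar_bound_def mult_ac)

lemma value_in_factor_space:
  assumes "x \<in> pts X" "e \<in> carrier E"
  shows "T (x, e) \<in> carrier factor_space"
proof -
  have "\<Delta> x (base X) e = T (x, e)"
    using T assms by (simp add: carrier_LipL0 LipL0_closed)
  then show ?thesis
    using bipolar_bound_difference[of x "base X" e] assms base_in_pts LipL0_closed[OF T assms] by auto
qed

lemma LipL_bound_factor: "LipL_bound X E factor_space T 1"
  unfolding LipL_bound_def
proof (intro ballI)
  fix x y e assume A: "x \<in> pts X" "y \<in> pts X" "e \<in> carrier E"
  then show "nrm factor_space (T (x, e) \<ominus>\<^bsub>factor_space\<^esub> T (y, e)) \<le> 1 * pdist X x y * nrm E e"
    using factor_nrm_le[OF bipolar_bound_difference[OF A]] E.nrm_nonneg[OF A(3)]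
    by (simp add: factor_diff value_in_factor_space del: factor_space_simps(1))
qed

lemma LipL0_factor: "T \<in> carrier (LipL0 X E factor_space)"
proof -
  interpret G: LipL_setting X E factor_space
    using X E normed_space_factor by (rule LipL_setting.intro)
  show ?thesis
  proof (rule G.LipL0_I[OF _ _ _ LipL_bound_factor])
    show "linear_on E factor_space (\<lambda>e. T (x, e))" if x: "x \<in> pts X" for x
    proof -
      have "linear_on E F (\<lambda>e. T (x, e))"
        using T x by (simp add: carrier_LipL0)
      then show ?thesis
        using value_in_factor_space[OF x] by (simp add: linear_on_def Pi_iff)
    qed
  qed (use T in \<open>auto simp: carrier_LipL0\<close>)
qed

abbreviation inclusion :: "'f \<Rightarrow> 'f" where
  "inclusion \<equiv> \<lambda>g\<in>carrier factor_space. g"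

lemma inclusion_blin: "inclusion \<in> carrier (blin factor_space F)"
  unfolding carrier_blin
proof (intro conjI exI ballI)
  interpret G: normed_space factor_space by (rule normed_space_factor)
  show "linear_on factor_space F inclusion"
    using G.M.a_closed G.scale_closed by (auto simp: linear_on_def)
  show "nrm F (inclusion g) \<le> LipL_norm X E F T * nrm factor_space g"
    if "g \<in> carrier factor_space" for g
    using nrm_le_bipolar[OF _ bipolar_bound_nrm[OF that]] that by simp
qed simp

lemma compose_inclusion: "compose (pts X \<times> carrier E) inclusion T = T"
proof (rule extensionalityI[of _ "pts X \<times> carrier E"])
  show "T \<in> extensional (pts X \<times> carrier E)"
    using T by (simp add: carrier_LipL0)
  show "compose (pts X \<times> carrier E) inclusion T a = T a" if "a \<in> pts X \<times> carrier E" for a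
    using that value_in_factor_space by (cases a) (simp add: compose_def del: factor_space_simps(1))
qed (simp add: compose_def)

text \<open>By homogeneity in \<open>e\<close>, the least constant \<open>c\<close> with \<open>polar_bound z c\<close> is almost attained at
  differences of any prescribed weight \<open>w\<close>.\<close>

lemma polar_almost_attained:
  assumes z: "z \<in> carrier (dual F)" and w: "0 \<le> w" and \<epsilon>: "0 < \<epsilon>"
  defines "c \<equiv> Inf {c. 0 < c \<and> polar_bound z c}"
  shows "\<exists>x y e. x \<in> pts X \<and> y \<in> pts X \<and> e \<in> carrier E \<and> pdist X x y * nrm E e \<le> w \<and>
    (c - \<epsilon>) * w \<le> \<bar>z (\<Delta> x y e)\<bar>"
proof (cases "c - \<epsilon> < 0")
  case True
  \<comment> \<open>The zero difference suffices.\<close>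
  then have "(c - \<epsilon>) * w \<le> 0"
    using w by (simp add: mult_nonpos_nonneg)
  then have "base X \<in> pts X \<and> base X \<in> pts X \<and> \<zero>\<^bsub>E\<^esub> \<in> carrier E \<and>
      pdist X (base X) (base X) * nrm E \<zero>\<^bsub>E\<^esub> \<le> w \<and> (c - \<epsilon>) * w \<le> \<bar>z (\<Delta> (base X) (base X) \<zero>\<^bsub>E\<^esub>)\<bar>"
    using w base_in_pts by simp
  then show ?thesis by blast
next
  case False
  \<comment> \<open>A constant \<open>c - \<epsilon> \<ge> 0\<close> that satisfies the bound makes the infimum \<open>c\<close> at most \<open>c - \<epsilon>\<close>, even for
    \<open>c - \<epsilon> = 0\<close>, because all larger constants are positive and satisfy it too.\<close>
  have "\<not> polar_bound z (c - \<epsilon>)"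
    using Inf_admissible_le[OF admissible_polar, of z "c - \<epsilon>"] False \<epsilon> by (auto simp: c_def)
  then obtain x y e where A: "x \<in> pts X" "y \<in> pts X" "e \<in> carrier E"
    and gt: "\<bar>z (\<Delta> x y e)\<bar> > (c - \<epsilon>) * pdist X x y * nrm E e"
    by (auto simp: polar_bound_def not_le)
  define t where "t = pdist X x y * nrm E e"
  have "t \<noteq> 0"
  proof
    assume "t = 0"
    moreover have "\<bar>z (\<Delta> x y e)\<bar> \<le> nrm (dual F) z * LipL_norm X E F T * t"
      using polar_bound_dual[OF z] A unfolding polar_bound_def t_def mult.assoc by blast
    moreover have "\<bar>z (\<Delta> x y e)\<bar> > (c - \<epsilon>) * t"
      using gt by (simp add: t_def mult.assoc)
    ultimately show False by simp
  qed
  then have t: "t > 0"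
    using E.nrm_nonneg[OF A(3)] by (simp add: t_def less_le)
  let ?e = "(w / t) \<odot>\<^bsub>E\<^esub> e"
  have "linear_on E F (\<lambda>e. T (x, e))" "linear_on E F (\<lambda>e. T (y, e))"
    using T A by (auto simp: carrier_LipL0)
  then have "\<Delta> x y ?e = (w / t) \<odot>\<^bsub>F\<^esub> \<Delta> x y e"
    using A by (simp add: linear_on_def F.scale_diff LipL0_closed[OF T])
  then have "z (\<Delta> x y ?e) = (w / t) * z (\<Delta> x y e)"
    using dual_scale[OF F z \<Delta>_closed[OF A]] by simp
  moreover have "(c - \<epsilon>) * w \<le> (w / t) * \<bar>z (\<Delta> x y e)\<bar>"
  proof -
    have "(w / t) * ((c - \<epsilon>) * t) \<le> (w / t) * \<bar>z (\<Delta> x y e)\<bar>"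
      using gt w t by (intro mult_left_mono) (auto simp: t_def mult.assoc)
    then show ?thesis
      using t by (simp add: mult_ac)
  qed
  moreover have "pdist X x y * nrm E ?e = w"
    using A w t \<open>t \<noteq> 0\<close> by (simp add: E.nrm_smult t_def)
  ultimately have "x \<in> pts X \<and> y \<in> pts X \<and> ?e \<in> carrier E \<and> pdist X x y * nrm E ?e \<le> w \<and>
      (c - \<epsilon>) * w \<le> \<bar>z (\<Delta> x y ?e)\<bar>"
    using A w t by (simp add: abs_mult)
  then show ?thesis by blast
qed

text \<open>If \<open>c\<^sub>i\<close> is the supremum of \<open>\<bar>z\<^sub>i\<bar>\<close> on the differences of weight at most 1, then
  \<open>\<bar>z\<^sub>i g\<^sub>i\<bar> \<le> c\<^sub>i * nrm g\<^sub>i\<close> by the choice of the norm, and the right-hand side is almost the value of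
  \<open>\<bar>z\<^sub>i\<bar>\<close> at a difference of weight \<open>nrm g\<^sub>i\<close>. So the inequality for the vectors \<open>g\<^sub>i\<close> follows from
  the one for these differences, with the same constant.\<close>

lemma strongly_summing_inclusion:
  assumes p: "1 < p" and C: "0 \<le> C" and bound: "cohen_LipL_bound p X E F T C"
  shows "strongly_summing_bound p factor_space F inclusion C"
  unfolding strongly_summing_bound_def
proof (intro allI impI)
  interpret cohen_setting X E F p
    by unfold_locales (rule p)
  fix n :: nat and g z
  assume A: "\<forall>i<n. g i \<in> carrier factor_space \<and> z i \<in> carrier (dual F)"
  define c where "c i = Inf {c. 0 < c \<and> polar_bound (z i) c}" for i
  let ?w = "\<lambda>i. nrm factor_space (g i)"
  let ?W = "weak_norm (conj_exp p) F n z"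
  have W: "0 \<le> ?W"
    using A by (intro weak_norm_nonneg[OF F q_ge_1]) auto
  have w: "0 \<le> ?w i" if "i < n" for i
    using A that factor_nrm_nonneg by blast
  have zg: "\<bar>z i (inclusion (g i))\<bar> \<le> ?w i * c i" if "i < n" for i
  proof -
    have gi: "g i \<in> carrier factor_space" and zi: "z i \<in> carrier (dual F)"
      using A that by auto
    have ex: "\<exists>c>0. polar_bound (z i) c"
      using admissible_ex_pos[OF admissible_polar polar_bound_dual[OF zi]] .
    have "\<bar>z i (g i)\<bar> \<le> ?w i * c i"
      using bipolar_boundD[OF bipolar_bound_nrm[OF gi] zi] Inf_admissible_nonneg[OF ex]
        Inf_admissible[OF admissible_polar ex] unfolding c_def .
    then show ?thesis
      using gi by simp
  qed
  have "(\<Sum>i<n. \<bar>z i (inclusion (g i))\<bar>) \<le> C * lp_norm p n ?w * ?W + \<delta>" if \<delta>: "\<delta> > 0" for \<delta>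
  proof -
    \<comment> \<open>The total loss is \<open>\<epsilon>\<close> times the sum of the weights.\<close>
    define \<epsilon> where "\<epsilon> = \<delta> / ((\<Sum>i<n. ?w i) + 1)"
    have sum_w: "0 \<le> (\<Sum>i<n. ?w i)"
      using w by (intro sum_nonneg) auto
    have \<epsilon>: "\<epsilon> > 0" "\<epsilon> * (\<Sum>i<n. ?w i) \<le> \<delta>"
      using \<delta> sum_w by (auto simp: \<epsilon>_def field_simps)
    have "\<exists>x y e. x \<in> pts X \<and> y \<in> pts X \<and> e \<in> carrier E \<and> pdist X x y * nrm E e \<le> ?w i \<and>
        (c i - \<epsilon>) * ?w i \<le> \<bar>z i (\<Delta> x y e)\<bar>" if "i < n" for i
      unfolding c_def using A that w \<epsilon>(1) by (intro polar_almost_attained) auto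
    then obtain x y e where xye: "\<And>i. i < n \<Longrightarrow> x i \<in> pts X" "\<And>i. i < n \<Longrightarrow> y i \<in> pts X"
      "\<And>i. i < n \<Longrightarrow> e i \<in> carrier E" "\<And>i. i < n \<Longrightarrow> pdist X (x i) (y i) * nrm E (e i) \<le> ?w i"
      "\<And>i. i < n \<Longrightarrow> (c i - \<epsilon>) * ?w i \<le> \<bar>z i (\<Delta> (x i) (y i) (e i))\<bar>"
      by metis
    have "(\<Sum>i<n. \<bar>z i (inclusion (g i))\<bar>) \<le> (\<Sum>i<n. ?w i * c i)"
      using zg by (intro sum_mono) auto
    also have "\<dots> = (\<Sum>i<n. (c i - \<epsilon>) * ?w i) + \<epsilon> * (\<Sum>i<n. ?w i)"
      by (simp add: sum_distrib_left sum.distrib[symmetric] algebra_simps)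
    also have "\<dots> \<le> (\<Sum>i<n. \<bar>z i (\<Delta> (x i) (y i) (e i))\<bar>) + \<delta>"
      using xye \<epsilon> by (intro add_mono sum_mono) auto
    also have "(\<Sum>i<n. \<bar>z i (\<Delta> (x i) (y i) (e i))\<bar>)
        \<le> C * lp_norm p n (\<lambda>i. pdist X (x i) (y i) * nrm E (e i)) * ?W"
      using A xye by (intro cohen_LipL_boundD[OF bound]) auto
    also have "\<dots> \<le> C * lp_norm p n ?w * ?W"
    proof (intro mult_right_mono mult_left_mono lp_norm_mono[OF p_ge_1] C W)
      show "\<bar>pdist X (x i) (y i) * nrm E (e i)\<bar> \<le> \<bar>?w i\<bar>" if "i < n" for i
        using xye[OF that] w[OF that] E.nrm_nonneg by simp
    qed
    finally show ?thesis by simp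
  qed
  then show "(\<Sum>i<n. \<bar>z i (inclusion (g i))\<bar>) \<le> C * lp_norm p n ?w * ?W"
    by (rule field_le_epsilon)
qed

end

text \<open>\<open>T\<close> has the constant 1 as an operator into \<open>factor_space\<close>, and the inclusion has the constant of
  \<open>T\<close>. With \<open>composition_cohen_bound\<close> it follows that the infimum in the norm of the composition ideal
  is attained here.\<close>

lemma (in cohen_setting) cohen_factorization:
  assumes F': "banach_space F" and T: "T \<in> cohen_LipL p X E F"
  shows "\<exists>(G :: 'f nspace) u. banach_space G \<and> T \<in> carrier (LipL0 X E G) \<and> u \<in> strongly_summing p G F \<and>
    T = compose (pts X \<times> carrier E) u T \<and>
    strongly_summing_norm p G F u * LipL_norm X E G T \<le> cohen_LipL_norm p X E F T"
proof -
  interpret T: factor_setting X E F T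
    by unfold_locales (rule cohen_LipL_LipL0[OF T])
  interpret G: LipL_setting X E T.factor_space
    using X E T.normed_space_factor by (rule LipL_setting.intro)
  let ?C = "cohen_LipL_norm p X E F T"
  have C: "0 \<le> ?C"
    using T by (rule cohen_norm_nonneg)
  have adm: "admissible (strongly_summing_bound p T.factor_space F T.inclusion)"
    using p F T.normed_space_factor by (rule admissible_strongly_summing)
  have bound: "strongly_summing_bound p T.factor_space F T.inclusion ?C"
    using p C cohen_bound_norm[OF T] by (rule T.strongly_summing_inclusion)
  have u: "T.inclusion \<in> strongly_summing p T.factor_space F"
    using T.inclusion_blin admissible_ex_pos[OF adm bound] unfolding strongly_summing_def by blast
  have "strongly_summing_norm p T.factor_space F T.inclusion \<le> ?C"
    unfolding strongly_summing_norm_def using adm bound C by (rule Inf_admissible_le)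
  moreover have "LipL_norm X E T.factor_space T \<le> 1"
    using T.LipL_bound_factor by (rule G.LipL_norm_le) simp
  ultimately have "strongly_summing_norm p T.factor_space F T.inclusion * LipL_norm X E T.factor_space T
      \<le> ?C * 1"
    using C G.LipL_norm_nonneg[OF T.LipL0_factor] by (intro mult_mono) auto
  then show ?thesis
    using T.banach_space_factor[OF F'] T.LipL0_factor u T.compose_inclusion by (metis mult.right_neutral)
qed

theorem corollary3p9:
  fixes p :: ereal
  assumes "1 < p" and "p \<le> \<infinity>"
  shows "banach_LipL_ideal
           (cohen_LipL p :: 'u LipL_class) (cohen_LipL_norm p :: 'u LipL_class_norm) \<and>
         (\<forall>(X :: 'u pmspace) (E :: 'u nspace) (F :: 'u nspace).
            pointed_metric_space X \<and> banach_space E \<and> banach_space F \<longrightarrow>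
              cohen_LipL p X E F = composition_ideal (strongly_summing p) X E F \<and>
              (\<forall>T \<in> cohen_LipL p X E F.
                 cohen_LipL_norm p X E F T =
                   composition_ideal_norm (strongly_summing p) (strongly_summing_norm p) X E F T))"
proof (intro conjI allI impI)
  show "banach_LipL_ideal (cohen_LipL p :: 'u LipL_class) (cohen_LipL_norm p)"
    using assms(1) by (rule banach_LipL_ideal_cohen)
next
  fix X :: "'u pmspace" and E F :: "'u nspace"
  assume XEF: "pointed_metric_space X \<and> banach_space E \<and> banach_space F"
  then interpret cohen_setting X E F p
    using assms(1) by (intro cohen_settingI) (auto simp: normed_space_of_banach_space)
  let ?fact = "factorization (strongly_summing p) X E F"
  have bound: "cohen_LipL_bound p X E F T (strongly_summing_norm p G F u * LipL_norm X E G S)"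
    "0 \<le> strongly_summing_norm p G F u * LipL_norm X E G S" if "?fact T G S u" for T G S u
    using that composition_cohen_bound[of G S u]
    by (auto simp: factorization_def normed_space_of_banach_space)
  have exists: "\<exists>G u. ?fact T G T u \<and>
      strongly_summing_norm p G F u * LipL_norm X E G T \<le> cohen_LipL_norm p X E F T"
    if "T \<in> cohen_LipL p X E F" for T
    using cohen_factorization[OF _ that] XEF unfolding factorization_def by blast
  show "cohen_LipL p X E F = composition_ideal (strongly_summing p) X E F"
  proof (intro equalityI subsetI)
    fix T assume "T \<in> cohen_LipL p X E F"
    then show "T \<in> composition_ideal (strongly_summing p) X E F"
      using exists cohen_LipL_LipL0 unfolding composition_ideal_def by blast
  next
    fix T assume "T \<in> composition_ideal (strongly_summing p) X E F"
    then show "T \<in> cohen_LipL p X E F"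
      using bound(1) admissible_ex_pos[OF admissible_cohen]
      unfolding composition_ideal_def cohen_LipL_def by blast
  qed
  show "\<forall>T \<in> cohen_LipL p X E F. cohen_LipL_norm p X E F T =
      composition_ideal_norm (strongly_summing p) (strongly_summing_norm p) X E F T"
  proof (intro ballI antisym)
    fix T assume T: "T \<in> cohen_LipL p X E F"
    let ?S = "{strongly_summing_norm p G F u * LipL_norm X E G S | G S u. ?fact T G S u}"
    obtain G u where Gu: "?fact T G T u"
      "strongly_summing_norm p G F u * LipL_norm X E G T \<le> cohen_LipL_norm p X E F T"
      using exists[OF T] by blast
    have "cohen_LipL_norm p X E F T \<le> Inf ?S"
    proof (rule cInf_greatest)
      show "?S \<noteq> {}"
        using Gu by blast
      show "cohen_LipL_norm p X E F T \<le> s" if "s \<in> ?S" for s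
        using that bound cohen_norm_le by blast
    qed
    then show "cohen_LipL_norm p X E F T
        \<le> composition_ideal_norm (strongly_summing p) (strongly_summing_norm p) X E F T"
      by (simp add: composition_ideal_norm_def)
    have "Inf ?S \<le> strongly_summing_norm p G F u * LipL_norm X E G T"
    proof (rule cInf_lower)
      show "bdd_below ?S"
        using bound(2) by (intro bdd_belowI[of _ 0]) blast
    qed (use Gu in blast)
    with Gu(2) show "composition_ideal_norm (strongly_summing p) (strongly_summing_norm p) X E F T
        \<le> cohen_LipL_norm p X E F T"
      by (simp add: composition_ideal_norm_def)
  qed
qed

end
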